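(* Let $n\ge 2$ be a fixed integer. Suppose that $\gamma$ is a curve in $\mathbb{S}^2$ of class $C^{n+1}$ on the relevant parameter interval, and that all data points $p_j=\gamma(jh)$, $j=i,\dots,i+n$, and all intermediate points generated by the SIDER-$n$ construction from them remain in a common geodesically convex ball of radius $O(h)$. Then $$d_{\mathbb{S}^2}\!\left(\gamma(\theta h),P_i^{[n]}(\theta;h)\right)\le C_n h^{n+1},\qquad i\le\theta\le i+n,$$ where $C_n$ is independent of $h$. In addition, the leading coefficient, i.e. the coefficient of $h^{n+1}$ in the local expansion of $\operatorname{Log}_{\gamma(\theta h)}P_i^{[n]}(\theta;h)$, has the shifted nodal form $$A_n(\theta)\prod_{j=i}^{i+n}(\theta-j).$$
   Context: $\mathbb{S}^2=\{x\in\mathbb{R}^3:|x|=1\}$ with the induced Riemannian metric; $d_{\mathbb{S}^2}(y,z)=\arccos(y\cdot z)$; $T_y\mathbb{S}^2=\{v\in\mathbb{R}^3:v\cdot y=0\}$. $\operatorname{Exp}_y(v)=\cos|v|\,y+\frac{\sin|v|}{|v|}v$ for $v\in T_y\mathbb{S}^2$ (with $\operatorname{Exp}_y(0)=y$). For $z$ not antipodal to $y$ and $\alpha=\arccos(y\cdot z)$, $\operatorname{Log}_y(z)=\frac{\alpha}{\sin\alpha}(z-(y\cdot z)y)\in T_y\mathbb{S}^2$ (with $\operatorname{Log}_y(y)=0$). For non-antipodal $a,b\in\mathbb{S}^2$ and any real $\lambda$, $\operatorname{SLERP}(a,b,\lambda)=\operatorname{Exp}_a(\lambda\operatorname{Log}_a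 b)$, equivalently $\frac{\sin((1-\lambda)\alpha)}{\sin\alpha}a+\frac{\sin(\lambda\alpha)}{\sin\alpha}b$ with $\alpha=\arccos(a\cdot b)\in(0,\pi)$. SIDER construction. Let $h>0$ and $p_j=\gamma(jh)$. For a stencil beginning at index $i$, the SIDER2 interpolant is, with $\tau=(\theta-i)/2$, $d_a=\operatorname{SLERP}(p_{i+2},p_{i+1},2)$, $d_b=\operatorname{SLERP}(p_i,p_{i+1},2)$, $$P_i^{[2]}(\theta;h)=\operatorname{SLERP}\bigl(\operatorname{SLERP}(p_i,d_a,\tau),\operatorname{SLERP}(d_b,p_{i+2},\tau),\tau\bigr).$$ For $k\ge3$, $P_i^{[k]}(\theta;h)=\operatorname{SLERP}\bigl(P_i^{[k-1]}(\theta;h),P_{i+1}^{[k-1]}(\theta;h),\frac{\theta-i}{k}\bigr)$. The physical evaluation parameter is $s=\theta h$. Conventions: $\gamma$ is a fixed curve and $h\to0^+$; $h$ is small enough that, in the common geodesically convex ball, logarithms are single-valued and geodesics unique. Local expansions in powers of $h$ are taken in normal coordinates at $y=\gamma(\theta h)$, with coefficients depending on the local jet of $\gamma$ at the parameter $\theta h$ (the derivatives at $\eta=0$ of $X(\eta)=\operatorname{Log}_{\gamma(\theta h)}\gamma(\theta h+\eta)$). $A_n(\theta)\in T_{\gamma(\theta h)}\mathbb{S}^2$ denotes a vector coefficient depending on this local jet but not on the stencil shift $i$. *)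

theory Defs
  imports "HOL-Analysis.Analysis"
begin

type_synonym vec3 = "real ^ 3"

abbreviation S2 :: "vec3 set" where
  "S2 \<equiv> sphere 0 1"

definition dist_S2 :: "vec3 \<Rightarrow> vec3 \<Rightarrow> real" where
  "dist_S2 y z = arccos (y \<bullet> z)"

definition tangent_S2 :: "vec3 \<Rightarrow> vec3 set" where
  "tangent_S2 y = {v. v \<bullet> y = 0}"

(* Since x / 0 = 0, the two formulas below give Exp_S2 y 0 = y and Log_S2 y y = 0
   without a case distinction. Log_S2 is meaningful only for non-antipodal arguments. *)
definition Exp_S2 :: "vec3 \<Rightarrow> vec3 \<Rightarrow> vec3" where
  "Exp_S2 y v = cos (norm v) *\<^sub>R y + (sin (norm v) / norm v) *\<^sub>R v"

definition Log_S2 :: "vec3 \<Rightarrow> vec3 \<Rightarrow> vec3" where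
  "Log_S2 y z =
     (let \<alpha> = arccos (y \<bullet> z) in (\<alpha> / sin \<alpha>) *\<^sub>R (z - (y \<bullet> z) *\<^sub>R y))"

definition slerp :: "vec3 \<Rightarrow> vec3 \<Rightarrow> real \<Rightarrow> vec3" where
  "slerp a b t = Exp_S2 a (t *\<^sub>R Log_S2 a b)"

definition geo_ball :: "vec3 \<Rightarrow> real \<Rightarrow> vec3 set" where
  "geo_ball c r = {z \<in> S2. dist_S2 c z < r}"

(* On the sphere two points are joined by a unique minimizing geodesic exactly when they
   are not antipodal; that geodesic is then the slerp arc over [0, 1]. *)
definition geodesically_convex :: "vec3 set \<Rightarrow> bool" where
  "geodesically_convex S \<longleftrightarrow>
     S \<subseteq> S2 \<and> (\<forall>x\<in>S. \<forall>y\<in>S. x \<noteq> - y \<and> (\<forall>t\<in>{0..1}. slerp x y t \<in> S))"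

definition sider2_a :: "(int \<Rightarrow> vec3) \<Rightarrow> int \<Rightarrow> vec3" where
  "sider2_a p i = slerp (p (i + 2)) (p (i + 1)) 2"

definition sider2_b :: "(int \<Rightarrow> vec3) \<Rightarrow> int \<Rightarrow> vec3" where
  "sider2_b p i = slerp (p i) (p (i + 1)) 2"

definition sider2_left :: "(int \<Rightarrow> vec3) \<Rightarrow> int \<Rightarrow> real \<Rightarrow> vec3" where
  "sider2_left p i \<theta> = slerp (p i) (sider2_a p i) ((\<theta> - of_int i) / 2)"

definition sider2_right :: "(int \<Rightarrow> vec3) \<Rightarrow> int \<Rightarrow> real \<Rightarrow> vec3" where
  "sider2_right p i \<theta> = slerp (sider2_b p i) (p (i + 2)) ((\<theta> - of_int i) / 2)"

(* sider p k i \<theta> is the SIDER-k interpolant of the stencil i, ..., i + k; it is left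
   unspecified for k < 2. *)
fun sider :: "(int \<Rightarrow> vec3) \<Rightarrow> nat \<Rightarrow> int \<Rightarrow> real \<Rightarrow> vec3" where
  "sider p (Suc (Suc 0)) i \<theta> =
     slerp (sider2_left p i \<theta>) (sider2_right p i \<theta>) ((\<theta> - of_int i) / 2)"
| "sider p (Suc (Suc (Suc m))) i \<theta> =
     slerp (sider p (Suc (Suc m)) i \<theta>) (sider p (Suc (Suc m)) (i + 1) \<theta>)
       ((\<theta> - of_int i) / of_nat (Suc (Suc (Suc m))))"

definition sider_points :: "(int \<Rightarrow> vec3) \<Rightarrow> nat \<Rightarrow> int \<Rightarrow> real \<Rightarrow> vec3 set" where
  "sider_points p n i \<theta> =
     p ` {i..i + int n} \<union>
     (\<Union>j\<in>{i..i + int n - 2}.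
        {sider2_a p j, sider2_b p j, sider2_left p j \<theta>, sider2_right p j \<theta>}) \<union>
     {sider p k j \<theta> |k j. 2 \<le> k \<and> k \<le> n \<and> i \<le> j \<and> j \<le> i + int n - int k}"

(* Iterated derivatives relative to a set, hence one-sided at the ends of a closed interval. *)
primrec vderivs :: "real set \<Rightarrow> nat \<Rightarrow> (real \<Rightarrow> vec3) \<Rightarrow> real \<Rightarrow> vec3" where
  "vderivs S 0 f = f"
| "vderivs S (Suc k) f = (\<lambda>x. vector_derivative (vderivs S k f) (at x within S))"

definition C_k_on :: "nat \<Rightarrow> (real \<Rightarrow> vec3) \<Rightarrow> real set \<Rightarrow> bool" where
  "C_k_on m f S \<longleftrightarrow>
     (\<forall>k<m. vderivs S k f differentiable_on S) \<and> continuous_on S (vderivs S m f)"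

definition samples :: "(real \<Rightarrow> vec3) \<Rightarrow> real \<Rightarrow> int \<Rightarrow> vec3" where
  "samples \<gamma> h j = \<gamma> (of_int j * h)"

definition stencil_in :: "nat \<Rightarrow> real \<Rightarrow> real \<Rightarrow> real \<Rightarrow> int \<Rightarrow> bool" where
  "stencil_in n a b h i \<longleftrightarrow> a \<le> of_int i * h \<and> of_int (i + int n) * h \<le> b"

(* Derivatives of orders 1, ..., m at \<eta> = 0 of the curve \<eta> \<mapsto> Log_S2 (\<gamma> s) (\<gamma> (s + \<eta>)),
   i.e. of \<gamma> in normal coordinates at \<gamma> s. *)
definition normal_jet :: "nat \<Rightarrow> (real \<Rightarrow> vec3) \<Rightarrow> real \<Rightarrow> real \<Rightarrow> real \<Rightarrow> vec3 list" where
  "normal_jet m \<gamma> a b s =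
     map (\<lambda>k. vderivs {a - s..b - s} k (\<lambda>\<eta>. Log_S2 (\<gamma> s) (\<gamma> (s + \<eta>))) 0) [1..<Suc m]"

(* The constants h0 and K express that, for all small h and every stencil whose parameters lie
   in [a, b], the whole construction stays in one geodesically convex ball of radius at most
   K * h. *)
definition sider_setting ::
  "nat \<Rightarrow> (real \<Rightarrow> vec3) \<Rightarrow> real \<Rightarrow> real \<Rightarrow> real \<Rightarrow> real \<Rightarrow> bool" where
  "sider_setting n \<gamma> a b h0 K \<longleftrightarrow>
     a < b \<and> \<gamma> ` {a..b} \<subseteq> S2 \<and> C_k_on (n + 1) \<gamma> {a..b} \<and> 0 < h0 \<and>
     (\<forall>h i. 0 < h \<and> h < h0 \<and> stencil_in n a b h i \<longrightarrow>
        (\<exists>c\<in>S2. \<exists>r. r \<le> K * h \<and> geodesically_convex (geo_ball c r) \<and>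
           (\<forall>\<theta>\<in>{of_int i..of_int (i + int n)}.
              sider_points (samples \<gamma> h) n i \<theta> \<subseteq> geo_ball c r)))"

end

(* In the variables h and w = (theta - i) h every slerp of the construction is polynomial in h and w
   up to higher order: an extrapolation or interpolation parameter (theta - i) / k costs a power of h,
   but it only multiplies differences of neighbouring points, which supply one. So the coefficient
   of h^m in the expansion of P_i^[n] - gamma(theta h) is a polynomial of degree at most m in
   theta - i, with coefficients depending on the jet alone. The construction interpolates, so this
   polynomial vanishes at the n + 1 nodes. Hence it is zero for m <= n and a multiple of the nodal
   polynomial for m = n + 1. *)
theory Submission
  imports Defs
begin

section \<open>Power series at the origin\<close>

text \<open>Three obstacles shape the proof. As \<open>\<gamma>\<close> is only C^(n+1), its Taylor
  remainder is merely o(h^(n+1)), and it has to be uniform in the base point up to the ends of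
  [a, b]; expansions are therefore cut off at order n + 1 and compared modulo uniformly negligible
  terms. Next, SIDER2 nests two interpolations with parameter (theta - i) / 2, so its inner arcs
  must join points at distance O(h^2). They do, since the extrapolated points differ from the end
  points by second differences up to a quadratic term. Finally, vanishing at a node can be read off
  an expansion only if the base point and the position theta - i stay fixed while h tends to 0. Near
  an end of [a, b] the given curve leaves no room for this: at s = a only theta = i fits. So the
  expansion is set up jointly for the given curve and for a model curve, the exponential of the
  Taylor polynomial in normal coordinates, which admits every position. The model data determine the
  coefficient, which thus depends on the jet alone, and the joint expansion carries it over to the
  given curve. Singular quotients at coinciding points disappear because everything is a power
  series in squared lengths.\<close>

definition sqrt_cos :: "real \<Rightarrow> real" where
  "sqrt_cos t = cos (sqrt t)"

definition sqrt_sinc :: "real \<Rightarrow> real" where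
  "sqrt_sinc t = (if t = 0 then 1 else sin (sqrt t) / sqrt t)"

definition sqrt_arctan :: "real \<Rightarrow> real" where
  "sqrt_arctan t = (if t = 0 then 1 else arctan (sqrt t) / sqrt t)"

text \<open>The arguments will be squared norms and defects \<open>1 - a \<bullet> b\<close>, in
  which the even functions above are analytic although the norm is not differentiable at 0. The
  condition is one-sided because in HOL the root of a negative \<open>t\<close> is minus the root of
  its absolute value, so that \<open>sqrt_cos\<close> leaves its series there.\<close>

definition power_series_on :: "(real \<Rightarrow> real) \<Rightarrow> (nat \<Rightarrow> real) \<Rightarrow> real \<Rightarrow> bool" where
  "power_series_on F a \<rho> \<longleftrightarrow> 0 < \<rho> \<and> (\<forall>x\<in>{0..\<rho>}. (\<lambda>k. a k * x ^ k) sums F x)"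

lemma sqrt_even_power: "0 \<le> t \<Longrightarrow> sqrt t ^ (2 * k) = t ^ k"
  by (simp add: power_mult)

lemma power_series_on_sqrt_cos:
  "power_series_on sqrt_cos (\<lambda>k. (- 1) ^ k / fact (2 * k)) 1"
proof -
  have "(\<lambda>k. (- 1) ^ k / fact (2 * k) * t ^ k) sums sqrt_cos t" if "0 \<le> t" for t :: real
    using cos_paired[of "sqrt t"] that by (simp add: sqrt_cos_def sqrt_even_power)
  then show ?thesis by (simp add: power_series_on_def)
qed

lemma power_series_on_sqrt_sinc:
  "power_series_on sqrt_sinc (\<lambda>k. (- 1) ^ k / fact (2 * k + 1)) 1"
proof -
  have "(\<lambda>k. (- 1) ^ k / fact (2 * k + 1) * t ^ k) sums sqrt_sinc t" if "0 \<le> t" for t :: real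
  proof (cases "t = 0")
    case True
    then show ?thesis
      using powser_sums_zero[of "\<lambda>k. (- 1) ^ k / fact (2 * k + 1) :: real"]
      by (simp add: sqrt_sinc_def)
  next
    case False
    have "(\<lambda>k. (- 1) ^ k / fact (2 * k + 1) * sqrt t ^ (2 * k + 1) / sqrt t)
        sums (sin (sqrt t) / sqrt t)"
      by (intro sums_divide sin_paired)
    moreover have "(- 1) ^ k / fact (2 * k + 1) * sqrt t ^ (2 * k + 1) / sqrt t =
        (- 1) ^ k / fact (2 * k + 1) * t ^ k" for k
      using False that by (simp add: sqrt_even_power)
    ultimately show ?thesis using False by (simp add: sqrt_sinc_def)
  qed
  then show ?thesis by (simp add: power_series_on_def)
qed

lemma power_series_on_sqrt_arctan:
  "power_series_on sqrt_arctan (\<lambda>k. (- 1) ^ k / real (2 * k + 1)) 1"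
proof -
  have "(\<lambda>k. (- 1) ^ k / real (2 * k + 1) * t ^ k) sums sqrt_arctan t"
    if "0 \<le> t" "t \<le> 1" for t :: real
  proof (cases "t = 0")
    case True
    then show ?thesis
      using powser_sums_zero[of "\<lambda>k. (- 1) ^ k / real (2 * k + 1) :: real"]
      by (simp add: sqrt_arctan_def)
  next
    case False
    have 1: "\<bar>sqrt t\<bar> \<le> 1" using that by simp
    have "(\<lambda>k. (- 1) ^ k * (1 / real (k * 2 + 1) * sqrt t ^ (k * 2 + 1))) sums arctan (sqrt t)"
      using summable_arctan_series[OF 1] arctan_series[OF 1] by (simp add: sums_iff)
    then have "(\<lambda>k. (- 1) ^ k * (1 / real (k * 2 + 1) * sqrt t ^ (k * 2 + 1)) / sqrt t)
        sums (arctan (sqrt t) / sqrt t)"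
      by (rule sums_divide)
    moreover have "(- 1) ^ k * (1 / real (k * 2 + 1) * sqrt t ^ (k * 2 + 1)) / sqrt t =
        (- 1) ^ k / real (2 * k + 1) * t ^ k" for k
      using False that sqrt_even_power[of t k] by (simp add: mult.commute)
    ultimately show ?thesis using False by (simp add: sqrt_arctan_def)
  qed
  then show ?thesis by (simp add: power_series_on_def)
qed

lemma power_series_on_geometric:
  "power_series_on (\<lambda>x. 1 / (1 - x)) (\<lambda>k. 1) (1 / 2)"
  by (auto simp: power_series_on_def intro!: geometric_sums)

text \<open>Convergence at \<open>\<rho>\<close> gives absolute convergence at
  \<open>\<rho> / 2\<close>; once \<open>x ^ Suc K\<close> is split off, the tail is majorized
  termwise by its value there.\<close>

lemma power_series_on_remainder:
  assumes "power_series_on F a \<rho>"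
  obtains C where "0 \<le> C"
    "\<And>x. 0 \<le> x \<Longrightarrow> x \<le> \<rho> / 2 \<Longrightarrow> \<bar>F x - (\<Sum>k\<le>K. a k * x ^ k)\<bar> \<le> C * x ^ Suc K"
proof -
  have \<rho>: "0 < \<rho>" and sums: "\<And>x. 0 \<le> x \<Longrightarrow> x \<le> \<rho> \<Longrightarrow> (\<lambda>k. a k * x ^ k) sums F x"
    using assms by (auto simp: power_series_on_def)
  define b where "b k = \<bar>a (k + Suc K)\<bar> * (\<rho> / 2) ^ k" for k
  have "summable (\<lambda>k. \<bar>a k * (\<rho> / 2) ^ k\<bar>)"
    using powser_insidea[of a \<rho> "\<rho> / 2"] sums[of \<rho>] \<rho> by (simp add: sums_iff)
  then have "summable (\<lambda>k. \<bar>a (k + Suc K) * (\<rho> / 2) ^ (k + Suc K)\<bar>)"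
    by (rule summable_ignore_initial_segment)
  then have "summable (\<lambda>k. \<bar>a (k + Suc K) * (\<rho> / 2) ^ (k + Suc K)\<bar> * (1 / (\<rho> / 2) ^ Suc K))"
    by (rule summable_mult2)
  moreover have "\<bar>a (k + Suc K) * (\<rho> / 2) ^ (k + Suc K)\<bar> * (1 / (\<rho> / 2) ^ Suc K) = b k" for k
    using \<rho> by (simp add: b_def abs_mult power_add)
  ultimately have b: "summable b" by (simp only:)
  show thesis
  proof
    show "0 \<le> suminf b" by (rule suminf_nonneg[OF b]) (use \<rho> in \<open>simp add: b_def\<close>)
    fix x :: real assume x: "0 \<le> x" "x \<le> \<rho> / 2"
    have s: "(\<lambda>k. a k * x ^ k) sums F x" using sums x \<rho> by simp
    have bnd: "\<And>k. norm (a (k + Suc K) * x ^ k) \<le> b k"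
      using x by (auto simp: b_def abs_mult power_abs intro!: mult_left_mono power_mono)
    have sm: "summable (\<lambda>k. a (k + Suc K) * x ^ k)"
      by (rule summable_comparison_test'[OF b, of 0]) (rule bnd)
    have "F x - (\<Sum>k\<le>K. a k * x ^ k) = (\<Sum>k. a (k + Suc K) * x ^ (k + Suc K))"
      using suminf_minus_initial_segment[OF sums_summable[OF s], of "Suc K"] s
      by (simp add: sums_iff lessThan_Suc_atMost)
    also have "\<dots> = (\<Sum>k. x ^ Suc K * (a (k + Suc K) * x ^ k))"
      by (simp add: power_add algebra_simps)
    also have "\<dots> = x ^ Suc K * (\<Sum>k. a (k + Suc K) * x ^ k)"
      by (rule suminf_mult[OF sm])
    finally have "\<bar>F x - (\<Sum>k\<le>K. a k * x ^ k)\<bar> = x ^ Suc K * \<bar>\<Sum>k. a (k + Suc K) * x ^ k\<bar>"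
      using x by (simp add: abs_mult)
    also have "\<dots> \<le> x ^ Suc K * suminf b"
      using norm_suminf_le[of "\<lambda>k. a (k + Suc K) * x ^ k" b, OF bnd b] x
      by (intro mult_left_mono) auto
    finally show "\<bar>F x - (\<Sum>k\<le>K. a k * x ^ k)\<bar> \<le> suminf b * x ^ Suc K"
      by (simp add: mult.commute)
  qed
qed

section \<open>Exponential map, logarithm and slerp on unit spheres\<close>

text \<open>Polymorphic because the scheme is run twice: in \<open>vec3\<close> on the given
  samples, and in \<open>real \<times> vec3\<close> after the base point has been moved to
  \<open>(1, 0)\<close>.\<close>

definition sph_exp :: "'a::real_inner \<Rightarrow> 'a \<Rightarrow> 'a" where
  "sph_exp y v = cos (norm v) *\<^sub>R y + (sin (norm v) / norm v) *\<^sub>R v"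

definition sph_log :: "'a::real_inner \<Rightarrow> 'a \<Rightarrow> 'a" where
  "sph_log y z = (arccos (y \<bullet> z) / sin (arccos (y \<bullet> z))) *\<^sub>R (z - (y \<bullet> z) *\<^sub>R y)"

definition sph_slerp :: "'a::real_inner \<Rightarrow> 'a \<Rightarrow> real \<Rightarrow> 'a" where
  "sph_slerp a b t = sph_exp a (t *\<^sub>R sph_log a b)"

lemma Log_S2_eq_sph_log: "Log_S2 = sph_log"
  by (intro ext) (simp add: Log_S2_def sph_log_def Let_def)

lemma slerp_eq_sph_slerp: "slerp = sph_slerp"
  by (intro ext) (simp add: slerp_def sph_slerp_def Log_S2_eq_sph_log Exp_S2_def sph_exp_def)

text \<open>Only inner products enter the formulas. The lemma serves for the reflection that yields
  the middle node of SIDER2 and for the passage to \<open>real \<times> vec3\<close>.\<close>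

lemma sph_slerp_isometry:
  assumes "linear T" "\<And>x y. T x \<bullet> T y = x \<bullet> y"
  shows "sph_slerp (T a) (T b) t = T (sph_slerp a b t)"
proof -
  interpret T: linear T by fact
  have "norm (T x) = norm x" for x by (simp add: norm_eq_sqrt_inner assms(2))
  moreover have "sph_log (T a) (T b) = T (sph_log a b)"
    by (simp add: sph_log_def assms(2) T.diff T.scale)
  ultimately show ?thesis
    by (simp add: sph_slerp_def sph_exp_def T.add T.scale flip: T.scale)
qed

lemma sph_exp_isometry:
  assumes "linear T" "\<And>x y. T x \<bullet> T y = x \<bullet> y"
  shows "sph_exp (T y) (T v) = T (sph_exp y v)"
proof -
  interpret T: linear T by fact
  have "norm (T v) = norm v" by (simp add: norm_eq_sqrt_inner assms(2))
  then show ?thesis by (simp add: sph_exp_def T.add T.scale)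
qed

lemma sph_exp_zero [simp]: "sph_exp y 0 = y"
  by (simp add: sph_exp_def)

lemma sph_slerp_0 [simp]: "sph_slerp a b 0 = a"
  by (simp add: sph_slerp_def)

lemma sph_slerp_same [simp]: "norm a = 1 \<Longrightarrow> sph_slerp a a t = a"
  by (simp add: sph_slerp_def sph_log_def flip: power2_norm_eq_inner)

lemma sph_exp_sqrt:
  "sph_exp y v = sqrt_cos ((norm v)\<^sup>2) *\<^sub>R y + sqrt_sinc ((norm v)\<^sup>2) *\<^sub>R v"
  by (simp add: sph_exp_def sqrt_cos_def sqrt_sinc_def)

lemma inner_sph_log: "norm a = 1 \<Longrightarrow> a \<bullet> sph_log a b = 0"
  by (simp add: sph_log_def inner_diff_right flip: power2_norm_eq_inner)

lemma norm_sph_exp: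
  assumes "norm a = 1" "a \<bullet> v = 0"
  shows "norm (sph_exp a v) = 1"
proof (cases "v = 0")
  case False
  have "(norm (sph_exp a v))\<^sup>2 = (cos (norm v))\<^sup>2 * (norm a)\<^sup>2
      + (sin (norm v) / norm v)\<^sup>2 * (norm v)\<^sup>2"
    unfolding sph_exp_def power2_norm_eq_inner
    using assms(2) by (simp add: inner_add inner_commute power2_eq_square)
  also have "\<dots> = 1" using False assms by (simp add: power_divide)
  finally show ?thesis by (rule power2_eq_imp_eq[of _ 1, simplified]) auto
qed (simp add: assms)

lemma norm_sph_slerp: "norm a = 1 \<Longrightarrow> norm (sph_slerp a b t) = 1"
  by (simp add: sph_slerp_def norm_sph_exp inner_sph_log)

lemma sph_slerp_in_subspace:
  assumes "subspace S" "a \<in> S" "b \<in> S"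
  shows "sph_slerp a b t \<in> S"
  unfolding sph_slerp_def sph_exp_def sph_log_def
  using assms by (intro subspace_add subspace_scale subspace_diff) auto

text \<open>With \<open>\<alpha> = arccos c\<close> one has \<open>q = tan\<^sup>2 (\<alpha> / 2)\<close>, so \<open>\<alpha> / sin \<alpha> = (1 + q) arctan (sqrt q) / sqrt q\<close>.
  In contrast to the quotient of \<open>arccos\<close> and \<open>sin\<close> this is visibly analytic at \<open>c = 1\<close>.\<close>

definition log_factor :: "real \<Rightarrow> real" where
  "log_factor c = (let m = (1 - c) / 2; q = m * (1 / (1 - m)) in (1 + q) * sqrt_arctan q)"

lemma log_factor_eq:
  assumes "0 < c" "c < 1"
  shows "log_factor c = arccos c / sin (arccos c)"
proof -
  define x where "x = arccos c / 2"
  have x: "0 < x" "x < pi / 4"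
    using assms arccos_less_arccos[of c 1] arccos_less_arccos[of 0 c] by (auto simp: x_def)
  have c: "c = cos (2 * x)" using assms by (simp add: x_def)
  have pos: "0 < cos x" "0 < sin x" using x by (auto intro!: cos_gt_zero_pi sin_gt_zero)
  have m: "(1 - c) / 2 = (sin x)\<^sup>2" by (simp add: c cos_double_sin)
  have "1 - (sin x)\<^sup>2 = (cos x)\<^sup>2" by (simp add: cos_squared_eq)
  then have q: "(1 - c) / 2 * (1 / (1 - (1 - c) / 2)) = (tan x)\<^sup>2"
    by (simp add: m tan_def power_divide)
  have t: "0 < tan x" using pos by (simp add: tan_def)
  have "log_factor c = (1 + (tan x)\<^sup>2) * (x / tan x)"
    unfolding log_factor_def Let_def q using t x by (simp add: sqrt_arctan_def arctan_tan)
  also have "1 + (tan x)\<^sup>2 = 1 / (cos x)\<^sup>2"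
    using pos by (simp add: tan_sec inverse_eq_divide power_divide)
  also have "1 / (cos x)\<^sup>2 * (x / tan x) = 2 * x / (2 * sin x * cos x)"
    using pos by (simp add: tan_def field_simps power2_eq_square)
  also have "\<dots> = arccos c / sin (arccos c)"
    by (simp add: x_def flip: sin_double)
  finally show ?thesis .
qed

text \<open>Both \<open>q\<close> and the deviation of \<open>sqrt_arctan q\<close> from 1 are O(1 -
  c); the bound 1/2 on \<open>c\<close> keeps \<open>q\<close> within half the radius of the arctan
  series. In the final estimate this measures how far the logarithm is from the orthogonal
  projection to the tangent plane.\<close>

lemma log_factor_near_1:
  obtains C where "0 \<le> C" "\<And>c. 1 / 2 \<le> c \<Longrightarrow> c \<le> 1 \<Longrightarrow> \<bar>log_factor c - 1\<bar> \<le> C * (1 - c)"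
proof -
  obtain C where C: "0 \<le> C"
    "\<And>x. 0 \<le> x \<Longrightarrow> x \<le> 1 / 2 \<Longrightarrow> \<bar>sqrt_arctan x - 1\<bar> \<le> C * x"
    using power_series_on_remainder[OF power_series_on_sqrt_arctan, of 0] by auto
  show thesis
  proof
    show "0 \<le> 2 * C + 1" using C by simp
    fix c :: real assume c: "1 / 2 \<le> c" "c \<le> 1"
    define q where "q = (1 - c) / 2 * (1 / (1 - (1 - c) / 2))"
    have q: "0 \<le> q" "q \<le> 1 - c"
    proof -
      show "0 \<le> q" using c by (simp add: q_def)
      have "1 / (1 - (1 - c) / 2) \<le> 2" using c by (simp add: field_simps)
      then have "q \<le> (1 - c) / 2 * 2" unfolding q_def using c by (intro mult_left_mono) auto
      then show "q \<le> 1 - c" by simp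
    qed
    have "log_factor c = (1 + q) * sqrt_arctan q"
      unfolding log_factor_def Let_def q_def ..
    then have "log_factor c - 1 = (1 + q) * (sqrt_arctan q - 1) + q"
      by (simp add: algebra_simps)
    also have "\<bar>\<dots>\<bar> \<le> (1 + q) * \<bar>sqrt_arctan q - 1\<bar> + q"
      using q by (intro order_trans[OF abs_triangle_ineq]) (simp add: abs_mult)
    also have "\<dots> \<le> 2 * (C * q) + q"
      using q c C by (intro add_mono mult_mono C(2)) auto
    also have "\<dots> = (2 * C + 1) * q" by (simp add: algebra_simps)
    also have "\<dots> \<le> (2 * C + 1) * (1 - c)" using q C by (intro mult_left_mono) auto
    finally show "\<bar>log_factor c - 1\<bar> \<le> (2 * C + 1) * (1 - c)" .
  qed
qed

lemma unit_inner_eq_1: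
  assumes "norm a = 1" "norm b = 1" "a \<bullet> b = 1"
  shows "a = (b::'a::real_inner)"
proof -
  have "(norm (a - b))\<^sup>2 = 0"
    using assms by (simp add: power2_norm_eq_inner inner_diff inner_commute)
      (simp flip: power2_norm_eq_inner)
  then show ?thesis by simp
qed

lemma unit_inner_bounds:
  assumes "norm a = 1" "norm b = 1"
  shows "a \<bullet> b \<le> 1" "- 1 \<le> a \<bullet> b"
  using Cauchy_Schwarz_ineq2[of a b] assms by auto

lemma unit_inner_chord:
  assumes "norm a = 1" "norm b = 1"
  shows "1 - a \<bullet> b = (norm (b - a))\<^sup>2 / 2"
  using assms by (simp add: power2_norm_eq_inner inner_diff inner_commute)
      (simp flip: power2_norm_eq_inner)

lemma unit_close_inner:
  assumes "norm a = 1" "norm b = 1" "norm (b - a) < 1"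
  shows "0 < a \<bullet> b"
proof -
  have "(norm (b - a))\<^sup>2 < 1" using power_strict_mono[OF assms(3), of 2] by simp
  then show ?thesis using unit_inner_chord[OF assms(1,2)] by simp
qed

text \<open>For \<open>a = b\<close> the scalar factors disagree, as 0 / 0 = 0 while
  \<open>log_factor 1\<close> is 1, but the vector that they multiply vanishes.\<close>

lemma sph_log_eq_log_factor:
  assumes "norm a = 1" "norm b = 1" "0 < a \<bullet> b"
  shows "sph_log a b = log_factor (a \<bullet> b) *\<^sub>R (b - (a \<bullet> b) *\<^sub>R a)"
proof (cases "a \<bullet> b = 1")
  case True
  then have "a = b" using unit_inner_eq_1 assms by blast
  then show ?thesis using True by (simp add: sph_log_def)
next
  case False
  then have "a \<bullet> b < 1" using unit_inner_bounds[OF assms(1,2)] by simp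
  then show ?thesis using assms by (simp add: sph_log_def log_factor_eq)
qed

lemma norm_unit_rejection:
  assumes "norm a = 1" "norm b = 1"
  shows "(norm (b - (a \<bullet> b) *\<^sub>R a))\<^sup>2 = 1 - (a \<bullet> b)\<^sup>2"
proof -
  have "a \<bullet> a = 1" "b \<bullet> b = 1" using assms by (simp_all flip: power2_norm_eq_inner)
  then show ?thesis
    unfolding power2_norm_eq_inner
    by (simp add: inner_diff inner_commute power2_eq_square)
qed

lemma norm_sph_log:
  assumes "norm a = 1" "norm b = 1" "- 1 < a \<bullet> b"
  shows "norm (sph_log a b) = arccos (a \<bullet> b)"
proof (cases "a \<bullet> b = 1")
  case True
  then have "a = b" using unit_inner_eq_1 assms by blast
  then show ?thesis using True by (simp add: sph_log_def)
next
  case False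
  then have c: "a \<bullet> b < 1" using unit_inner_bounds[OF assms(1,2)] by simp
  have s: "sin (arccos (a \<bullet> b)) = sqrt (1 - (a \<bullet> b)\<^sup>2)"
    using assms c by (simp add: sin_arccos)
  have "norm (b - (a \<bullet> b) *\<^sub>R a) = sqrt (1 - (a \<bullet> b)\<^sup>2)"
    by (rule real_sqrt_unique[symmetric]) (use norm_unit_rejection[OF assms(1,2)] in auto)
  moreover have "0 < sin (arccos (a \<bullet> b))"
    using assms c arccos_lt_bounded by (intro sin_gt_zero) auto
  moreover have "0 \<le> arccos (a \<bullet> b)"
    using assms c by (intro arccos_lbound) auto
  ultimately show ?thesis by (simp add: sph_log_def s)
qed

lemma sph_slerp_angle:
  assumes "norm a = 1" "norm b = 1" "- 1 < a \<bullet> b" "a \<bullet> b < 1" "0 \<le> t"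
  defines "\<alpha> \<equiv> arccos (a \<bullet> b)"
  shows "sph_slerp a b t = cos (t * \<alpha>) *\<^sub>R a + (sin (t * \<alpha>) / sin \<alpha>) *\<^sub>R (b - cos \<alpha> *\<^sub>R a)"
proof -
  have "norm (t *\<^sub>R sph_log a b) = t * \<alpha>"
    using assms by (simp add: norm_sph_log)
  moreover have "0 < \<alpha>" unfolding \<alpha>_def using assms arccos_lt_bounded by auto
  moreover have "cos \<alpha> = a \<bullet> b" unfolding \<alpha>_def using assms by simp
  ultimately show ?thesis
    by (simp add: sph_slerp_def sph_exp_def) (simp add: sph_log_def flip: \<alpha>_def)
qed

lemma sph_slerp_1:
  assumes "norm a = 1" "norm b = 1" "- 1 < a \<bullet> b"
  shows "sph_slerp a b 1 = b"
proof (cases "a \<bullet> b = 1")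
  case True
  then have "a = b" using unit_inner_eq_1 assms by blast
  then show ?thesis using assms by simp
next
  case False
  then have c: "a \<bullet> b < 1" using unit_inner_bounds[OF assms(1,2)] by simp
  then have "0 < sin (arccos (a \<bullet> b))"
    using assms c arccos_lt_bounded by (intro sin_gt_zero) auto
  then show ?thesis by (simp add: sph_slerp_angle assms c)
qed

text \<open>Doubling an arc reflects \<open>a\<close> in the line through \<open>b\<close>. The
  extrapolated points of SIDER2 are thus polynomial in the data, and their order in h can be found
  by algebra.\<close>

lemma sph_slerp_2:
  assumes "norm a = 1" "norm b = 1" "- 1 < a \<bullet> b"
  shows "sph_slerp a b 2 = (2 * (a \<bullet> b)) *\<^sub>R b - a"
proof (cases "a \<bullet> b = 1")
  case True
  then have "a = b" using unit_inner_eq_1 assms by blast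
  then show ?thesis using assms True by (simp add: scaleR_2)
next
  case False
  then have c: "a \<bullet> b < 1" using unit_inner_bounds[OF assms(1,2)] by simp
  then have "0 < sin (arccos (a \<bullet> b))"
    using assms c arccos_lt_bounded by (intro sin_gt_zero) auto
  then show ?thesis using c assms
    by (simp add: sph_slerp_angle sin_double cos_double_cos scaleR_diff_right scaleR_diff_left
        power2_eq_square algebra_simps)
qed

text \<open>The midpoint is the normalized sum. Only the sign of the factor is exposed, because its
  size follows from the unit length wherever it is needed.\<close>

lemma sph_slerp_half:
  assumes "norm a = 1" "norm b = 1" "- 1 < a \<bullet> b"
  obtains r where "0 < r" "sph_slerp a b (1 / 2) = r *\<^sub>R (a + b)"
proof (cases "a \<bullet> b = 1")
  case True
  then have "a = b" using unit_inner_eq_1 assms by blast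
  then have "sph_slerp a b (1 / 2) = (1 / 2) *\<^sub>R (a + b)" using assms by (simp flip: scaleR_2)
  then show ?thesis by (rule that[rotated]) simp
next
  case False
  then have c: "a \<bullet> b < 1" using unit_inner_bounds[OF assms(1,2)] by simp
  define x where "x = arccos (a \<bullet> b) / 2"
  have x: "0 < x" "x < pi / 2" using assms c arccos_lt_bounded[of "a \<bullet> b"] by (auto simp: x_def)
  have pos: "0 < cos x" "0 < sin x" using x by (auto intro!: cos_gt_zero_pi sin_gt_zero)
  have "sph_slerp a b (1 / 2) = cos x *\<^sub>R a + (sin x / sin (2 * x)) *\<^sub>R (b - cos (2 * x) *\<^sub>R a)"
    using sph_slerp_angle[OF assms c, of "1 / 2"] by (simp add: x_def)
  also have "sin x / sin (2 * x) = 1 / (2 * cos x)"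
    using pos by (simp add: sin_double)
  also have "cos x *\<^sub>R a + (1 / (2 * cos x)) *\<^sub>R (b - cos (2 * x) *\<^sub>R a) =
      (cos x - cos (2 * x) / (2 * cos x)) *\<^sub>R a + (1 / (2 * cos x)) *\<^sub>R b"
    by (simp add: algebra_simps)
  also have "cos x - cos (2 * x) / (2 * cos x) = 1 / (2 * cos x)"
    unfolding cos_double_cos using pos by (simp add: field_simps power2_eq_square)
  finally have "sph_slerp a b (1 / 2) = (1 / (2 * cos x)) *\<^sub>R (a + b)"
    by (simp add: scaleR_add_right)
  then show ?thesis by (rule that[rotated]) (use pos in simp)
qed

lemma sph_slerp_analytic:
  fixes t :: real
  assumes "norm a = 1" "norm b = 1" "0 < a \<bullet> b"
  defines "c \<equiv> a \<bullet> b"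
  defines "w \<equiv> (t * log_factor c) *\<^sub>R (b - c *\<^sub>R a)"
  shows "sph_slerp a b t = sqrt_cos ((norm w)\<^sup>2) *\<^sub>R a + sqrt_sinc ((norm w)\<^sup>2) *\<^sub>R w"
  using assms by (simp add: sph_slerp_def sph_exp_sqrt sph_log_eq_log_factor)

section \<open>The SIDER scheme in an arbitrary inner product space\<close>

definition sph_sider2_left :: "(int \<Rightarrow> 'a::real_inner) \<Rightarrow> int \<Rightarrow> real \<Rightarrow> 'a" where
  "sph_sider2_left p i \<theta> =
     sph_slerp (p i) (sph_slerp (p (i + 2)) (p (i + 1)) 2) ((\<theta> - of_int i) / 2)"

definition sph_sider2_right :: "(int \<Rightarrow> 'a::real_inner) \<Rightarrow> int \<Rightarrow> real \<Rightarrow> 'a" where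
  "sph_sider2_right p i \<theta> =
     sph_slerp (sph_slerp (p i) (p (i + 1)) 2) (p (i + 2)) ((\<theta> - of_int i) / 2)"

fun sph_sider :: "(int \<Rightarrow> 'a::real_inner) \<Rightarrow> nat \<Rightarrow> int \<Rightarrow> real \<Rightarrow> 'a" where
  "sph_sider p (Suc (Suc 0)) i \<theta> =
     sph_slerp (sph_sider2_left p i \<theta>) (sph_sider2_right p i \<theta>) ((\<theta> - of_int i) / 2)"
| "sph_sider p (Suc (Suc (Suc m))) i \<theta> =
     sph_slerp (sph_sider p (Suc (Suc m)) i \<theta>) (sph_sider p (Suc (Suc m)) (i + 1) \<theta>)
       ((\<theta> - of_int i) / of_nat (Suc (Suc (Suc m))))"

lemma sph_sider_2:
  "sph_sider p 2 i \<theta> =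
     sph_slerp (sph_sider2_left p i \<theta>) (sph_sider2_right p i \<theta>) ((\<theta> - of_int i) / 2)"
  by (simp add: numeral_2_eq_2)

lemma sph_sider_Suc:
  assumes "2 \<le> k"
  shows "sph_sider p (Suc k) i \<theta> =
     sph_slerp (sph_sider p k i \<theta>) (sph_sider p k (i + 1) \<theta>) ((\<theta> - of_int i) / of_nat (Suc k))"
proof -
  obtain m where "k = 2 + m" using assms le_Suc_ex by blast
  then have "k = Suc (Suc m)" by simp
  then show ?thesis by simp
qed

lemma sider_eq_sph_sider: "2 \<le> k \<Longrightarrow> sider p k i \<theta> = sph_sider p k i \<theta>"
  by (induction p k i \<theta> rule: sider.induct)
    (simp_all add: sider2_left_def sider2_right_def sider2_a_def sider2_b_def
      sph_sider2_left_def sph_sider2_right_def slerp_eq_sph_slerp)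

lemma sph_sider_isometry:
  assumes "linear T" "\<And>x y. T x \<bullet> T y = x \<bullet> y" "2 \<le> k"
  shows "sph_sider (\<lambda>j. T (p j)) k i \<theta> = T (sph_sider p k i \<theta>)"
  using assms(3)
  by (induction p k i \<theta> rule: sph_sider.induct)
    (simp_all add: sph_slerp_isometry[OF assms(1,2)] sph_sider2_left_def sph_sider2_right_def)

text \<open>Moving every stencil to start at index 0 leaves theta - i as the only position
  variable.\<close>

lemma sph_sider_translate:
  assumes "2 \<le> k"
  shows "sph_sider (\<lambda>j. p (j + c)) k i \<theta> = sph_sider p k (i + c) (\<theta> + of_int c)"
  using assms
  by (induction k arbitrary: i rule: nat_induct_at_least)
    (simp_all add: sph_sider_2 sph_sider_Suc sph_sider2_left_def sph_sider2_right_def add_ac)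

lemma sph_sider_cong:
  assumes "2 \<le> k" "\<And>j. i \<le> j \<Longrightarrow> j \<le> i + int k \<Longrightarrow> p j = q j"
  shows "sph_sider p k i \<theta> = sph_sider q k i \<theta>"
  using assms
  by (induction k arbitrary: i rule: nat_induct_at_least)
    (simp_all add: sph_sider_2 sph_sider_Suc sph_sider2_left_def sph_sider2_right_def)

lemma norm_sph_sider:
  assumes "2 \<le> k" "\<And>j. i \<le> j \<Longrightarrow> j \<le> i + int k \<Longrightarrow> norm (p j) = 1"
  shows "norm (sph_sider p k i \<theta>) = 1"
  using assms
  by (induction k arbitrary: i rule: nat_induct_at_least)
    (auto simp: sph_sider_2 sph_sider_Suc sph_sider2_left_def intro!: norm_sph_slerp)

text \<open>Used for the points whose tangential part is orthogonal to the base point: it makes the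
  leading coefficient a tangent vector.\<close>

lemma sph_sider_in_subspace:
  assumes "2 \<le> k" "subspace S" "\<And>j. i \<le> j \<Longrightarrow> j \<le> i + int k \<Longrightarrow> p j \<in> S"
  shows "sph_sider p k i \<theta> \<in> S"
  using assms
  by (induction k arbitrary: i rule: nat_induct_at_least)
    (auto simp: sph_sider_2 sph_sider_Suc sph_sider2_left_def sph_sider2_right_def
      intro!: sph_slerp_in_subspace)

lemma sph_sider_left_node:
  assumes "2 \<le> k"
  shows "sph_sider p k i (of_int i) = p i"
  using assms
  by (induction k rule: nat_induct_at_least)
    (simp_all add: sph_sider_2 sph_sider_Suc sph_sider2_left_def)

text \<open>The reflection in the line through \<open>q\<close> exchanges the two extrapolated points with the
  end points, hence the two intermediate arcs.\<close>

lemma sph_sider2_middle_node: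
  assumes unit: "norm a = 1" "norm q = 1" "norm b = 1"
    and far: "- 1 < a \<bullet> q" "- 1 < b \<bullet> q"
  defines "l \<equiv> sph_slerp a (sph_slerp b q 2) (1 / 2)"
    and "r \<equiv> sph_slerp (sph_slerp a q 2) b (1 / 2)"
  assumes "- 1 < l \<bullet> r" "0 < q \<bullet> l"
  shows "sph_slerp l r (1 / 2) = q"
proof -
  define R where "R v = (2 * (q \<bullet> v)) *\<^sub>R q - v" for v
  have qq: "q \<bullet> q = 1" using unit by (simp flip: power2_norm_eq_inner)
  have lin: "linear R"
    by (rule linearI) (simp_all add: R_def inner_add_right algebra_simps)
  have iso: "R x \<bullet> R y = x \<bullet> y" for x y
    by (simp add: R_def inner_diff qq inner_commute)
  have RR: "R (R v) = v" for v
    by (simp add: R_def inner_diff_right qq algebra_simps)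
  have da: "sph_slerp b q 2 = R b" "sph_slerp a q 2 = R a"
    using unit far by (simp_all add: sph_slerp_2 R_def inner_commute)
  have rl: "r = R l"
    using sph_slerp_isometry[OF lin iso, of a "R b" "1 / 2"] by (simp add: l_def r_def da RR)
  have nl: "norm l = 1" using unit by (simp add: l_def norm_sph_slerp)
  have nr: "norm r = 1" using iso[of l l] nl by (simp add: rl norm_eq_sqrt_inner)
  obtain t where t: "0 < t" "sph_slerp l r (1 / 2) = t *\<^sub>R (l + r)"
    using sph_slerp_half[OF nl nr assms(8)] by blast
  have s: "sph_slerp l r (1 / 2) = (t * (2 * (q \<bullet> l))) *\<^sub>R q"
    using t(2) by (simp add: rl R_def)
  \<comment> \<open>The midpoint of \<open>l\<close> and its mirror image is a unit vector on the
    line through \<open>q\<close>; the positive signs of \<open>t\<close> and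
    \<open>q \<bullet> l\<close> exclude \<open>- q\<close>.\<close>
  have "norm (sph_slerp l r (1 / 2)) = 1" using nl by (rule norm_sph_slerp)
  then have "t * (2 * (q \<bullet> l)) = 1"
    using t(1) assms(9) unit unfolding s by simp
  then show ?thesis by (simp add: s)
qed

section \<open>Polynomials in the step and the scaled stencil position\<close>

text \<open>In the applications \<open>w = (\<theta> - i) h\<close>. That an expansion is polynomial in \<open>h\<close> and \<open>w\<close>
  jointly encodes the degree bound of the proof: the coefficient of \<open>h\<^sup>m\<close> has degree at most
  \<open>m\<close> in \<open>\<theta> - i\<close>.\<close>

inductive bpoly :: "'p set \<Rightarrow> ('p \<Rightarrow> real \<Rightarrow> real \<Rightarrow> 'v::real_normed_vector) \<Rightarrow> bool"
  for Z where
  bpoly_const: "bounded (q ` Z) \<Longrightarrow> bpoly Z (\<lambda>p h w. q p)"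
| bpoly_add: "bpoly Z G \<Longrightarrow> bpoly Z H \<Longrightarrow> bpoly Z (\<lambda>p h w. G p h w + H p h w)"
| bpoly_mult_h: "bpoly Z G \<Longrightarrow> bpoly Z (\<lambda>p h w. h *\<^sub>R G p h w)"
| bpoly_mult_w: "bpoly Z G \<Longrightarrow> bpoly Z (\<lambda>p h w. w *\<^sub>R G p h w)"

lemma bpoly_constant: "bpoly Z (\<lambda>p h w. c)"
  by (rule bpoly_const) (auto simp: bounded_iff)

lemma bpoly_bilinear:
  assumes "bounded_bilinear bop" "bpoly Z G" "bpoly Z H"
  shows "bpoly Z (\<lambda>p h w. bop (G p h w) (H p h w))"
proof -
  interpret bounded_bilinear bop by fact
  show ?thesis
    using assms(2)
  proof induction
    case (bpoly_const q)
    show ?case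
      using assms(3)
    proof induction
      case (bpoly_const q')
      from \<open>bounded (q ` Z)\<close> obtain B where B: "\<And>p. p \<in> Z \<Longrightarrow> norm (q p) \<le> B"
        by (auto simp: bounded_iff)
      from bpoly_const obtain B' where B': "\<And>p. p \<in> Z \<Longrightarrow> norm (q' p) \<le> B'"
        by (auto simp: bounded_iff)
      obtain K where K: "0 \<le> K" "\<And>x y. norm (bop x y) \<le> norm x * norm y * K"
        using nonneg_bounded by blast
      have "norm (bop (q p) (q' p)) \<le> B * B' * K" if p: "p \<in> Z" for p
      proof -
        have "norm (q p) * norm (q' p) \<le> B * B'"
          using B[OF p] B'[OF p] order_trans[OF norm_ge_zero B[OF p]] by (intro mult_mono) auto
        then show ?thesis using order_trans[OF K(2) mult_right_mono[OF _ K(1)]] by blast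
      qed
      then show ?case by (intro bpoly.bpoly_const) (auto simp: bounded_iff)
    qed (auto simp: add_right scaleR_right intro: bpoly.intros)
  qed (auto simp: add_left scaleR_left intro: bpoly.intros)
qed

lemmas bpoly_scaleR = bpoly_bilinear[OF bounded_bilinear_scaleR]

lemma bpoly_scaleR_const: "bpoly Z G \<Longrightarrow> bpoly Z (\<lambda>p h w. c *\<^sub>R G p h w)"
  by (rule bpoly_scaleR[OF bpoly_constant])

lemma bpoly_minus: "bpoly Z G \<Longrightarrow> bpoly Z (\<lambda>p h w. - G p h w)"
  using bpoly_scaleR_const[of Z G "- 1"] by simp

lemma bpoly_diff: "bpoly Z G \<Longrightarrow> bpoly Z H \<Longrightarrow> bpoly Z (\<lambda>p h w. G p h w - H p h w)"
  using bpoly_add[OF _ bpoly_minus, of Z G H] by simp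

lemma bpoly_mult_h_power: "bpoly Z G \<Longrightarrow> bpoly Z (\<lambda>p h w. h ^ k *\<^sub>R G p h w)"
proof (induction k)
  case (Suc k)
  then show ?case using bpoly_mult_h[of Z "\<lambda>p h w. h ^ k *\<^sub>R G p h w"] by simp
qed simp

lemma bpoly_mult_w_power: "bpoly Z G \<Longrightarrow> bpoly Z (\<lambda>p h w. w ^ k *\<^sub>R G p h w)"
proof (induction k)
  case (Suc k)
  then show ?case using bpoly_mult_w[of Z "\<lambda>p h w. w ^ k *\<^sub>R G p h w"] by simp
qed simp

lemma bpoly_sum:
  assumes "finite A" "\<And>a. a \<in> A \<Longrightarrow> bpoly Z (G a)"
  shows "bpoly Z (\<lambda>p h w. \<Sum>a\<in>A. G a p h w)"
  using assms by (induction A rule: finite_induct) (auto intro: bpoly_constant bpoly_add)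

text \<open>Replacing the stencil start i by i + 1 replaces w by w - h. Divisibility of the change
  by h is why neighbouring interpolants differ by one order more.\<close>

lemma bpoly_shift:
  assumes "bpoly Z G"
  shows "\<exists>D. bpoly Z D \<and> (\<forall>p h w. G p h (w - h) = G p h w + h *\<^sub>R D p h w)"
  using assms
proof induction
  case (bpoly_const q)
  then show ?case by (intro exI[of _ "\<lambda>p h w. 0"]) (simp add: bpoly_constant)
next
  case (bpoly_add G H)
  then obtain D E where "bpoly Z D" "bpoly Z E"
    "\<And>p h w. G p h (w - h) = G p h w + h *\<^sub>R D p h w"
    "\<And>p h w. H p h (w - h) = H p h w + h *\<^sub>R E p h w" by blast
  then show ?case
    by (intro exI[of _ "\<lambda>p h w. D p h w + E p h w"])
      (simp add: bpoly.bpoly_add scaleR_add_right)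
next
  case (bpoly_mult_h G)
  then obtain D where "bpoly Z D" "\<And>p h w. G p h (w - h) = G p h w + h *\<^sub>R D p h w" by blast
  then show ?case
    by (intro exI[of _ "\<lambda>p h w. h *\<^sub>R D p h w"]) (simp add: bpoly.bpoly_mult_h scaleR_add_right)
next
  case (bpoly_mult_w G)
  then obtain D where D: "bpoly Z D" "\<And>p h w. G p h (w - h) = G p h w + h *\<^sub>R D p h w" by blast
  show ?case
    by (intro exI[of _ "\<lambda>p h w. w *\<^sub>R D p h w - G p h w - h *\<^sub>R D p h w"])
      (auto simp: D algebra_simps intro!: bpoly.intros bpoly_diff bpoly_mult_w D)
qed

text \<open>The factor theorem in w with root c h. The remainder is the value on the ray w = c h,
  and the quotient stays jointly polynomial in h and w.\<close>

lemma bpoly_divide: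
  assumes "bpoly Z G"
  shows "\<exists>D. bpoly Z D \<and> (\<forall>p h w. G p h w = G p h (c * h) + (w - c * h) *\<^sub>R D p h w)"
  using assms
proof induction
  case (bpoly_const q)
  then show ?case by (intro exI[of _ "\<lambda>p h w. 0"]) (simp add: bpoly_constant)
next
  case (bpoly_add G H)
  then obtain D E where D: "bpoly Z D" "bpoly Z E"
    "\<And>p h w. G p h w = G p h (c * h) + (w - c * h) *\<^sub>R D p h w"
    "\<And>p h w. H p h w = H p h (c * h) + (w - c * h) *\<^sub>R E p h w" by blast
  show ?case
    by (intro exI[of _ "\<lambda>p h w. D p h w + E p h w"] conjI allI, intro bpoly.bpoly_add D,
        subst D(3), subst D(4)) (simp add: algebra_simps)
next
  case (bpoly_mult_h G)
  then obtain D where D: "bpoly Z D"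
    "\<And>p h w. G p h w = G p h (c * h) + (w - c * h) *\<^sub>R D p h w" by blast
  show ?case
    by (intro exI[of _ "\<lambda>p h w. h *\<^sub>R D p h w"] conjI allI, intro bpoly.bpoly_mult_h D,
        subst D(2)) (simp add: algebra_simps)
next
  case (bpoly_mult_w G)
  then obtain D where D: "bpoly Z D"
    "\<And>p h w. G p h w = G p h (c * h) + (w - c * h) *\<^sub>R D p h w" by blast
  have "bpoly Z (\<lambda>p h w. G p h w + c *\<^sub>R (h *\<^sub>R D p h w))"
    by (intro bpoly.bpoly_add bpoly_scaleR_const bpoly.bpoly_mult_h D bpoly_mult_w.hyps)
  moreover have "w *\<^sub>R G p h w = (c * h) *\<^sub>R G p h (c * h) +
      (w - c * h) *\<^sub>R (G p h w + c *\<^sub>R (h *\<^sub>R D p h w))" for p h w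
  proof -
    have "(c * h) *\<^sub>R G p h w = (c * h) *\<^sub>R (G p h (c * h) + (w - c * h) *\<^sub>R D p h w)"
      by (subst D(2)) simp
    then show ?thesis by (simp add: algebra_simps)
  qed
  ultimately show ?case
    by (intro exI[of _ "\<lambda>p h w. G p h w + c *\<^sub>R (h *\<^sub>R D p h w)"]) blast
qed

text \<open>On a ray w is itself a multiple of h, so everything beyond the value at the origin is
  divisible by h.\<close>

lemma bpoly_on_ray_divide:
  assumes "bpoly Z G"
  shows "\<exists>D. bpoly Z D \<and> (\<forall>p h. G p h (c * h) = G p 0 0 + h *\<^sub>R D p h (c * h))"
  using assms
proof induction
  case (bpoly_const q)
  then show ?case by (intro exI[of _ "\<lambda>p h w. 0"]) (simp add: bpoly_constant)
next
  case (bpoly_add G H)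
  then obtain D E where D: "bpoly Z D" "bpoly Z E"
    "\<And>p h. G p h (c * h) = G p 0 0 + h *\<^sub>R D p h (c * h)"
    "\<And>p h. H p h (c * h) = H p 0 0 + h *\<^sub>R E p h (c * h)" by blast
  then show ?case
    by (intro exI[of _ "\<lambda>p h w. D p h w + E p h w"])
      (simp add: bpoly.bpoly_add scaleR_add_right)
next
  case (bpoly_mult_h G)
  then show ?case by auto
next
  case (bpoly_mult_w G)
  then show ?case
    by (intro exI[of _ "\<lambda>p h w. c *\<^sub>R G p h w"]) (simp add: bpoly_scaleR_const mult.commute)
qed

lemma bpoly_bounded:
  assumes "bpoly Z G"
  shows "\<exists>C\<ge>0. \<forall>p\<in>Z. \<forall>h w. \<bar>h\<bar> \<le> 1 \<longrightarrow> \<bar>w\<bar> \<le> M \<longrightarrow> norm (G p h w) \<le> C"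
  using assms
proof induction
  case (bpoly_const q)
  then obtain B where "\<And>p. p \<in> Z \<Longrightarrow> norm (q p) \<le> B" by (auto simp: bounded_iff)
  then show ?case by (intro exI[of _ "max 0 B"]) (auto intro: max.coboundedI2)
next
  case (bpoly_add G H)
  then obtain C D where "0 \<le> C" "0 \<le> D"
    "\<forall>p\<in>Z. \<forall>h w. \<bar>h\<bar> \<le> 1 \<longrightarrow> \<bar>w\<bar> \<le> M \<longrightarrow> norm (G p h w) \<le> C"
    "\<forall>p\<in>Z. \<forall>h w. \<bar>h\<bar> \<le> 1 \<longrightarrow> \<bar>w\<bar> \<le> M \<longrightarrow> norm (H p h w) \<le> D" by blast
  then show ?case by (intro exI[of _ "C + D"]) (auto intro!: norm_triangle_mono)
next
  case (bpoly_mult_h G)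
  then obtain C where "0 \<le> C"
    "\<forall>p\<in>Z. \<forall>h w. \<bar>h\<bar> \<le> 1 \<longrightarrow> \<bar>w\<bar> \<le> M \<longrightarrow> norm (G p h w) \<le> C" by blast
  then show ?case
    by (intro exI[of _ C]) (auto intro: order_trans[OF mult_left_le_one_le])
next
  case (bpoly_mult_w G)
  then obtain C where "0 \<le> C"
    "\<forall>p\<in>Z. \<forall>h w. \<bar>h\<bar> \<le> 1 \<longrightarrow> \<bar>w\<bar> \<le> M \<longrightarrow> norm (G p h w) \<le> C" by blast
  then show ?case
    by (intro exI[of _ "max 0 M * C"]) (auto intro!: mult_mono intro: max.coboundedI2)
qed

text \<open>Along the ray the polynomial equals its value at the origin plus O(h), so the limit
  forces that value to be 0. The quotient is again of the class \<open>bpoly\<close>, which allows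
  iteration.\<close>

lemma bpoly_ray_vanishing:
  assumes G: "bpoly Z G" and lim: "\<And>p. p \<in> Z \<Longrightarrow> ((\<lambda>h. G p h (c * h)) \<longlongrightarrow> 0) (at_right 0)"
  shows "\<exists>E. bpoly Z E \<and> (\<forall>p\<in>Z. \<forall>h. G p h (c * h) = h *\<^sub>R E p h (c * h))"
proof -
  obtain D where D: "bpoly Z D" "\<And>p h. G p h (c * h) = G p 0 0 + h *\<^sub>R D p h (c * h)"
    using bpoly_on_ray_divide[OF G, of c] by blast
  obtain C where C: "\<forall>p\<in>Z. \<forall>h w. \<bar>h\<bar> \<le> 1 \<longrightarrow> \<bar>w\<bar> \<le> \<bar>c\<bar> \<longrightarrow> norm (D p h w) \<le> C"
    using bpoly_bounded[OF D(1)] by blast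
  have "G p 0 0 = 0" if p: "p \<in> Z" for p
  proof -
    have small: "\<forall>\<^sub>F h :: real in at_right 0. 0 < h \<and> h < 1"
      by (auto simp: eventually_at_right_field intro!: exI[of _ 1])
    have "\<forall>\<^sub>F h in at_right 0. norm (D p h (c * h)) \<le> C"
      using small
    proof eventually_elim
      case (elim h)
      then have "\<bar>c * h\<bar> \<le> \<bar>c\<bar> * 1" unfolding abs_mult by (intro mult_left_mono) auto
      with elim C p show ?case by auto
    qed
    then have "Bfun (\<lambda>h. D p h (c * h)) (at_right 0)" by (rule BfunI)
    moreover have "((\<lambda>h. h) \<longlongrightarrow> 0) (at_right (0::real))" by (rule tendsto_ident_at)
    ultimately have "((\<lambda>h. h *\<^sub>R D p h (c * h)) \<longlongrightarrow> 0) (at_right 0)"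
      by (simp add: bounded_bilinear.Zfun_prod_Bfun[OF bounded_bilinear_scaleR] tendsto_Zfun_iff)
    from tendsto_add[OF tendsto_const this]
    have "((\<lambda>h. G p h (c * h)) \<longlongrightarrow> G p 0 0 + 0) (at_right 0)" by (simp add: D(2))
    then show ?thesis using lim[OF p] by (simp add: tendsto_unique[OF trivial_limit_at_right_real])
  qed
  with D show ?thesis by auto
qed

text \<open>A polynomial has no orders between two powers: what is o(h^M) on a ray is divisible by
  h^(M+1). This gains the power by which the little-o information at the nodes becomes an O(h^(n+2))
  remainder.\<close>

lemma bpoly_ray_order:
  assumes G: "bpoly Z G"
    and lim: "\<And>p. p \<in> Z \<Longrightarrow> ((\<lambda>h. (1 / h ^ M) *\<^sub>R G p h (c * h)) \<longlongrightarrow> 0) (at_right 0)"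
  shows "\<exists>E. bpoly Z E \<and> (\<forall>p\<in>Z. \<forall>h. G p h (c * h) = h ^ Suc M *\<^sub>R E p h (c * h))"
  using lim
proof (induction M)
  case 0
  then show ?case using bpoly_ray_vanishing[OF G] by simp
next
  case (Suc M)
  have pos: "\<forall>\<^sub>F h :: real in at_right 0. 0 < h" by (simp add: eventually_at_right_less)
  have "((\<lambda>h. (1 / h ^ M) *\<^sub>R G p h (c * h)) \<longlongrightarrow> 0) (at_right 0)" if p: "p \<in> Z" for p
  proof -
    have "((\<lambda>h. h *\<^sub>R (1 / h ^ Suc M) *\<^sub>R G p h (c * h)) \<longlongrightarrow> 0 *\<^sub>R 0) (at_right 0)"
      by (intro tendsto_scaleR tendsto_ident_at Suc.prems p)
    then have "((\<lambda>h. h *\<^sub>R (1 / h ^ Suc M) *\<^sub>R G p h (c * h)) \<longlongrightarrow> 0) (at_right 0)" by simp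
    moreover have "\<forall>\<^sub>F h in at_right 0. h *\<^sub>R (1 / h ^ Suc M) *\<^sub>R G p h (c * h) =
        (1 / h ^ M) *\<^sub>R G p h (c * h)"
      using pos by eventually_elim simp
    ultimately show ?thesis by (rule Lim_transform_eventually)
  qed
  from Suc.IH[OF this] obtain E where E: "bpoly Z E"
    "\<And>p h. p \<in> Z \<Longrightarrow> G p h (c * h) = h ^ Suc M *\<^sub>R E p h (c * h)" by blast
  have "((\<lambda>h. E p h (c * h)) \<longlongrightarrow> 0) (at_right 0)" if p: "p \<in> Z" for p
  proof (rule Lim_transform_eventually[OF Suc.prems[OF p]])
    show "\<forall>\<^sub>F h in at_right 0. (1 / h ^ Suc M) *\<^sub>R G p h (c * h) = E p h (c * h)"
      using pos by eventually_elim (simp add: E(2)[OF p])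
  qed
  from bpoly_ray_vanishing[OF E(1) this] obtain E' where E': "bpoly Z E'"
    "\<And>p h. p \<in> Z \<Longrightarrow> E p h (c * h) = h *\<^sub>R E' p h (c * h)" by blast
  have "G p h (c * h) = h ^ Suc (Suc M) *\<^sub>R E' p h (c * h)" if "p \<in> Z" for p h
    using E(2)[OF that, of h] E'(2)[OF that, of h] by (simp add: mult_ac)
  with E'(1) show ?case by blast
qed

text \<open>Successive division by \<open>w - l h\<close>, as in Newton interpolation: each remainder is the value
  on a node ray divided by a lower power of \<open>h\<close>, so it stays of higher order.\<close>

lemma bpoly_nodal_form_step:
  assumes G: "bpoly Z G"
    and node: "\<And>p l. p \<in> Z \<Longrightarrow> l \<le> n \<Longrightarrow>
      ((\<lambda>h. (1 / h ^ Suc n) *\<^sub>R G p h (real l * h)) \<longlongrightarrow> 0) (at_right 0)"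
    and r: "r \<le> Suc n"
  shows "\<exists>D C. bpoly Z D \<and> (\<forall>p\<in>Z. \<forall>u h. 0 \<le> u \<longrightarrow> u \<le> real n \<longrightarrow> 0 < h \<longrightarrow> h \<le> 1 \<longrightarrow>
     norm (G p h (u * h) - (h ^ r * (\<Prod>l<r. u - real l)) *\<^sub>R D p h (u * h)) \<le> C * h ^ Suc (Suc n))"
  using r
proof (induction r)
  case 0
  then show ?case using G by (intro exI[of _ G] exI[of _ 0]) simp
next
  case (Suc r)
  define \<pi> where "\<pi> u = (\<Prod>l<r. u - real l)" for u
  obtain D C where D: "bpoly Z D" and C: "\<And>p u h. p \<in> Z \<Longrightarrow> 0 \<le> u \<Longrightarrow> u \<le> real n \<Longrightarrow> 0 < h \<Longrightarrow> h \<le> 1 \<Longrightarrow>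
      norm (G p h (u * h) - (h ^ r * \<pi> u) *\<^sub>R D p h (u * h)) \<le> C * h ^ Suc (Suc n)"
    using Suc.IH[OF Suc_leD[OF Suc.prems]] unfolding \<pi>_def by blast
  have r: "r \<le> n" using Suc.prems by simp
  have pi_r: "\<pi> (real r) \<noteq> 0" by (auto simp: \<pi>_def)
  have pos: "\<forall>\<^sub>F h :: real in at_right 0. 0 < h \<and> h < 1"
    by (auto simp: eventually_at_right_field intro!: exI[of _ 1])
  \<comment> \<open>At u = r the product over the earlier nodes does not vanish, so the order of
    \<open>G\<close> on this ray passes to \<open>D\<close>, less the r powers of h already
    extracted. The difference \<open>e\<close> is harmless by the induction hypothesis.\<close>
  have "((\<lambda>h. (1 / h ^ (Suc n - r)) *\<^sub>R D p h (real r * h)) \<longlongrightarrow> 0) (at_right 0)" if p: "p \<in> Z" for p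
  proof -
    define e where "e h = (1 / h ^ Suc n) *\<^sub>R
      (G p h (real r * h) - (h ^ r * \<pi> (real r)) *\<^sub>R D p h (real r * h))" for h
    have "((\<lambda>h. C * h) \<longlongrightarrow> C * 0) (at_right (0::real))"
      by (intro tendsto_intros)
    then have "((\<lambda>h. C * h) \<longlongrightarrow> 0) (at_right (0::real))" by simp
    moreover have "\<forall>\<^sub>F h in at_right 0. norm (e h) \<le> C * h"
      using pos
    proof eventually_elim
      case (elim h)
      have "norm (e h) = 1 / h ^ Suc n *
          norm (G p h (real r * h) - (h ^ r * \<pi> (real r)) *\<^sub>R D p h (real r * h))"
        using elim by (simp add: e_def)
      also have "\<dots> \<le> 1 / h ^ Suc n * (C * h ^ Suc (Suc n))"
        using elim C[OF p, of "real r" h] r by (intro mult_left_mono) auto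
      also have "\<dots> = C * h" using elim by simp
      finally show ?case .
    qed
    ultimately have "(e \<longlongrightarrow> 0) (at_right 0)" by (rule Lim_null_comparison[rotated])
    from tendsto_diff[OF node[OF p r] this]
    have "((\<lambda>h. (1 / h ^ Suc n) *\<^sub>R G p h (real r * h) - e h) \<longlongrightarrow> 0) (at_right 0)" by simp
    from tendsto_scaleR[OF tendsto_const[of "1 / \<pi> (real r)"] this]
    have "((\<lambda>h. (1 / \<pi> (real r)) *\<^sub>R ((1 / h ^ Suc n) *\<^sub>R G p h (real r * h) - e h)) \<longlongrightarrow> 0) (at_right 0)"
      by simp
    then show ?thesis
    proof (rule Lim_transform_eventually)
      show "\<forall>\<^sub>F h in at_right 0. (1 / \<pi> (real r)) *\<^sub>R ((1 / h ^ Suc n) *\<^sub>R G p h (real r * h) - e h) =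
          (1 / h ^ (Suc n - r)) *\<^sub>R D p h (real r * h)"
        using pos
      proof eventually_elim
        case (elim h)
        have "h ^ Suc n = h ^ (Suc n - r) * h ^ r" using r by (simp flip: power_add)
        then show ?case using elim pi_r by (simp add: e_def algebra_simps)
      qed
    qed
  qed
  from bpoly_ray_order[OF D this] obtain E where E: "bpoly Z E"
    "\<And>p h. p \<in> Z \<Longrightarrow> D p h (real r * h) = h ^ Suc (Suc n - r) *\<^sub>R E p h (real r * h)" by blast
  obtain D' where D': "bpoly Z D'"
    "\<And>p h w. D p h w = D p h (real r * h) + (w - real r * h) *\<^sub>R D' p h w"
    using bpoly_divide[OF D, of "real r"] by blast
  obtain B where B: "0 \<le> B" "\<And>p h w. p \<in> Z \<Longrightarrow> \<bar>h\<bar> \<le> 1 \<Longrightarrow> \<bar>w\<bar> \<le> real r \<Longrightarrow> norm (E p h w) \<le> B"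
    using bpoly_bounded[OF E(1), of "real r"] by blast
  have pi_le: "\<bar>\<pi> u\<bar> \<le> real n ^ r" if "0 \<le> u" "u \<le> real n" for u
  proof -
    have "\<bar>\<pi> u\<bar> = (\<Prod>l<r. \<bar>u - real l\<bar>)" by (simp add: \<pi>_def abs_prod)
    also have "\<dots> \<le> (\<Prod>l<r. real n)"
      using that r by (intro prod_mono) auto
    finally show ?thesis by simp
  qed
  have "norm (G p h (u * h) - (h ^ Suc r * (\<Prod>l<Suc r. u - real l)) *\<^sub>R D' p h (u * h))
      \<le> (C + real n ^ r * B) * h ^ Suc (Suc n)"
    if *: "p \<in> Z" "0 \<le> u" "u \<le> real n" "0 < h" "h \<le> 1" for p u h
  proof -
    \<comment> \<open>On the ray, \<open>D\<close> is divisible by h^(n+2-r); together with the r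
      extracted powers the discarded remainder is O(h^(n+2)).\<close>
    have pw: "h ^ Suc (Suc n) = h ^ r * h ^ Suc (Suc n - r)"
      using r by (simp flip: power_add power_Suc)
    have "(h ^ r * \<pi> u) *\<^sub>R D p h (u * h) = (h ^ r * \<pi> u) *\<^sub>R D p h (real r * h)
        + (h ^ r * \<pi> u) *\<^sub>R ((u * h - real r * h) *\<^sub>R D' p h (u * h))"
      by (subst D'(2)) (simp add: scaleR_add_right)
    also have "(h ^ r * \<pi> u) *\<^sub>R D p h (real r * h) = (h ^ Suc (Suc n) * \<pi> u) *\<^sub>R E p h (real r * h)"
      unfolding E(2)[OF *(1)] pw by simp
    also have "(h ^ r * \<pi> u) *\<^sub>R ((u * h - real r * h) *\<^sub>R D' p h (u * h)) =
        (h ^ Suc r * (\<Prod>l<Suc r. u - real l)) *\<^sub>R D' p h (u * h)"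
      by (simp add: \<pi>_def algebra_simps)
    finally have eq: "G p h (u * h) - (h ^ Suc r * (\<Prod>l<Suc r. u - real l)) *\<^sub>R D' p h (u * h) =
        (G p h (u * h) - (h ^ r * \<pi> u) *\<^sub>R D p h (u * h))
        + (h ^ Suc (Suc n) * \<pi> u) *\<^sub>R E p h (real r * h)" by simp
    have "norm ((h ^ Suc (Suc n) * \<pi> u) *\<^sub>R E p h (real r * h)) =
        h ^ Suc (Suc n) * (\<bar>\<pi> u\<bar> * norm (E p h (real r * h)))"
      using * by (simp add: abs_mult)
    also have "\<dots> \<le> h ^ Suc (Suc n) * (real n ^ r * B)"
      using * pi_le B mult_left_mono[of h 1 "real r"]
      by (intro mult_left_mono mult_mono) auto
    finally show ?thesis
      unfolding eq using C[OF *] by (intro order_trans[OF norm_triangle_ineq]) (simp add: algebra_simps)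
  qed
  with D'(1) show ?case by blast
qed

text \<open>After division by all n + 1 nodes the coefficient is the value of the quotient at the
  origin. Its further terms go into the remainder, since w = u h with bounded u is O(h).\<close>

lemma bpoly_nodal_form:
  assumes G: "bpoly Z G"
    and node: "\<And>p l. p \<in> Z \<Longrightarrow> l \<le> n \<Longrightarrow>
      ((\<lambda>h. (1 / h ^ Suc n) *\<^sub>R G p h (real l * h)) \<longlongrightarrow> 0) (at_right 0)"
  shows "\<exists>A C. bounded (A ` Z) \<and> (\<forall>p\<in>Z. \<forall>u h. 0 \<le> u \<longrightarrow> u \<le> real n \<longrightarrow> 0 < h \<longrightarrow> h \<le> 1 \<longrightarrow>
     norm (G p h (u * h) - (h ^ Suc n * (\<Prod>l\<le>n. u - real l)) *\<^sub>R A p) \<le> C * h ^ Suc (Suc n))"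
proof -
  define \<pi> where "\<pi> u = (\<Prod>l<Suc n. u - real l)" for u
  obtain D C where D: "bpoly Z D" and C: "\<And>p u h. p \<in> Z \<Longrightarrow> 0 \<le> u \<Longrightarrow> u \<le> real n \<Longrightarrow> 0 < h \<Longrightarrow> h \<le> 1 \<Longrightarrow>
      norm (G p h (u * h) - (h ^ Suc n * \<pi> u) *\<^sub>R D p h (u * h)) \<le> C * h ^ Suc (Suc n)"
    using bpoly_nodal_form_step[OF G node, of "Suc n"] unfolding \<pi>_def by blast
  obtain D1 where D1: "bpoly Z D1" "\<And>p h w. D p h w = D p h (0 * h) + (w - 0 * h) *\<^sub>R D1 p h w"
    using bpoly_divide[OF D, of 0] by blast
  obtain D2 where D2: "bpoly Z D2" "\<And>p h. D p h (0 * h) = D p 0 0 + h *\<^sub>R D2 p h (0 * h)"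
    using bpoly_on_ray_divide[OF D, of 0] by blast
  obtain B where B: "\<And>p h w. p \<in> Z \<Longrightarrow> \<bar>h\<bar> \<le> 1 \<Longrightarrow> \<bar>w\<bar> \<le> 1 \<Longrightarrow> norm (D p h w) \<le> B"
    using bpoly_bounded[OF D] by blast
  obtain B1 where B1: "0 \<le> B1" "\<And>p h w. p \<in> Z \<Longrightarrow> \<bar>h\<bar> \<le> 1 \<Longrightarrow> \<bar>w\<bar> \<le> real n \<Longrightarrow> norm (D1 p h w) \<le> B1"
    using bpoly_bounded[OF D1(1)] by blast
  obtain B2 where B2: "0 \<le> B2" "\<And>p h w. p \<in> Z \<Longrightarrow> \<bar>h\<bar> \<le> 1 \<Longrightarrow> \<bar>w\<bar> \<le> 1 \<Longrightarrow> norm (D2 p h w) \<le> B2"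
    using bpoly_bounded[OF D2(1)] by blast
  define K where "K = real n ^ Suc n * (B2 + real n * B1)"
  have "norm (G p h (u * h) - (h ^ Suc n * \<pi> u) *\<^sub>R D p 0 0) \<le> (C + K) * h ^ Suc (Suc n)"
    if *: "p \<in> Z" "0 \<le> u" "u \<le> real n" "0 < h" "h \<le> 1" for p u h
  proof -
    have uh: "\<bar>u * h\<bar> \<le> real n"
      using * mult_mono[of u "real n" h 1] by simp
    have "D p h (u * h) - D p 0 0 = h *\<^sub>R (D2 p h 0 + u *\<^sub>R D1 p h (u * h))"
      using D1(2)[of p h "u * h"] D2(2)[of p h] by (simp add: scaleR_add_right mult.commute)
    also have "norm \<dots> \<le> h * (B2 + real n * B1)"
      unfolding norm_scaleR using * B1 B2 uh
      by (intro mult_mono order_trans[OF norm_triangle_ineq] add_mono) (auto intro!: mult_mono)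
    finally have le: "norm (D p h (u * h) - D p 0 0) \<le> h * (B2 + real n * B1)" .
    have "\<bar>\<pi> u\<bar> = (\<Prod>l<Suc n. \<bar>u - real l\<bar>)" unfolding \<pi>_def by (rule abs_prod)
    also have "\<dots> \<le> (\<Prod>l<Suc n. real n)"
      using * by (intro prod_mono) auto
    finally have pi: "\<bar>\<pi> u\<bar> \<le> real n ^ Suc n" by simp
    have "norm ((h ^ Suc n * \<pi> u) *\<^sub>R (D p h (u * h) - D p 0 0)) =
        h ^ Suc n * (\<bar>\<pi> u\<bar> * norm (D p h (u * h) - D p 0 0))"
      using * by (simp add: abs_mult)
    also have "\<dots> \<le> h ^ Suc n * (real n ^ Suc n * (h * (B2 + real n * B1)))"
      using * le pi by (intro mult_left_mono mult_mono) auto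
    also have "\<dots> = K * h ^ Suc (Suc n)" by (simp add: K_def)
    finally have "norm ((h ^ Suc n * \<pi> u) *\<^sub>R (D p h (u * h) - D p 0 0)) \<le> K * h ^ Suc (Suc n)" .
    then show ?thesis
      using norm_triangle_mono[OF C[OF *]] by (fastforce simp: algebra_simps)
  qed
  moreover have "bounded ((\<lambda>p. D p 0 0) ` Z)"
    using B[of _ 0 0] by (auto simp: bounded_iff)
  moreover have "{..<Suc n} = {..n}" by auto
  ultimately show ?thesis
    unfolding \<pi>_def by (intro exI[of _ "\<lambda>p. D p 0 0"] exI[of _ "C + K"]) auto
qed

section \<open>Expansions along a family of stencils\<close>

text \<open>A single filter encodes "as h tends to 0, uniformly in base point and position"; the
  calculus of orders below then needs no explicit quantifiers over these.\<close>

locale stencil_regime =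
  fixes F :: "'x filter" and Z :: "'p set" and par :: "'x \<Rightarrow> 'p"
    and u h :: "'x \<Rightarrow> real" and N :: nat and U :: real
  assumes par_in: "\<forall>\<^sub>F x in F. par x \<in> Z"
    and h_lim: "filterlim h (at_right 0) F"
    and u_bound: "\<forall>\<^sub>F x in F. \<bar>u x\<bar> \<le> U"
    and N_pos: "2 \<le> N"
begin

text \<open>Little-o and not big-O of a higher power: for a curve of class C^N the Taylor remainder
  of order N gives no more.\<close>

definition negl :: "('x \<Rightarrow> 'v::real_normed_vector) \<Rightarrow> bool" where
  "negl e \<longleftrightarrow> (\<forall>\<epsilon>>0. \<forall>\<^sub>F x in F. norm (e x) \<le> \<epsilon> * h x ^ N)"

text \<open>One expansion \<open>G\<close> serves all stencil shifts \<open>i\<close>; hence differences in \<open>i\<close> gain a factor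
  \<open>h\<close>, while multiplication by \<open>\<theta> - i\<close> loses one.\<close>

definition reg :: "int set \<Rightarrow> nat \<Rightarrow> (int \<Rightarrow> 'x \<Rightarrow> 'v::real_normed_vector) \<Rightarrow> bool" where
  "reg I d f \<longleftrightarrow> (\<exists>G. bpoly Z G \<and>
     (\<forall>i\<in>I. negl (\<lambda>x. f i x - h x ^ d *\<^sub>R G (par x) (h x) ((u x - of_int i) * h x))))"

lemma h_small: "0 < \<delta> \<Longrightarrow> \<forall>\<^sub>F x in F. 0 < h x \<and> h x < \<delta>"
  using h_lim order_tendstoD(2)[of h 0 F \<delta>] unfolding filterlim_at
  by (auto elim: eventually_elim2)

lemma negl_zero: "negl (\<lambda>x. 0)"
  unfolding negl_def using h_small[of 1] by (auto elim!: eventually_mono)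

lemma negl_add:
  assumes "negl e" "negl f"
  shows "negl (\<lambda>x. e x + f x)"
  unfolding negl_def
proof (intro allI impI)
  fix \<epsilon> :: real assume "0 < \<epsilon>"
  then have "0 < \<epsilon> / 2" by simp
  then have "\<forall>\<^sub>F x in F. norm (e x) \<le> \<epsilon> / 2 * h x ^ N" "\<forall>\<^sub>F x in F. norm (f x) \<le> \<epsilon> / 2 * h x ^ N"
    using assms unfolding negl_def by blast+
  then show "\<forall>\<^sub>F x in F. norm (e x + f x) \<le> \<epsilon> * h x ^ N"
    by eventually_elim (rule order_trans[OF norm_triangle_ineq], simp)
qed

lemma negl_le:
  assumes "negl e" "\<forall>\<^sub>F x in F. norm (f x) \<le> C * norm (e x)"
  shows "negl f"
  unfolding negl_def
proof (intro allI impI)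
  fix \<epsilon> :: real assume \<epsilon>: "0 < \<epsilon>"
  define C' where "C' = max C 1"
  have "0 < \<epsilon> / C'" using \<epsilon> by (simp add: C'_def)
  then have "\<forall>\<^sub>F x in F. norm (e x) \<le> \<epsilon> / C' * h x ^ N"
    using assms(1) unfolding negl_def by blast
  then show "\<forall>\<^sub>F x in F. norm (f x) \<le> \<epsilon> * h x ^ N"
    using assms(2)
  proof eventually_elim
    case (elim x)
    have "norm (f x) \<le> C' * norm (e x)"
      using elim(2) by (rule order_trans) (auto simp: C'_def intro: mult_right_mono)
    also have "\<dots> \<le> C' * (\<epsilon> / C' * h x ^ N)"
      using elim(1) by (intro mult_left_mono) (auto simp: C'_def)
    also have "\<dots> = \<epsilon> * h x ^ N" by (simp add: C'_def)
    finally show ?case .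
  qed
qed

lemma negl_cong: "negl e \<Longrightarrow> \<forall>\<^sub>F x in F. f x = e x \<Longrightarrow> negl f"
  by (erule negl_le[where C = 1]) (auto elim: eventually_mono)

lemma negl_bilinear_left:
  assumes "bounded_bilinear bop" "negl e" "\<forall>\<^sub>F x in F. norm (f x) \<le> C"
  shows "negl (\<lambda>x. bop (e x) (f x))"
proof -
  obtain K where K: "0 \<le> K" "\<And>x y. norm (bop x y) \<le> norm x * norm y * K"
    using bounded_bilinear.nonneg_bounded[OF assms(1)] by blast
  have "\<forall>\<^sub>F x in F. norm (bop (e x) (f x)) \<le> (C * K) * norm (e x)"
    using assms(3)
  proof eventually_elim
    case (elim x)
    have "norm (bop (e x) (f x)) \<le> norm (e x) * norm (f x) * K" by (rule K)
    also have "\<dots> \<le> norm (e x) * C * K"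
      using elim K by (intro mult_right_mono mult_left_mono) auto
    finally show ?case by (simp add: mult_ac)
  qed
  with assms(2) show ?thesis by (rule negl_le)
qed

lemma negl_bilinear_right:
  assumes "bounded_bilinear bop" "\<forall>\<^sub>F x in F. norm (f x) \<le> C" "negl e"
  shows "negl (\<lambda>x. bop (f x) (e x))"
  using negl_bilinear_left[OF bounded_bilinear.flip[OF assms(1)] assms(3,2)] .

lemma negl_h_power:
  assumes "N < d" "\<forall>\<^sub>F x in F. norm (f x) \<le> C * h x ^ d"
  shows "negl f"
  unfolding negl_def
proof (intro allI impI)
  fix \<epsilon> :: real assume \<epsilon>: "0 < \<epsilon>"
  define C' where "C' = max C 1"
  have "\<forall>\<^sub>F x in F. 0 < h x \<and> h x < min 1 (\<epsilon> / C')"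
    using \<epsilon> by (intro h_small) (auto simp: C'_def)
  then show "\<forall>\<^sub>F x in F. norm (f x) \<le> \<epsilon> * h x ^ N"
    using assms(2)
  proof eventually_elim
    case (elim x)
    have "norm (f x) \<le> C' * h x ^ d"
      using elim by (elim order_trans) (auto simp: C'_def intro!: mult_right_mono)
    also have "\<dots> \<le> C' * h x ^ Suc N"
      using elim assms(1) by (intro mult_left_mono power_decreasing) (auto simp: C'_def)
    also have "\<dots> = (C' * h x) * h x ^ N" by simp
    also have "\<dots> \<le> \<epsilon> * h x ^ N"
      using elim by (intro mult_right_mono) (auto simp: C'_def field_simps)
    finally show ?case .
  qed
qed

lemma bpoly_eventually_bounded:
  assumes "bpoly Z G"
  obtains C where "\<forall>\<^sub>F x in F. norm (G (par x) (h x) ((u x - of_int i) * h x)) \<le> C"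
proof -
  obtain C where C: "\<forall>p\<in>Z. \<forall>h w. \<bar>h\<bar> \<le> 1 \<longrightarrow> \<bar>w\<bar> \<le> U + \<bar>of_int i\<bar> \<longrightarrow> norm (G p h w) \<le> C"
    using bpoly_bounded[OF assms] by blast
  have "\<forall>\<^sub>F x in F. norm (G (par x) (h x) ((u x - of_int i) * h x)) \<le> C"
    using par_in u_bound h_small[of 1, OF zero_less_one]
  proof eventually_elim
    case (elim x)
    have "\<bar>(u x - of_int i) * h x\<bar> \<le> (U + \<bar>of_int i\<bar>) * 1"
      unfolding abs_mult using elim by (intro mult_mono) auto
    with elim C show ?case by auto
  qed
  then show ?thesis by (rule that)
qed

lemma reg_cong:
  assumes "reg I d f" "\<And>i. i \<in> I \<Longrightarrow> \<forall>\<^sub>F x in F. g i x = f i x"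
  shows "reg I d g"
proof -
  obtain G where G: "bpoly Z G"
    "\<And>i. i \<in> I \<Longrightarrow> negl (\<lambda>x. f i x - h x ^ d *\<^sub>R G (par x) (h x) ((u x - of_int i) * h x))"
    using assms(1) by (auto simp: reg_def)
  have "negl (\<lambda>x. g i x - h x ^ d *\<^sub>R G (par x) (h x) ((u x - of_int i) * h x))" if "i \<in> I" for i
    by (rule negl_cong[OF G(2)[OF that]]) (use assms(2)[OF that] in \<open>auto elim: eventually_mono\<close>)
  with G show ?thesis by (auto simp: reg_def)
qed

lemma reg_subset: "reg I d f \<Longrightarrow> J \<subseteq> I \<Longrightarrow> reg J d f"
  unfolding reg_def by blast

lemma reg_const: "bounded (q ` Z) \<Longrightarrow> reg I 0 (\<lambda>i x. q (par x))"
  unfolding reg_def by (intro exI[of _ "\<lambda>p h w. q p"]) (simp add: bpoly_const negl_zero)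

lemma reg_constant: "reg I 0 (\<lambda>i x. c)"
  using reg_const[of "\<lambda>_. c"] by (simp add: image_constant_conv)

lemma reg_zero: "reg I d (\<lambda>i x. 0)"
  unfolding reg_def by (intro exI[of _ "\<lambda>p h w. 0"]) (simp add: bpoly_constant negl_zero)

lemma reg_add:
  assumes "reg I d f" "reg I d g"
  shows "reg I d (\<lambda>i x. f i x + g i x)"
proof -
  obtain G H where G: "bpoly Z G" "bpoly Z H"
    "\<And>i. i \<in> I \<Longrightarrow> negl (\<lambda>x. f i x - h x ^ d *\<^sub>R G (par x) (h x) ((u x - of_int i) * h x))"
    "\<And>i. i \<in> I \<Longrightarrow> negl (\<lambda>x. g i x - h x ^ d *\<^sub>R H (par x) (h x) ((u x - of_int i) * h x))"
    using assms by (auto simp: reg_def)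
  show ?thesis
    unfolding reg_def
    by (intro exI[of _ "\<lambda>p h w. G p h w + H p h w"] conjI ballI bpoly_add G)
      (rule negl_cong[OF negl_add[OF G(3,4)]], auto simp: algebra_simps)
qed

lemma reg_bound:
  assumes "reg I d f" "i \<in> I" "d \<le> N"
  obtains C where "0 \<le> C" "\<forall>\<^sub>F x in F. norm (f i x) \<le> C * h x ^ d"
proof -
  obtain G where G: "bpoly Z G"
    "negl (\<lambda>x. f i x - h x ^ d *\<^sub>R G (par x) (h x) ((u x - of_int i) * h x))"
    using assms(1,2) by (auto simp: reg_def)
  obtain C where C: "\<forall>\<^sub>F x in F. norm (G (par x) (h x) ((u x - of_int i) * h x)) \<le> C"
    using bpoly_eventually_bounded[OF G(1)] by blast
  have "\<forall>\<^sub>F x in F. norm (f i x - h x ^ d *\<^sub>R G (par x) (h x) ((u x - of_int i) * h x)) \<le> 1 * h x ^ N"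
    using G(2) unfolding negl_def by (rule allE[of _ 1]) simp
  then have "\<forall>\<^sub>F x in F. norm (f i x) \<le> (1 + max 0 C) * h x ^ d"
    using C h_small[of 1, OF zero_less_one]
  proof eventually_elim
    case (elim x)
    let ?g = "h x ^ d *\<^sub>R G (par x) (h x) ((u x - of_int i) * h x)"
    have "norm (f i x) \<le> norm (f i x - ?g) + norm ?g"
      by (metis diff_add_cancel norm_triangle_ineq)
    moreover have "norm ?g \<le> h x ^ d * max 0 C"
      using elim by (auto intro!: mult_left_mono)
    moreover have "h x ^ N \<le> h x ^ d"
      using elim assms(3) by (intro power_decreasing) auto
    ultimately have "norm (f i x) \<le> h x ^ d + h x ^ d * max 0 C" using elim(1) by linarith
    also have "\<dots> = (1 + max 0 C) * h x ^ d" by (simp add: algebra_simps)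
    finally show ?case .
  qed
  then show ?thesis by (rule that[rotated]) simp
qed

lemma reg_bilinear:
  assumes b: "bounded_bilinear bop" and "reg I d f" "reg I e g"
  shows "reg I (d + e) (\<lambda>i x. bop (f i x) (g i x))"
proof -
  interpret bounded_bilinear bop by fact
  obtain G H where G: "bpoly Z G" "bpoly Z H"
    "\<And>i. i \<in> I \<Longrightarrow> negl (\<lambda>x. f i x - h x ^ d *\<^sub>R G (par x) (h x) ((u x - of_int i) * h x))"
    "\<And>i. i \<in> I \<Longrightarrow> negl (\<lambda>x. g i x - h x ^ e *\<^sub>R H (par x) (h x) ((u x - of_int i) * h x))"
    using assms by (auto simp: reg_def)
  show ?thesis
    unfolding reg_def
  proof (intro exI[of _ "\<lambda>p h w. bop (G p h w) (H p h w)"] conjI ballI bpoly_bilinear[OF b G(1,2)])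
    fix i assume i: "i \<in> I"
    let ?G = "\<lambda>x. h x ^ d *\<^sub>R G (par x) (h x) ((u x - of_int i) * h x)"
    let ?H = "\<lambda>x. h x ^ e *\<^sub>R H (par x) (h x) ((u x - of_int i) * h x)"
    \<comment> \<open>The powers of h are absorbed into the polynomials, so that
      \<open>reg_bound\<close> at order 0 yields plain boundedness whatever \<open>d\<close> and
      \<open>e\<close> are. Then the two errors are separated by the usual splitting of a difference
      of products.\<close>
    have "reg I 0 (\<lambda>i x. h x ^ d *\<^sub>R G (par x) (h x) ((u x - of_int i) * h x))"
      unfolding reg_def
      by (intro exI[of _ "\<lambda>p h w. h ^ d *\<^sub>R G p h w"]) (auto simp: bpoly_mult_h_power G negl_zero)
    from reg_bound[OF this i] obtain C where C: "\<forall>\<^sub>F x in F. norm (?G x) \<le> C" by auto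
    have "reg I 0 g"
      unfolding reg_def
      by (intro exI[of _ "\<lambda>p h w. h ^ e *\<^sub>R H p h w"]) (auto simp: bpoly_mult_h_power G)
    from reg_bound[OF this i] obtain D where D: "\<forall>\<^sub>F x in F. norm (g i x) \<le> D" by auto
    have "negl (\<lambda>x. bop (f i x - ?G x) (g i x) + bop (?G x) (g i x - ?H x))"
      by (intro negl_add negl_bilinear_left[OF b G(3)[OF i] D]
          negl_bilinear_right[OF b C G(4)[OF i]])
    then show "negl (\<lambda>x. bop (f i x) (g i x) - h x ^ (d + e) *\<^sub>R
        bop (G (par x) (h x) ((u x - of_int i) * h x)) (H (par x) (h x) ((u x - of_int i) * h x)))"
      by (rule negl_cong) (simp add: diff_left diff_right scaleR_left scaleR_right power_add)
  qed
qed

lemmas reg_scaleR = reg_bilinear[OF bounded_bilinear_scaleR]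
lemmas reg_mult = reg_bilinear[OF bounded_bilinear_mult]
lemmas reg_inner = reg_bilinear[OF bounded_bilinear_inner]

lemma reg_scaleR_const: "reg I d f \<Longrightarrow> reg I d (\<lambda>i x. c *\<^sub>R f i x)"
  using reg_scaleR[OF reg_constant, of I d f c] by simp

lemma reg_minus: "reg I d f \<Longrightarrow> reg I d (\<lambda>i x. - f i x)"
  using reg_scaleR_const[of I d f "- 1"] by simp

lemma reg_diff: "reg I d f \<Longrightarrow> reg I d g \<Longrightarrow> reg I d (\<lambda>i x. f i x - g i x)"
  using reg_add[OF _ reg_minus, of I d f g] by simp

lemma reg_sum:
  assumes "finite A" "\<And>a. a \<in> A \<Longrightarrow> reg I d (f a)"
  shows "reg I d (\<lambda>i x. \<Sum>a\<in>A. f a i x)"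
  using assms by (induction A rule: finite_induct) (auto intro: reg_zero reg_add)

lemma reg_power: "reg I 0 f \<Longrightarrow> reg I 0 (\<lambda>i x. f i x ^ k :: real)"
proof (induction k)
  case 0
  then show ?case using reg_constant[of I 1] by simp
next
  case (Suc k)
  then show ?case using reg_mult[of I 0 f 0 "\<lambda>i x. f i x ^ k"] by simp
qed

lemma reg_mono:
  assumes "reg I e f" "d \<le> e"
  shows "reg I d f"
proof -
  obtain G where G: "bpoly Z G"
    "\<And>i. i \<in> I \<Longrightarrow> negl (\<lambda>x. f i x - h x ^ e *\<^sub>R G (par x) (h x) ((u x - of_int i) * h x))"
    using assms by (auto simp: reg_def)
  have "h x ^ d * h x ^ (e - d) = h x ^ e" for x
    using assms(2) by (simp flip: power_add)
  with G show ?thesis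
    unfolding reg_def
    by (intro exI[of _ "\<lambda>p h w. h ^ (e - d) *\<^sub>R G p h w"]) (auto intro: bpoly_mult_h_power)
qed

text \<open>One power of h is traded for the variable w, because (u - i) h = w.\<close>

lemma reg_mult_u:
  assumes "reg I (Suc d) f"
  shows "reg I d (\<lambda>i x. (u x - of_int i) *\<^sub>R f i x)"
proof -
  obtain G where G: "bpoly Z G"
    "\<And>i. i \<in> I \<Longrightarrow> negl (\<lambda>x. f i x - h x ^ Suc d *\<^sub>R G (par x) (h x) ((u x - of_int i) * h x))"
    using assms by (auto simp: reg_def)
  have "\<forall>\<^sub>F x in F. norm (u x - of_int i) \<le> U + \<bar>of_int i\<bar>" for i
    using u_bound by eventually_elim auto
  note n = negl_bilinear_right[OF bounded_bilinear_scaleR this G(2)]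
  have "negl (\<lambda>x. (u x - of_int i) *\<^sub>R f i x -
      h x ^ d *\<^sub>R ((u x - of_int i) * h x) *\<^sub>R G (par x) (h x) ((u x - of_int i) * h x))"
    if "i \<in> I" for i
    by (rule negl_cong[OF n[OF that, of i]]) (simp add: scaleR_diff_right mult_ac)
  then show ?thesis
    unfolding reg_def
    by (intro exI[of _ "\<lambda>p h w. w *\<^sub>R G p h w"] conjI bpoly_mult_w G) blast
qed

lemma reg_difference:
  assumes "reg I d f" "\<And>i. i \<in> J \<Longrightarrow> i \<in> I \<and> i + 1 \<in> I"
  shows "reg J (Suc d) (\<lambda>i x. f (i + 1) x - f i x)"
proof -
  obtain G where G: "bpoly Z G"
    "\<And>i. i \<in> I \<Longrightarrow> negl (\<lambda>x. f i x - h x ^ d *\<^sub>R G (par x) (h x) ((u x - of_int i) * h x))"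
    using assms by (auto simp: reg_def)
  obtain D where D: "bpoly Z D" "\<And>p h w. G p h (w - h) = G p h w + h *\<^sub>R D p h w"
    using bpoly_shift[OF G(1)] by blast
  show ?thesis
    unfolding reg_def
  proof (intro exI[of _ D] conjI ballI D)
    fix i assume "i \<in> J"
    then have i: "i \<in> I" "i + 1 \<in> I" using assms(2) by auto
    have eq: "(u x - of_int (i + 1)) * h x = (u x - of_int i) * h x - h x" for x
      by (simp add: algebra_simps)
    have *: "negl (\<lambda>x. - 1 *\<^sub>R (f i x - h x ^ d *\<^sub>R G (par x) (h x) ((u x - of_int i) * h x)))"
      by (rule negl_le[OF G(2)[OF i(1)], of _ 1]) (simp add: norm_minus_commute)
    show "negl (\<lambda>x. f (i + 1) x - f i x
        - h x ^ Suc d *\<^sub>R D (par x) (h x) ((u x - of_int i) * h x))"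
      by (rule negl_cong[OF negl_add[OF G(2)[OF i(2)] *]])
        (unfold eq D(2), simp add: algebra_simps)
  qed
qed

lemma reg_tendsto_zero:
  assumes "reg I (Suc d) f" "i \<in> I"
  shows "((\<lambda>x. f i x) \<longlongrightarrow> 0) F"
proof -
  have "reg I 1 f" using assms(1) by (rule reg_mono) simp
  then obtain C where C: "\<forall>\<^sub>F x in F. norm (f i x) \<le> C * h x"
    using reg_bound[OF _ assms(2), of 1 f] N_pos by auto
  have "(h \<longlongrightarrow> 0) F" using h_lim by (simp add: filterlim_at)
  then have "((\<lambda>x. C * h x) \<longlongrightarrow> 0) F" by (rule tendsto_mult_right_zero)
  with C show ?thesis by (rule Lim_null_comparison)
qed

text \<open>Smallness is assumed apart from the order \<open>d\<close>: at d = 0 the argument may be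
  O(h) only thanks to w = (u - i) h, with no factor h split off. Truncation at degree N leaves an
  error O(h^(N+1)).\<close>

lemma reg_power_series:
  assumes ps: "power_series_on \<Phi> a \<rho>" and f: "reg I d f"
    and small: "\<And>i. i \<in> I \<Longrightarrow> \<exists>C. \<forall>\<^sub>F x in F. f i x \<le> C * h x"
    and pos: "\<And>i. i \<in> I \<Longrightarrow> \<forall>\<^sub>F x in F. 0 \<le> f i x"
  shows "reg I d (\<lambda>i x. \<Phi> (f i x) - a 0)"
proof -
  obtain C where C: "0 \<le> C"
    "\<And>x. 0 \<le> x \<Longrightarrow> x \<le> \<rho> / 2 \<Longrightarrow> \<bar>\<Phi> x - (\<Sum>k\<le>N. a k * x ^ k)\<bar> \<le> C * x ^ Suc N"
    using power_series_on_remainder[OF ps] by blast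
  \<comment> \<open>Without its constant term the truncated series has a factor \<open>f\<close>,
    which carries the order \<open>d\<close>; the cofactor is taken at order 0.\<close>
  have "reg I (d + 0) (\<lambda>i x. f i x * (\<Sum>k<N. a (Suc k) *\<^sub>R f i x ^ k))"
    by (intro reg_mult f reg_sum reg_scaleR_const reg_power reg_mono[OF f]) auto
  moreover have "f i x * (\<Sum>k<N. a (Suc k) *\<^sub>R f i x ^ k) = (\<Sum>k\<le>N. a k * f i x ^ k) - a 0" for i x
    unfolding lessThan_Suc_atMost[symmetric] sum.lessThan_Suc_shift
    by (simp add: sum_distrib_left mult_ac)
  ultimately have P: "reg I d (\<lambda>i x. (\<Sum>k\<le>N. a k * f i x ^ k) - a 0)" by simp
  have R: "negl (\<lambda>x. \<Phi> (f i x) - (\<Sum>k\<le>N. a k * f i x ^ k))" if i: "i \<in> I" for i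
  proof -
    obtain B where B: "\<forall>\<^sub>F x in F. f i x \<le> B * h x" using small[OF i] by blast
    define B' where "B' = max B 1"
    have "\<forall>\<^sub>F x in F. 0 < h x \<and> h x < \<rho> / 2 / B'"
      using ps by (intro h_small) (auto simp: power_series_on_def B'_def)
    then have "\<forall>\<^sub>F x in F. norm (\<Phi> (f i x) - (\<Sum>k\<le>N. a k * f i x ^ k)) \<le> (C * B' ^ Suc N) * h x ^ Suc N"
      using B pos[OF i]
    proof eventually_elim
      case (elim x)
      have le: "f i x \<le> B' * h x"
        using elim by (elim order_trans) (auto simp: B'_def intro!: mult_right_mono)
      also have "\<dots> \<le> \<rho> / 2" using elim by (simp add: B'_def field_simps)
      finally have "\<bar>\<Phi> (f i x) - (\<Sum>k\<le>N. a k * f i x ^ k)\<bar> \<le> C * f i x ^ Suc N"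
        using C(2) elim by blast
      also have "\<dots> \<le> C * (B' * h x) ^ Suc N"
        using le elim C by (intro mult_left_mono power_mono) auto
      finally show ?case by (simp add: power_mult_distrib mult_ac)
    qed
    then show ?thesis by (rule negl_h_power[rotated]) simp
  qed
  obtain G where G: "bpoly Z G"
    "\<And>i. i \<in> I \<Longrightarrow> negl (\<lambda>x. ((\<Sum>k\<le>N. a k * f i x ^ k) - a 0)
       - h x ^ d *\<^sub>R G (par x) (h x) ((u x - of_int i) * h x))"
    using P by (auto simp: reg_def)
  show ?thesis
    unfolding reg_def
    by (intro exI[of _ G] conjI ballI G) (rule negl_cong[OF negl_add[OF R G(2)]], auto)
qed

lemma reg_power_series_0:
  assumes "power_series_on \<Phi> a \<rho>" "reg I 0 f"
    "\<And>i. i \<in> I \<Longrightarrow> \<exists>C. \<forall>\<^sub>F x in F. f i x \<le> C * h x"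
    "\<And>i. i \<in> I \<Longrightarrow> \<forall>\<^sub>F x in F. 0 \<le> f i x"
  shows "reg I 0 (\<lambda>i x. \<Phi> (f i x))"
  using reg_add[OF reg_power_series[OF assms] reg_constant, of "a 0"] by simp

lemma reg_Suc_small:
  assumes "reg I (Suc d) f" "i \<in> I"
  shows "\<exists>C. \<forall>\<^sub>F x in F. f i x \<le> C * (h x :: real)"
proof -
  have "reg I 1 f" using assms(1) by (rule reg_mono) simp
  then obtain C where "\<forall>\<^sub>F x in F. norm (f i x) \<le> C * h x"
    using reg_bound[OF _ assms(2), of 1 f] N_pos by auto
  then have "\<forall>\<^sub>F x in F. f i x \<le> C * h x" by eventually_elim auto
  then show ?thesis ..
qed

text \<open>The factor \<open>(u - i) / k\<close> enters only in products with \<open>b - a\<close> or with \<open>1 - a \<bullet> b\<close>, where the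
  power of \<open>h\<close> that it costs is available.\<close>

lemma reg_slerp:
  fixes a b :: "int \<Rightarrow> 'x \<Rightarrow> 'v::real_inner"
  assumes unit: "\<And>i. i \<in> I \<Longrightarrow> \<forall>\<^sub>F x in F. norm (a i x) = 1"
      "\<And>i. i \<in> I \<Longrightarrow> \<forall>\<^sub>F x in F. norm (b i x) = 1"
    and a: "reg I 0 a" and ba: "reg I (Suc e) (\<lambda>i x. b i x - a i x)"
  shows "reg I e (\<lambda>i x. sph_slerp (a i x) (b i x) ((u x - of_int i) / k) - a i x)"
proof -
  \<comment> \<open>These are the ingredients of \<open>log_factor\<close>. For unit vectors
    \<open>\<kappa>\<close> is \<open>1 - a \<bullet> b\<close>, written as half a squared chord to
    make its order visible; likewise the rejection of \<open>b\<close> from \<open>a\<close> is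
    \<open>(b - a) + \<kappa> a\<close>. Thus \<open>v\<close> is eventually the logarithm and
    \<open>w\<close> the scaled velocity.\<close>
  define \<kappa> where "\<kappa> i x = (b i x - a i x) \<bullet> (b i x - a i x) / 2" for i x
  define q where "q i x = \<kappa> i x / 2 * (1 / (1 - \<kappa> i x / 2))" for i x
  define \<phi> where "\<phi> i x = (1 + q i x) * sqrt_arctan (q i x)" for i x
  define v where "v i x = \<phi> i x *\<^sub>R ((b i x - a i x) + \<kappa> i x *\<^sub>R a i x)" for i x
  define w where "w i x = (1 / k) *\<^sub>R ((u x - of_int i) *\<^sub>R v i x)" for i x
  have \<kappa>: "reg I (Suc e) \<kappa>"
    using reg_mono[OF reg_scaleR_const[OF reg_inner[OF ba ba], of "1 / 2"], of "Suc e"]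
    by (simp add: \<kappa>_def[abs_def])
  have \<kappa>0: "((\<lambda>x. \<kappa> i x) \<longlongrightarrow> 0) F" if "i \<in> I" for i
    using reg_tendsto_zero[OF \<kappa> that] .
  have \<kappa>_pos: "0 \<le> \<kappa> i x" for i x by (simp add: \<kappa>_def)
  have m: "reg I (Suc e) (\<lambda>i x. \<kappa> i x / 2)"
    using reg_scaleR_const[OF \<kappa>, of "1 / 2"] by simp
  have "reg I 0 (\<lambda>i x. 1 / (1 - \<kappa> i x / 2))"
    by (rule reg_power_series_0[OF power_series_on_geometric reg_mono[OF m]])
      (simp, erule reg_Suc_small[OF m], simp add: \<kappa>_pos)
  from reg_mult[OF m this] have q: "reg I (Suc e) q" by (simp add: q_def[abs_def])
  have q_pos: "\<forall>\<^sub>F x in F. 0 \<le> q i x" if "i \<in> I" for i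
    using order_tendstoD(2)[OF \<kappa>0[OF that], of 1]
    by (auto simp: q_def \<kappa>_pos elim!: eventually_mono)
  have at: "reg I 0 (\<lambda>i x. sqrt_arctan (q i x))"
    by (rule reg_power_series_0[OF power_series_on_sqrt_arctan reg_mono[OF q]])
      (auto intro!: reg_Suc_small[OF q] simp: q_pos)
  have "reg I 0 (\<lambda>i x. 1 + q i x)"
    by (intro reg_add reg_constant reg_mono[OF q]) simp
  from reg_mult[OF this at] have \<phi>: "reg I 0 \<phi>" by (simp add: \<phi>_def[abs_def])
  have "reg I (Suc e) (\<lambda>i x. (b i x - a i x) + \<kappa> i x *\<^sub>R a i x)"
    using reg_add[OF ba reg_scaleR[OF \<kappa> a, simplified]] .
  from reg_scaleR[OF \<phi> this] have v: "reg I (Suc e) v" by (simp add: v_def[abs_def])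
  have w: "reg I e w"
    unfolding w_def by (intro reg_scaleR_const reg_mult_u v)
  have t: "reg I e (\<lambda>i x. (norm (w i x))\<^sup>2)"
    using reg_mono[OF reg_inner[OF w w], of e] by (simp add: power2_norm_eq_inner)
  \<comment> \<open>For e = 0 the order of \<open>w\<close> alone does not show that it is small;
    here \<open>v\<close> = O(h) is combined with the boundedness of u - i.\<close>
  have t_small: "\<exists>C. \<forall>\<^sub>F x in F. (norm (w i x))\<^sup>2 \<le> C * h x" if i: "i \<in> I" for i
  proof -
    have "reg I 1 v" using v by (rule reg_mono) simp
    then obtain C where C: "0 \<le> C" "\<forall>\<^sub>F x in F. norm (v i x) \<le> C * h x"
      using reg_bound[OF _ i, of 1 v] N_pos by auto
    define D where "D = \<bar>1 / k\<bar> * ((U + \<bar>of_int i\<bar>) * C)"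
    have "\<forall>\<^sub>F x in F. (norm (w i x))\<^sup>2 \<le> D\<^sup>2 * h x"
      using C(2) u_bound h_small[of 1, OF zero_less_one]
    proof eventually_elim
      case (elim x)
      have "norm (w i x) \<le> \<bar>1 / k\<bar> * ((U + \<bar>of_int i\<bar>) * (C * h x))"
        unfolding w_def norm_scaleR using elim by (intro mult_left_mono mult_mono) auto
      also have "\<dots> = D * h x" by (simp add: D_def)
      finally have "(norm (w i x))\<^sup>2 \<le> (D * h x)\<^sup>2" by (intro power_mono) auto
      also have "\<dots> = D\<^sup>2 * (h x * h x)" by (simp add: power2_eq_square)
      also have "\<dots> \<le> D\<^sup>2 * (h x * 1)" using elim by (intro mult_left_mono) auto
      finally show ?case by simp
    qed
    then show ?thesis ..
  qed
  have cos: "reg I e (\<lambda>i x. sqrt_cos ((norm (w i x))\<^sup>2) - 1)"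
    using reg_power_series[OF power_series_on_sqrt_cos t t_small] by simp
  have sinc: "reg I 0 (\<lambda>i x. sqrt_sinc ((norm (w i x))\<^sup>2))"
    by (rule reg_power_series_0[OF power_series_on_sqrt_sinc reg_mono[OF t] t_small]) auto
  have "reg I e (\<lambda>i x. (sqrt_cos ((norm (w i x))\<^sup>2) - 1) *\<^sub>R a i x
      + sqrt_sinc ((norm (w i x))\<^sup>2) *\<^sub>R w i x)"
    using reg_add[OF reg_scaleR[OF cos a, simplified] reg_scaleR[OF sinc w, simplified]] .
  then show ?thesis
  proof (rule reg_cong)
    fix i assume i: "i \<in> I"
    show "\<forall>\<^sub>F x in F. sph_slerp (a i x) (b i x) ((u x - of_int i) / k) - a i x =
        (sqrt_cos ((norm (w i x))\<^sup>2) - 1) *\<^sub>R a i x + sqrt_sinc ((norm (w i x))\<^sup>2) *\<^sub>R w i x"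
      using unit(1)[OF i] unit(2)[OF i] order_tendstoD(2)[OF \<kappa>0[OF i], of 1, simplified]
    proof eventually_elim
      case (elim x)
      have \<kappa>_eq: "\<kappa> i x = 1 - a i x \<bullet> b i x"
        using unit_inner_chord[OF elim(1,2)] by (simp add: \<kappa>_def power2_norm_eq_inner)
      have "log_factor (a i x \<bullet> b i x) = \<phi> i x"
        by (simp add: log_factor_def \<phi>_def q_def \<kappa>_eq Let_def)
      then have "((u x - of_int i) / k * log_factor (a i x \<bullet> b i x)) *\<^sub>R
          (b i x - (a i x \<bullet> b i x) *\<^sub>R a i x) = w i x"
        unfolding w_def v_def by (simp add: \<kappa>_eq scaleR_diff_left mult_ac)
      with elim \<kappa>_eq show ?case
        using sph_slerp_analytic[OF elim(1,2), of "(u x - of_int i) / k"]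
        by (simp add: scaleR_diff_left)
    qed
  qed
qed

end

section \<open>Expansion and interpolation property of the SIDER construction\<close>

locale sider_regime = stencil_regime +
  fixes z :: "int \<Rightarrow> 'a \<Rightarrow> 'v::real_inner" and n :: nat
  assumes n: "2 \<le> n"
    and reg_z: "reg {0..int n} 0 z"
    and norm_z: "\<And>i. i \<in> {0..int n} \<Longrightarrow> \<forall>\<^sub>F x in F. norm (z i x) = 1"
begin

lemma reg_translate:
  assumes "reg I d f" "\<And>i. i \<in> J \<Longrightarrow> i \<in> I \<and> i + 1 \<in> I"
  shows "reg J d (\<lambda>i x. f (i + 1) x)"
proof -
  have "reg J d f" by (rule reg_subset[OF assms(1)]) (use assms(2) in auto)
  moreover have "reg J d (\<lambda>i x. f (i + 1) x - f i x)"
    by (rule reg_mono[OF reg_difference[OF assms]]) auto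
  ultimately have "reg J d (\<lambda>i x. f i x + (f (i + 1) x - f i x))" by (rule reg_add)
  then show ?thesis by simp
qed

lemma reg_close:
  assumes "reg I (Suc d) (\<lambda>i x. b i x - a i x :: 'v)" "i \<in> I"
  shows "\<forall>\<^sub>F x in F. norm (b i x - a i x) < 1"
proof -
  have "((\<lambda>x. norm (b i x - a i x)) \<longlongrightarrow> 0) F"
    using reg_tendsto_zero[OF assms] by (rule tendsto_norm_zero)
  then show ?thesis by (rule order_tendstoD) simp
qed

abbreviation pts :: "'a \<Rightarrow> int \<Rightarrow> 'v" where
  "pts x \<equiv> \<lambda>j. z j x"

abbreviation J2 :: "int set" where
  "J2 \<equiv> {0..int n - 2}"

lemma z_shift:
  shows z0: "reg J2 0 z" and z1: "reg J2 0 (\<lambda>i. z (i + 1))" and z2: "reg J2 0 (\<lambda>i. z (i + 2))"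
proof -
  show "reg J2 0 z" using reg_z by (rule reg_subset) auto
  have *: "reg {0..int n - 1} 0 (\<lambda>i. z (i + 1))" by (rule reg_translate[OF reg_z]) auto
  then show "reg J2 0 (\<lambda>i. z (i + 1))" by (rule reg_subset) auto
  have "reg J2 0 (\<lambda>i. z (i + 1 + 1))" by (rule reg_translate[OF *]) auto
  then show "reg J2 0 (\<lambda>i. z (i + 2))" by (simp add: add.assoc)
qed

lemma z_difference:
  shows z10: "reg J2 1 (\<lambda>i x. z (i + 1) x - z i x)"
    and z21: "reg J2 1 (\<lambda>i x. z (i + 2) x - z (i + 1) x)"
    and z_second: "reg J2 2 (\<lambda>i x. z (i + 2) x - 2 *\<^sub>R z (i + 1) x + z i x)"
proof -
  have *: "reg {0..int n - 1} 1 (\<lambda>i x. z (i + 1) x - z i x)"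
    using reg_difference[OF reg_z, of "{0..int n - 1}"] by auto
  then show "reg J2 1 (\<lambda>i x. z (i + 1) x - z i x)" by (rule reg_subset) auto
  have "reg J2 1 (\<lambda>i x. z (i + 1 + 1) x - z (i + 1) x)" by (rule reg_translate[OF *]) auto
  then show "reg J2 1 (\<lambda>i x. z (i + 2) x - z (i + 1) x)" by (simp add: add.assoc)
  have "reg J2 (Suc 1) (\<lambda>i x. (z (i + 1 + 1) x - z (i + 1) x) - (z (i + 1) x - z i x))"
    by (rule reg_difference[OF *]) auto
  then show "reg J2 2 (\<lambda>i x. z (i + 2) x - 2 *\<^sub>R z (i + 1) x + z i x)"
    by (simp add: add.assoc scaleR_2 numeral_2_eq_2 algebra_simps)
qed

lemma norm_z_J2:
  assumes "i \<in> J2"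
  shows "\<forall>\<^sub>F x in F. norm (z i x) = 1 \<and> norm (z (i + 1) x) = 1 \<and> norm (z (i + 2) x) = 1"
  using assms by (intro eventually_conj norm_z) auto

text \<open>By the reflection formula both differences are, up to sign, a second difference of the
  data plus a squared first difference times the middle point. One of the two powers of h is spent
  on the inner arcs, the other on the arc between them.\<close>

lemma extrapolation:
  shows extrapolation_a: "reg J2 2 (\<lambda>i x. sph_slerp (z (i + 2) x) (z (i + 1) x) 2 - z i x)"
    and extrapolation_b: "reg J2 2 (\<lambda>i x. z (i + 2) x - sph_slerp (z i x) (z (i + 1) x) 2)"
proof -
  have 21: "reg J2 (Suc 0) (\<lambda>i x. z (i + 2) x - z (i + 1) x)"
    and 10: "reg J2 (Suc 0) (\<lambda>i x. z (i + 1) x - z i x)" using z21 z10 by simp_all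
  have k: "reg J2 2 (\<lambda>i x. ((z (i + 2) x - z (i + 1) x) \<bullet> (z (i + 2) x - z (i + 1) x)) *\<^sub>R z (i + 1) x)"
    "reg J2 2 (\<lambda>i x. ((z (i + 1) x - z i x) \<bullet> (z (i + 1) x - z i x)) *\<^sub>R z (i + 1) x)"
    using reg_scaleR[OF reg_inner[OF 21 21] z1] reg_scaleR[OF reg_inner[OF 10 10] z1]
    by (simp_all add: numeral_2_eq_2)
  show "reg J2 2 (\<lambda>i x. sph_slerp (z (i + 2) x) (z (i + 1) x) 2 - z i x)"
  proof (rule reg_cong[OF reg_minus[OF reg_add[OF z_second k(1)]]])
    fix i assume i: "i \<in> J2"
    show "\<forall>\<^sub>F x in F. sph_slerp (z (i + 2) x) (z (i + 1) x) 2 - z i x =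
        - (z (i + 2) x - 2 *\<^sub>R z (i + 1) x + z i x +
        ((z (i + 2) x - z (i + 1) x) \<bullet> (z (i + 2) x - z (i + 1) x)) *\<^sub>R z (i + 1) x)"
      using norm_z_J2[OF i] reg_close[OF 21 i]
    proof eventually_elim
      case (elim x)
      have c: "0 < z (i + 2) x \<bullet> z (i + 1) x"
        using unit_close_inner[of "z (i + 1) x" "z (i + 2) x"] elim by (simp add: inner_commute)
      have eq: "(z (i + 2) x - z (i + 1) x) \<bullet> (z (i + 2) x - z (i + 1) x) =
          2 - 2 * (z (i + 2) x \<bullet> z (i + 1) x)"
        using unit_inner_chord[of "z (i + 1) x" "z (i + 2) x"] elim
        by (simp add: inner_commute power2_norm_eq_inner)
      show ?case unfolding eq using elim c by (simp add: sph_slerp_2 algebra_simps)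
    qed
  qed
  show "reg J2 2 (\<lambda>i x. z (i + 2) x - sph_slerp (z i x) (z (i + 1) x) 2)"
  proof (rule reg_cong[OF reg_add[OF z_second k(2)]])
    fix i assume i: "i \<in> J2"
    show "\<forall>\<^sub>F x in F. z (i + 2) x - sph_slerp (z i x) (z (i + 1) x) 2 =
        z (i + 2) x - 2 *\<^sub>R z (i + 1) x + z i x +
        ((z (i + 1) x - z i x) \<bullet> (z (i + 1) x - z i x)) *\<^sub>R z (i + 1) x"
      using norm_z_J2[OF i] reg_close[OF 10 i]
    proof eventually_elim
      case (elim x)
      have c: "0 < z i x \<bullet> z (i + 1) x"
        using unit_close_inner[of "z i x" "z (i + 1) x"] elim by simp
      have eq: "(z (i + 1) x - z i x) \<bullet> (z (i + 1) x - z i x) = 2 - 2 * (z i x \<bullet> z (i + 1) x)"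
        using unit_inner_chord[of "z i x" "z (i + 1) x"] elim
        by (simp add: power2_norm_eq_inner)
      show ?case unfolding eq using elim c by (simp add: sph_slerp_2 algebra_simps)
    qed
  qed
qed

abbreviation "lft \<equiv> \<lambda>i x. sph_sider2_left (pts x) i (u x)"
abbreviation "rgt \<equiv> \<lambda>i x. sph_sider2_right (pts x) i (u x)"

lemma norm_left_right:
  assumes "i \<in> J2"
  shows norm_left: "\<forall>\<^sub>F x in F. norm (lft i x) = 1" and norm_right: "\<forall>\<^sub>F x in F. norm (rgt i x) = 1"
  using norm_z_J2[OF assms]
  by (auto elim!: eventually_mono simp: sph_sider2_left_def sph_sider2_right_def
      intro!: norm_sph_slerp)

lemma left_z: "reg J2 1 (\<lambda>i x. lft i x - z i x)"
  unfolding sph_sider2_left_def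
proof (rule reg_slerp[OF _ _ z0])
  fix i assume "i \<in> J2"
  from norm_z_J2[OF this] show "\<forall>\<^sub>F x in F. norm (z i x) = 1"
    and "\<forall>\<^sub>F x in F. norm (sph_slerp (z (i + 2) x) (z (i + 1) x) 2) = 1"
    by (auto elim!: eventually_mono simp: norm_sph_slerp)
qed (use extrapolation_a in \<open>simp add: numeral_2_eq_2\<close>)

lemma right_z: "reg J2 1 (\<lambda>i x. rgt i x - z (i + 2) x)"
proof -
  have db: "reg J2 1 (\<lambda>i x. z (i + 2) x - sph_slerp (z i x) (z (i + 1) x) 2)"
    by (rule reg_mono[OF extrapolation_b]) simp
  have "reg J2 0 (\<lambda>i x. sph_slerp (z i x) (z (i + 1) x) 2)"
    using reg_diff[OF z2 reg_mono[OF db]] by simp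
  then have "reg J2 1 (\<lambda>i x. rgt i x - sph_slerp (z i x) (z (i + 1) x) 2)"
    unfolding sph_sider2_right_def
  proof (rule reg_slerp[rotated 2])
    fix i assume "i \<in> J2"
    from norm_z_J2[OF this] show "\<forall>\<^sub>F x in F. norm (z (i + 2) x) = 1"
      and "\<forall>\<^sub>F x in F. norm (sph_slerp (z i x) (z (i + 1) x) 2) = 1"
      by (auto elim!: eventually_mono simp: norm_sph_slerp)
  qed (use extrapolation_b in \<open>simp add: numeral_2_eq_2\<close>)
  from reg_diff[OF this db] show ?thesis by simp
qed

text \<open>Telescoping through the three data points; the remaining power of h is the one that the
  outer slerp of SIDER2 consumes.\<close>

lemma right_left: "reg J2 1 (\<lambda>i x. rgt i x - lft i x)"
  using reg_diff[OF reg_add[OF reg_add[OF right_z z21] z10] left_z] by (simp add: algebra_simps)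

lemma left_reg: "reg J2 0 lft"
  using reg_add[OF reg_mono[OF left_z] z0] by simp

lemma norm_sider:
  assumes "2 \<le> k" "i \<in> {0..int n - int k}"
  shows "\<forall>\<^sub>F x in F. norm (sph_sider (pts x) k i (u x)) = 1"
proof -
  have "\<forall>\<^sub>F x in F. \<forall>j\<in>{i..i + int k}. norm (z j x) = 1"
    using assms by (intro eventually_ball_finite ballI norm_z) auto
  then show ?thesis
    by eventually_elim (auto intro!: norm_sph_sider assms)
qed

text \<open>Each level starts from order 0 again: both interpolants are values of one expansion at
  neighbouring shifts, so their difference has order 1, just what the factor (theta - i) / k
  costs.\<close>

lemma reg_sider:
  assumes "2 \<le> k"
  shows "reg {0..int n - int k} 0 (\<lambda>i x. sph_sider (pts x) k i (u x))"
  using assms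
proof (induction k rule: nat_induct_at_least)
  case base
  have "reg J2 0 (\<lambda>i x. sph_slerp (lft i x) (rgt i x) ((u x - of_int i) / 2) - lft i x)"
    using right_left norm_left norm_right left_reg by (intro reg_slerp) auto
  from reg_add[OF this left_reg] show ?case by (simp add: sph_sider_2)
next
  case (Suc k)
  have sub: "reg {0..int n - int (Suc k)} 0 (\<lambda>i x. sph_sider (pts x) k i (u x))"
    by (rule reg_subset[OF Suc.IH]) auto
  have d: "reg {0..int n - int (Suc k)} (Suc 0)
      (\<lambda>i x. sph_sider (pts x) k (i + 1) (u x) - sph_sider (pts x) k i (u x))"
    by (rule reg_difference[OF Suc.IH]) auto
  have "reg {0..int n - int (Suc k)} 0
      (\<lambda>i x. sph_slerp (sph_sider (pts x) k i (u x)) (sph_sider (pts x) k (i + 1) (u x))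
        ((u x - of_int i) / of_nat (Suc k)) - sph_sider (pts x) k i (u x))"
    using Suc.hyps by (intro reg_slerp norm_sider sub d) auto
  from reg_add[OF this sub] show ?case using Suc.hyps by (simp add: sph_sider_Suc)
qed

text \<open>At the outer nodes the slerp parameter is 0 or 1; at an inner node the two interpolants
  of the previous level agree and slerp fixes their common value. It holds eventually, once
  consecutive points are close enough not to be antipodal.\<close>

lemma sider_interpolates:
  assumes "2 \<le> k" "i \<in> {0..int n - int k}"
  shows "\<forall>\<^sub>F x in F. \<forall>j\<in>{i..i + int k}. u x = of_int j \<longrightarrow> sph_sider (pts x) k i (u x) = z j x"
  using assms
proof (induction k arbitrary: i rule: nat_induct_at_least)
  case base
  then have i: "i \<in> J2" by simp
  have rl: "reg J2 (Suc 0) (\<lambda>i x. rgt i x - lft i x)" using right_left by simp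
  have db: "reg J2 (Suc 1) (\<lambda>i x. z (i + 2) x - sph_slerp (z i x) (z (i + 1) x) 2)"
    using extrapolation_b by (simp add: numeral_2_eq_2)
  \<comment> \<open>This brings the left arc within distance 1 of the middle node and so supplies
    the sign condition of \<open>sph_sider2_middle_node\<close>.\<close>
  have ql: "reg J2 (Suc 0) (\<lambda>i x. z (i + 1) x - lft i x)"
    using reg_diff[OF z10 left_z] by simp
  have z10': "reg J2 (Suc 0) (\<lambda>i x. z (i + 1) x - z i x)" using z10 by simp
  have z21': "reg J2 (Suc 0) (\<lambda>i x. z (i + 2) x - z (i + 1) x)" using z21 by simp
  show ?case
    using norm_z_J2[OF i] norm_left[OF i] norm_right[OF i] reg_close[OF rl i] reg_close[OF db i]
      reg_close[OF ql i] reg_close[OF z10' i] reg_close[OF z21' i]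
  proof eventually_elim
    case (elim x)
    have lr: "0 < lft i x \<bullet> rgt i x" using elim unit_close_inner by blast
    have lq: "0 < z (i + 1) x \<bullet> lft i x"
      using elim unit_close_inner[of "lft i x" "z (i + 1) x"] by (simp add: inner_commute)
    have q: "0 < z i x \<bullet> z (i + 1) x" "0 < z (i + 2) x \<bullet> z (i + 1) x"
      using elim unit_close_inner[of "z i x" "z (i + 1) x"]
        unit_close_inner[of "z (i + 1) x" "z (i + 2) x"] by (simp_all add: inner_commute)
    have bq: "0 < sph_slerp (z i x) (z (i + 1) x) 2 \<bullet> z (i + 2) x"
      using elim unit_close_inner[OF norm_sph_slerp] by blast
    show ?case
    proof (intro ballI impI)
      fix j assume j: "j \<in> {i..i + int 2}" "u x = of_int j"
      consider "j = i" | "j = i + 1" | "j = i + 2" using j(1) by force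
      then show "sph_sider (pts x) 2 i (u x) = z j x"
      proof cases
        case 1
        then show ?thesis using j sph_sider_left_node[of 2 "pts x" i] by simp
      next
        case 2
        then have u: "u x = of_int i + 1" using j by simp
        have "sph_slerp (lft i x) (rgt i x) (1 / 2) = z (i + 1) x"
          using sph_sider2_middle_node[of "z i x" "z (i + 1) x" "z (i + 2) x"] elim lr lq q
          by (simp add: sph_sider2_left_def sph_sider2_right_def u)
        then show ?thesis by (simp add: sph_sider_2 u 2)
      next
        case 3
        then have u: "u x = of_int i + 2" using j by simp
        have "sph_slerp (lft i x) (rgt i x) 1 = rgt i x"
          using elim lr by (intro sph_slerp_1) auto
        moreover have "rgt i x = z (i + 2) x"
          unfolding sph_sider2_right_def using elim bq
          by (simp add: u sph_slerp_1 norm_sph_slerp)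
        ultimately show ?thesis by (simp add: sph_sider_2 u 3)
      qed
    qed
  qed
next
  case (Suc k)
  let ?P = "\<lambda>i x. sph_sider (pts x) k i (u x)"
  have d: "reg {0..int n - int (Suc k)} (Suc 0) (\<lambda>i x. ?P (i + 1) x - ?P i x)"
    by (rule reg_difference[OF reg_sider[OF Suc.hyps]]) auto
  have i: "i \<in> {0..int n - int k}" "i + 1 \<in> {0..int n - int k}" using Suc.prems by auto
  show ?case
    using Suc.IH[OF i(1)] Suc.IH[OF i(2)] reg_close[OF d Suc.prems]
      norm_sider[OF Suc.hyps i(1)] norm_sider[OF Suc.hyps i(2)]
  proof eventually_elim
    case (elim x)
    have c: "0 < ?P i x \<bullet> ?P (i + 1) x" using elim unit_close_inner by blast
    show ?case
    proof (intro ballI impI)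
      fix j assume j: "j \<in> {i..i + int (Suc k)}" "u x = of_int j"
      consider "j = i" | "j \<in> {i..i + int k}" "j \<in> {i + 1..i + 1 + int k}" | "j = i + int (Suc k)"
        using j(1) by force
      then show "sph_sider (pts x) (Suc k) i (u x) = z j x"
      proof cases
        case 1
        then show ?thesis using j sph_sider_left_node[of "Suc k" "pts x" i] Suc.hyps by simp
      next
        case 2
        then have "?P i x = z j x" "?P (i + 1) x = z j x" using elim j(2) by auto
        moreover have "norm (z j x) = 1" using elim calculation by simp
        ultimately show ?thesis unfolding sph_sider_Suc[OF Suc.hyps] by simp
      next
        case 3
        then have "j \<in> {i + 1..i + 1 + int k}" by simp
        then have "?P (i + 1) x = z j x" using elim(2) j(2) by blast
        moreover have "(u x - of_int i) / of_nat (Suc k) = 1" using j(2) 3 by simp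
        ultimately show ?thesis
          unfolding sph_sider_Suc[OF Suc.hyps] using c elim by (simp add: sph_slerp_1)
      qed
    qed
  qed
qed

end

text \<open>The curves \<open>\<iota> p v\<close> enter the filter with the parameter and the stencil position held fixed;
  they make the coefficients of an expansion along the filter unique.\<close>

locale model_regime = sider_regime +
  fixes base :: 'c and \<iota> :: "'b \<Rightarrow> real \<Rightarrow> real \<Rightarrow> 'a"
  assumes N_eq: "N = Suc n"
    and u_range: "\<forall>\<^sub>F x in F. 0 \<le> u x \<and> u x \<le> real n"
    and \<iota>_lim: "\<And>p v. p \<in> Z \<Longrightarrow> 0 \<le> v \<Longrightarrow> v \<le> real n \<Longrightarrow> filterlim (\<iota> p v) F (at_right 0)"
    and \<iota>_simps: "\<And>p v t. par (\<iota> p v t) = p" "\<And>p v t. u (\<iota> p v t) = v" "\<And>p v t. h (\<iota> p v t) = t"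
    and \<iota>_node: "\<And>p l t. l \<le> n \<Longrightarrow> z (int l) (\<iota> p (real l) t) = base"
begin

text \<open>Along a model curve at a node position the interpolant is eventually exactly
  \<open>base\<close>, so the polynomial \<open>G\<close> equals its own error there and is
  o(h^(n+1)) on each node ray. This is the input of \<open>bpoly_nodal_form\<close>.\<close>

lemma sider_expansion:
  obtains A where "bounded (A ` Z)"
    "negl (\<lambda>x. sph_sider (pts x) n 0 (u x) - base -
       (h x ^ Suc n * (\<Prod>l\<le>n. u x - real l)) *\<^sub>R A (par x))"
proof -
  let ?P = "\<lambda>x. sph_sider (pts x) n 0 (u x)"
  have "reg {0} 0 (\<lambda>i x. sph_sider (pts x) n i (u x) - base)"
    using reg_diff[OF reg_subset[OF reg_sider[OF n]] reg_constant] by simp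
  then obtain G where G: "bpoly Z G" "negl (\<lambda>x. ?P x - base - G (par x) (h x) (u x * h x))"
    by (auto simp: reg_def)
  have "((\<lambda>t. (1 / t ^ Suc n) *\<^sub>R G p t (real l * t)) \<longlongrightarrow> 0) (at_right 0)"
    if p: "p \<in> Z" and l: "l \<le> n" for p l
  proof (rule tendstoI)
    fix \<epsilon> :: real assume \<epsilon>: "0 < \<epsilon>"
    have lim: "filterlim (\<iota> p (real l)) F (at_right 0)" using p l by (intro \<iota>_lim) auto
    have "0 < \<epsilon> / 2" using \<epsilon> by simp
    then have e: "\<forall>\<^sub>F x in F. norm (?P x - base - G (par x) (h x) (u x * h x)) \<le> \<epsilon> / 2 * h x ^ N"
      using G(2) unfolding negl_def by blast
    have "0 \<in> {0..int n - int n}" by simp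
    from eventually_compose_filterlim[OF eventually_conj[OF e sider_interpolates[OF n this]] lim]
      eventually_at_right_less[of "0::real"]
    show "\<forall>\<^sub>F t in at_right 0. dist ((1 / t ^ Suc n) *\<^sub>R G p t (real l * t)) 0 < \<epsilon>"
    proof eventually_elim
      case (elim t)
      have "?P (\<iota> p (real l) t) = base"
        using elim(1)[THEN conjunct2, rule_format, of "int l"] l \<iota>_node[OF l, of p t]
        by (simp add: \<iota>_simps)
      then have "norm (G p t (real l * t)) \<le> \<epsilon> / 2 * t ^ Suc n"
        using elim by (simp add: \<iota>_simps N_eq)
      also have "\<dots> < \<epsilon> * t ^ Suc n" using \<epsilon> elim by simp
      finally show ?case using elim by (simp add: field_simps)
    qed
  qed
  from bpoly_nodal_form[OF G(1) this] obtain A C where A: "bounded (A ` Z)"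
    "\<And>p v t. p \<in> Z \<Longrightarrow> 0 \<le> v \<Longrightarrow> v \<le> real n \<Longrightarrow> 0 < t \<Longrightarrow> t \<le> 1 \<Longrightarrow>
     norm (G p t (v * t) - (t ^ Suc n * (\<Prod>l\<le>n. v - real l)) *\<^sub>R A p) \<le> C * t ^ Suc (Suc n)"
    by blast
  have "negl (\<lambda>x. G (par x) (h x) (u x * h x) -
      (h x ^ Suc n * (\<Prod>l\<le>n. u x - real l)) *\<^sub>R A (par x))"
  proof (rule negl_h_power[of "Suc (Suc n)" _ C])
    show "\<forall>\<^sub>F x in F. norm (G (par x) (h x) (u x * h x) -
        (h x ^ Suc n * (\<Prod>l\<le>n. u x - real l)) *\<^sub>R A (par x)) \<le> C * h x ^ Suc (Suc n)"
      using par_in u_range h_small[of 1, OF zero_less_one]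
      by eventually_elim (intro A(2), auto)
  qed (simp add: N_eq)
  from negl_cong[OF negl_add[OF G(2) this]] A(1) show ?thesis
    by (intro that[of A]) auto
qed

text \<open>Away from the nodes the product can be divided out. The limit recovers the coefficient
  from the model curve, so that no two expansions can have different ones.\<close>

lemma sider_coefficient_limit:
  assumes A: "negl (\<lambda>x. sph_sider (pts x) n 0 (u x) - base -
       (h x ^ Suc n * (\<Prod>l\<le>n. u x - real l)) *\<^sub>R A (par x))"
    and p: "p \<in> Z" and v: "0 \<le> v" "v \<le> real n" "(\<Prod>l\<le>n. v - real l) \<noteq> 0"
  shows "((\<lambda>t. (1 / (t ^ Suc n * (\<Prod>l\<le>n. v - real l))) *\<^sub>R
     (sph_sider (pts (\<iota> p v t)) n 0 v - base)) \<longlongrightarrow> A p) (at_right 0)"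
proof (rule tendstoI)
  fix \<epsilon> :: real assume \<epsilon>: "0 < \<epsilon>"
  define \<pi> where "\<pi> = (\<Prod>l\<le>n. v - real l)"
  have "0 < \<epsilon> / 2 * \<bar>\<pi>\<bar>" using \<epsilon> v by (simp add: \<pi>_def)
  then have "\<forall>\<^sub>F x in F. norm (sph_sider (pts x) n 0 (u x) - base -
       (h x ^ Suc n * (\<Prod>l\<le>n. u x - real l)) *\<^sub>R A (par x)) \<le> \<epsilon> / 2 * \<bar>\<pi>\<bar> * h x ^ N"
    using A unfolding negl_def by blast
  from eventually_compose_filterlim[OF this \<iota>_lim[OF p v(1,2)]] eventually_at_right_less[of "0::real"]
  show "\<forall>\<^sub>F t in at_right 0. dist ((1 / (t ^ Suc n * (\<Prod>l\<le>n. v - real l))) *\<^sub>R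
     (sph_sider (pts (\<iota> p v t)) n 0 v - base)) (A p) < \<epsilon>"
  proof eventually_elim
    case (elim t)
    let ?w = "t ^ Suc n * \<pi>"
    have w: "?w \<noteq> 0" using elim v by (simp add: \<pi>_def)
    have "dist ((1 / ?w) *\<^sub>R (sph_sider (pts (\<iota> p v t)) n 0 v - base)) (A p) =
        norm ((1 / ?w) *\<^sub>R (sph_sider (pts (\<iota> p v t)) n 0 v - base - ?w *\<^sub>R A p))"
      unfolding dist_norm scaleR_diff_right[of _ _ "?w *\<^sub>R A p"] using w by simp
    also have "\<dots> = norm (sph_sider (pts (\<iota> p v t)) n 0 v - base - ?w *\<^sub>R A p) / (t ^ Suc n * \<bar>\<pi>\<bar>)"
      using elim by (simp add: abs_mult)
    also have "\<dots> \<le> (\<epsilon> / 2 * \<bar>\<pi>\<bar> * t ^ Suc n) / (t ^ Suc n * \<bar>\<pi>\<bar>)"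
      using elim by (intro divide_right_mono) (auto simp: \<iota>_simps N_eq \<pi>_def)
    also have "\<dots> = \<epsilon> / 2" using elim v by (simp add: \<pi>_def)
    also have "\<dots> < \<epsilon>" using \<epsilon> by simp
    finally show ?case by (simp add: \<pi>_def)
  qed
qed

end

context stencil_regime
begin

lemma reg_sph_exp:
  fixes X :: "int \<Rightarrow> 'x \<Rightarrow> 'v::real_inner" and J :: "nat \<Rightarrow> 'p \<Rightarrow> 'v"
  assumes J: "\<And>k. k < N \<Longrightarrow> bounded (J (Suc k) ` Z)"
    and X: "\<And>i. i \<in> I \<Longrightarrow> negl (\<lambda>x. X i x -
      (\<Sum>k<N. (((of_int i - u x) * h x) ^ Suc k / fact (Suc k)) *\<^sub>R J (Suc k) (par x)))"
  shows "reg I 0 (\<lambda>i x. sph_exp y (X i x))"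
proof -
  \<comment> \<open>A node lies at parameter distance (i - u) h = - w from the base, whence the
    sign. The Taylor polynomial has no constant term; splitting off w shows the normal coordinates
    to be O(h), as the power series require.\<close>
  define D where "D p h w = (\<Sum>k<N. w ^ k *\<^sub>R ((- 1) ^ Suc k / fact (Suc k)) *\<^sub>R J (Suc k) p)"
    for p and h w :: real
  have D: "bpoly Z D"
    unfolding D_def
    by (intro bpoly_sum bpoly_mult_w_power bpoly_scaleR_const bpoly_const J) auto
  have wD: "w *\<^sub>R D p h w = (\<Sum>k<N. ((- w) ^ Suc k / fact (Suc k)) *\<^sub>R J (Suc k) p)" for p h w
    by (simp add: D_def scaleR_sum_right power_minus[of w] mult_ac)
  have eq: "(of_int i - u x) * h x = - ((u x - of_int i) * h x)" for i x by (simp add: algebra_simps)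
  have X': "negl (\<lambda>x. X i x - ((u x - of_int i) * h x) *\<^sub>R D (par x) (h x) ((u x - of_int i) * h x))"
    if "i \<in> I" for i
    using X[OF that] unfolding wD eq .
  have rX: "reg I 0 X"
    unfolding reg_def
    by (intro exI[of _ "\<lambda>p h w. w *\<^sub>R D p h w"] conjI bpoly_mult_w D) (auto intro: X')
  have t: "reg I 0 (\<lambda>i x. (norm (X i x))\<^sup>2)"
    using reg_inner[OF rX rX] by (simp add: power2_norm_eq_inner)
  have t_small: "\<exists>C. \<forall>\<^sub>F x in F. (norm (X i x))\<^sup>2 \<le> C * h x" if i: "i \<in> I" for i
  proof -
    obtain C where C: "\<forall>\<^sub>F x in F. norm (D (par x) (h x) ((u x - of_int i) * h x)) \<le> C"
      using bpoly_eventually_bounded[OF D] by blast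
    define K where "K = 1 + (U + \<bar>of_int i\<bar>) * C"
    have "\<forall>\<^sub>F x in F. norm (X i x - ((u x - of_int i) * h x) *\<^sub>R D (par x) (h x) ((u x - of_int i) * h x))
        \<le> 1 * h x ^ N"
      using X'[OF i] unfolding negl_def by (rule allE[of _ 1]) simp
    then have "\<forall>\<^sub>F x in F. (norm (X i x))\<^sup>2 \<le> K\<^sup>2 * h x"
      using C u_bound h_small[of 1, OF zero_less_one]
    proof eventually_elim
      case (elim x)
      let ?g = "((u x - of_int i) * h x) *\<^sub>R D (par x) (h x) ((u x - of_int i) * h x)"
      have "norm ?g \<le> (U + \<bar>of_int i\<bar>) * h x * C"
        unfolding norm_scaleR abs_mult using elim by (intro mult_mono) auto
      moreover have "norm (X i x) \<le> norm (X i x - ?g) + norm ?g"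
        by (metis diff_add_cancel norm_triangle_ineq)
      moreover have "h x ^ N \<le> h x ^ 1" using elim N_pos by (intro power_decreasing) auto
      ultimately have "norm (X i x) \<le> h x + (U + \<bar>of_int i\<bar>) * h x * C" using elim(1) by simp
      also have "\<dots> = K * h x" by (simp add: K_def algebra_simps)
      finally have "(norm (X i x))\<^sup>2 \<le> (K * h x)\<^sup>2" by (intro power_mono) auto
      also have "\<dots> = K\<^sup>2 * (h x * h x)" by (simp add: power2_eq_square)
      also have "\<dots> \<le> K\<^sup>2 * (h x * 1)" using elim by (intro mult_left_mono) auto
      finally show ?case by simp
    qed
    then show ?thesis ..
  qed
  have "reg I 0 (\<lambda>i x. sqrt_cos ((norm (X i x))\<^sup>2))"
    by (rule reg_power_series_0[OF power_series_on_sqrt_cos t t_small]) auto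
  from reg_scaleR[OF this reg_constant]
  have 1: "reg I 0 (\<lambda>i x. sqrt_cos ((norm (X i x))\<^sup>2) *\<^sub>R y)" by simp
  have "reg I 0 (\<lambda>i x. sqrt_sinc ((norm (X i x))\<^sup>2))"
    by (rule reg_power_series_0[OF power_series_on_sqrt_sinc t t_small]) auto
  from reg_scaleR[OF this rX]
  have 2: "reg I 0 (\<lambda>i x. sqrt_sinc ((norm (X i x))\<^sup>2) *\<^sub>R X i x)" by simp
  show ?thesis unfolding sph_exp_sqrt using reg_add[OF 1 2] .
qed

end

section \<open>Jets in normal coordinates\<close>

text \<open>The remainder vanishes at \<open>s\<close> and its derivative is the remainder for the
  derivative, so the mean value inequality adds one power per step. \<open>\<epsilon>\<close> bounds
  the oscillation of the top derivative; the factor 1 / N! is given away.\<close>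

lemma vector_taylor_bound:
  fixes f :: "nat \<Rightarrow> real \<Rightarrow> 'v::real_normed_vector"
  assumes S: "convex S" "s \<in> S"
    and "\<And>k t. k < N \<Longrightarrow> t \<in> S \<Longrightarrow> (f k has_vector_derivative f (Suc k) t) (at t within S)"
    and "\<And>t. t \<in> S \<Longrightarrow> norm (f N t - f N s) \<le> \<epsilon>" and "0 \<le> \<epsilon>" and "t \<in> S"
  shows "norm (f 0 t - (\<Sum>k\<le>N. ((t - s) ^ k / fact k) *\<^sub>R f k s)) \<le> \<epsilon> * \<bar>t - s\<bar> ^ N"
  using assms(3-)
proof (induction N arbitrary: f t)
  case 0
  then show ?case by simp
next
  case (Suc N)
  define g where "g t = f 0 t - (\<Sum>k\<le>Suc N. ((t - s) ^ k / fact k) *\<^sub>R f k s)" for t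
  define g' where "g' t = f (Suc 0) t - (\<Sum>k\<le>N. ((t - s) ^ k / fact k) *\<^sub>R f (Suc k) s)" for t
  have bound: "norm (g' t) \<le> \<epsilon> * \<bar>t - s\<bar> ^ N" if "t \<in> S" for t
    unfolding g'_def by (rule Suc.IH[of "\<lambda>k. f (Suc k)"]) (use Suc.prems that in auto)
  have seg: "closed_segment s t \<subseteq> S"
    using S Suc.prems by (simp add: closed_segment_subset)
  have der: "(g has_vector_derivative g' x) (at x within closed_segment s t)"
    if x: "x \<in> closed_segment s t" for x
  proof -
    have f: "(f 0 has_vector_derivative f (Suc 0) x) (at x within closed_segment s t)"
      using Suc.prems(1)[of 0 x] seg x by (auto intro: has_vector_derivative_within_subset)
    have p: "((\<lambda>t. (t - s) ^ Suc k / fact (Suc k)) has_field_derivative (x - s) ^ k / fact k)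
        (at x within closed_segment s t)" for k
    proof -
      have "((\<lambda>t. t - s) has_field_derivative 1) (at x within closed_segment s t)"
        by (auto intro!: derivative_eq_intros)
      from DERIV_cdivide[OF DERIV_power[OF this, of "Suc k"], of "fact (Suc k)"]
      show ?thesis by (simp add: fact_Suc del: of_nat_Suc)
    qed
    have "((\<lambda>t. \<Sum>k\<le>N. ((t - s) ^ Suc k / fact (Suc k)) *\<^sub>R f (Suc k) s) has_vector_derivative
        (\<Sum>k\<le>N. ((x - s) ^ k / fact k) *\<^sub>R f (Suc k) s)) (at x within closed_segment s t)"
      using has_vector_derivative_scaleR[OF p has_vector_derivative_const]
      by (intro has_vector_derivative_sum) simp
    from has_vector_derivative_diff[OF has_vector_derivative_diff[OF f has_vector_derivative_const[of "f 0 s"]] this]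
    have "((\<lambda>t. f 0 t - f 0 s - (\<Sum>k\<le>N. ((t - s) ^ Suc k / fact (Suc k)) *\<^sub>R f (Suc k) s))
        has_vector_derivative g' x) (at x within closed_segment s t)"
      by (simp add: g'_def)
    moreover have "g = (\<lambda>t. f 0 t - f 0 s - (\<Sum>k\<le>N. ((t - s) ^ Suc k / fact (Suc k)) *\<^sub>R f (Suc k) s))"
      unfolding g_def sum.atMost_Suc_shift by (simp add: diff_diff_eq)
    ultimately show ?thesis by simp
  qed
  have "norm (g t - g s) \<le> (\<epsilon> * \<bar>t - s\<bar> ^ N) * norm (t - s)"
  proof (rule differentiable_bound)
    show "(g has_derivative (\<lambda>y. y *\<^sub>R g' x)) (at x within closed_segment s t)"
      if "x \<in> closed_segment s t" for x
      using der[OF that] by (simp add: has_vector_derivative_def)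
    show "onorm (\<lambda>y. y *\<^sub>R g' x) \<le> \<epsilon> * \<bar>t - s\<bar> ^ N" if x: "x \<in> closed_segment s t" for x
    proof (rule onorm_le)
      fix y :: real
      have "\<bar>x - s\<bar> \<le> \<bar>t - s\<bar>"
        using segment_bound1[OF x] by simp
      then have "norm (g' x) \<le> \<epsilon> * \<bar>t - s\<bar> ^ N"
        using bound[of x] seg x Suc.prems(3)
        by (intro order_trans[OF bound mult_left_mono] power_mono) auto
      then show "norm (y *\<^sub>R g' x) \<le> \<epsilon> * \<bar>t - s\<bar> ^ N * norm y"
        by (simp add: mult.commute mult_left_mono)
    qed
  qed auto
  moreover have "g s = 0"
    unfolding g_def sum.atMost_Suc_shift by simp
  ultimately show ?case by (simp add: g_def mult_ac)
qed

section \<open>Functions of a base point and an offset that are smooth in the offset\<close>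

definition strip :: "real \<Rightarrow> real \<Rightarrow> real \<Rightarrow> (real \<times> real) set" where
  "strip a b \<delta> = {(s, \<eta>). s \<in> {a..b} \<and> s + \<eta> \<in> {a..b} \<and> \<bar>\<eta>\<bar> < \<delta>}"

text \<open>Continuity of the derivatives is required jointly with the base point \<open>s\<close>, because Taylor
  expansions have to be uniform in \<open>s\<close>.\<close>

primrec fibre_Ck ::
  "real \<Rightarrow> real \<Rightarrow> real \<Rightarrow> nat \<Rightarrow> (real \<Rightarrow> real \<Rightarrow> 'v::real_normed_vector) \<Rightarrow> bool" where
  "fibre_Ck a b \<delta> 0 F \<longleftrightarrow> continuous_on (strip a b \<delta>) (\<lambda>x. F (fst x) (snd x))"
| "fibre_Ck a b \<delta> (Suc k) F \<longleftrightarrow> continuous_on (strip a b \<delta>) (\<lambda>x. F (fst x) (snd x)) \<and>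
     (\<exists>F'. fibre_Ck a b \<delta> k F' \<and>
        (\<forall>s \<eta>. (s, \<eta>) \<in> strip a b \<delta> \<longrightarrow>
           (F s has_vector_derivative F' s \<eta>) (at \<eta> within {a - s..b - s})))"

lemma fibre_Ck_continuous:
  "fibre_Ck a b \<delta> k F \<Longrightarrow> continuous_on (strip a b \<delta>) (\<lambda>x. F (fst x) (snd x))"
  by (cases k) auto

lemma fibre_Ck_SucD: "fibre_Ck a b \<delta> (Suc k) F \<Longrightarrow> fibre_Ck a b \<delta> k F"
  by (induction k arbitrary: F) (auto simp: fibre_Ck_continuous)

lemma fibre_Ck_add:
  "fibre_Ck a b \<delta> k F \<Longrightarrow> fibre_Ck a b \<delta> k G \<Longrightarrow> fibre_Ck a b \<delta> k (\<lambda>s \<eta>. F s \<eta> + G s \<eta>)"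
proof (induction k arbitrary: F G)
  case (Suc k)
  then obtain F' G' where *: "fibre_Ck a b \<delta> k F'" "fibre_Ck a b \<delta> k G'"
    "\<And>s \<eta>. (s, \<eta>) \<in> strip a b \<delta> \<Longrightarrow> (F s has_vector_derivative F' s \<eta>) (at \<eta> within {a - s..b - s})"
    "\<And>s \<eta>. (s, \<eta>) \<in> strip a b \<delta> \<Longrightarrow> (G s has_vector_derivative G' s \<eta>) (at \<eta> within {a - s..b - s})"
    by auto
  show ?case
    using Suc.prems
    by (auto intro!: continuous_intros exI[of _ "\<lambda>s \<eta>. F' s \<eta> + G' s \<eta>"] Suc.IH *
        has_vector_derivative_add)
qed (auto intro!: continuous_intros)

lemma fibre_Ck_fibre_constant:
  assumes "continuous_on {a..b} c"
  shows "fibre_Ck a b \<delta> k (\<lambda>s \<eta>. c s)"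
proof -
  have "continuous_on (strip a b \<delta>) (\<lambda>x. c (fst x))"
    by (rule continuous_on_compose2[OF assms]) (auto intro!: continuous_intros simp: strip_def)
  moreover have "fibre_Ck a b \<delta> k (\<lambda>s \<eta>. 0 :: 'a)" for k
    by (induction k) (auto intro!: exI[of _ "\<lambda>s \<eta>. 0"])
  ultimately show ?thesis
    by (cases k) (auto intro!: exI[of _ "\<lambda>s \<eta>. 0"])
qed

lemma fibre_Ck_bilinear:
  assumes b: "bounded_bilinear bop"
  shows "fibre_Ck a b \<delta> k F \<Longrightarrow> fibre_Ck a b \<delta> k G \<Longrightarrow> fibre_Ck a b \<delta> k (\<lambda>s \<eta>. bop (F s \<eta>) (G s \<eta>))"
proof (induction k arbitrary: F G)
  case 0
  then show ?case by (auto intro!: bounded_bilinear.continuous_on[OF b])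
next
  case (Suc k)
  then obtain F' G' where *: "fibre_Ck a b \<delta> k F'" "fibre_Ck a b \<delta> k G'"
    "\<And>s \<eta>. (s, \<eta>) \<in> strip a b \<delta> \<Longrightarrow> (F s has_vector_derivative F' s \<eta>) (at \<eta> within {a - s..b - s})"
    "\<And>s \<eta>. (s, \<eta>) \<in> strip a b \<delta> \<Longrightarrow> (G s has_vector_derivative G' s \<eta>) (at \<eta> within {a - s..b - s})"
    by auto
  have "fibre_Ck a b \<delta> k (\<lambda>s \<eta>. bop (F s \<eta>) (G' s \<eta>) + bop (F' s \<eta>) (G s \<eta>))"
    by (intro fibre_Ck_add Suc.IH * Suc.prems[THEN fibre_Ck_SucD])
  moreover have "continuous_on (strip a b \<delta>) (\<lambda>x. bop (F (fst x) (snd x)) (G (fst x) (snd x)))"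
    using Suc.prems by (auto intro!: bounded_bilinear.continuous_on[OF b])
  ultimately show ?case
    by (auto intro!: exI[of _ "\<lambda>s \<eta>. bop (F s \<eta>) (G' s \<eta>) + bop (F' s \<eta>) (G s \<eta>)"]
        bounded_bilinear.has_vector_derivative[OF b] *)
qed

lemma fibre_Ck_cong:
  assumes "fibre_Ck a b \<delta> k F" "\<And>s \<eta>. (s, \<eta>) \<in> strip a b \<delta> \<Longrightarrow> G s \<eta> = F s \<eta>"
  shows "fibre_Ck a b \<delta> k G"
proof -
  have cont: "continuous_on (strip a b \<delta>) (\<lambda>x. G (fst x) (snd x))"
    by (rule continuous_on_eq[OF fibre_Ck_continuous[OF assms(1)]]) (simp add: assms(2))
  \<comment> \<open>The strip is open in the offset relative to the interval: \<open>F\<close> and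
    \<open>G\<close> agree up to distance \<open>\<delta> - \<bar>\<eta>\<bar>\<close>, which
    suffices to transfer the derivative.\<close>
  have der: "(G s has_vector_derivative D) (at \<eta> within {a - s..b - s})"
    if "(F s has_vector_derivative D) (at \<eta> within {a - s..b - s})" "(s, \<eta>) \<in> strip a b \<delta>" for s \<eta> D
    by (rule has_vector_derivative_transform_within[OF that(1), of "\<delta> - \<bar>\<eta>\<bar>"])
      (use that(2) assms(2) in \<open>auto simp: strip_def dist_real_def\<close>)
  show ?thesis
  proof (cases k)
    case (Suc l)
    then obtain F' where "fibre_Ck a b \<delta> l F'"
      "\<And>s \<eta>. (s, \<eta>) \<in> strip a b \<delta> \<Longrightarrow> (F s has_vector_derivative F' s \<eta>) (at \<eta> within {a - s..b - s})"
      using assms(1) by auto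
    then show ?thesis using Suc cont der by auto
  qed (use cont in simp)
qed

text \<open>The whole sequence of derivatives is carried along because the chain rule for
  \<open>\<Phi> j\<close> calls for \<open>\<Phi> (Suc j)\<close>.\<close>

lemma fibre_Ck_compose:
  fixes \<Phi> :: "nat \<Rightarrow> real \<Rightarrow> real"
  assumes \<Phi>: "\<And>j x. \<bar>x\<bar> < \<rho> \<Longrightarrow> (\<Phi> j has_field_derivative \<Phi> (Suc j) x) (at x)"
    and range: "\<And>s \<eta>. (s, \<eta>) \<in> strip a b \<delta> \<Longrightarrow> \<bar>c s \<eta>\<bar> < \<rho>"
    and c: "fibre_Ck a b \<delta> k c"
  shows "fibre_Ck a b \<delta> k (\<lambda>s \<eta>. \<Phi> j (c s \<eta>))"
proof -
  have cont: "continuous_on (strip a b \<delta>) (\<lambda>x. \<Phi> j (c (fst x) (snd x)))"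
    if "continuous_on (strip a b \<delta>) (\<lambda>x. c (fst x) (snd x))" for j
  proof (rule continuous_on_compose2[OF _ that])
    show "continuous_on {-\<rho><..<\<rho>} (\<Phi> j)"
    proof (rule DERIV_continuous_on)
      show "(\<Phi> j has_field_derivative \<Phi> (Suc j) x) (at x within {-\<rho><..<\<rho>})"
        if "x \<in> {-\<rho><..<\<rho>}" for x
        by (rule has_field_derivative_at_within[OF \<Phi>]) (use that in auto)
    qed
  qed (use range in \<open>fastforce simp: abs_less_iff\<close>)
  show ?thesis
    using c
  proof (induction k arbitrary: j)
    case 0
    then show ?case using cont by simp
  next
    case (Suc k)
    then obtain c' where c': "fibre_Ck a b \<delta> k c'"
      "\<And>s \<eta>. (s, \<eta>) \<in> strip a b \<delta> \<Longrightarrow> (c s has_vector_derivative c' s \<eta>) (at \<eta> within {a - s..b - s})"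
      by auto
    have "fibre_Ck a b \<delta> k (\<lambda>s \<eta>. \<Phi> (Suc j) (c s \<eta>) * c' s \<eta>)"
      by (intro fibre_Ck_bilinear[OF bounded_bilinear_mult] Suc.IH c' fibre_Ck_SucD[OF Suc.prems])
    moreover have "((\<lambda>\<eta>. \<Phi> j (c s \<eta>)) has_vector_derivative \<Phi> (Suc j) (c s \<eta>) * c' s \<eta>)
        (at \<eta> within {a - s..b - s})" if "(s, \<eta>) \<in> strip a b \<delta>" for s \<eta>
    proof -
      have "(c s has_field_derivative c' s \<eta>) (at \<eta> within {a - s..b - s})"
        using c'(2)[OF that] unfolding has_real_derivative_iff_has_vector_derivative .
      from DERIV_chain'[where f = "c s" and g = "\<Phi> j", OF this \<Phi>[OF range[OF that]]]
      show ?thesis unfolding has_real_derivative_iff_has_vector_derivative .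
    qed
    moreover have "continuous_on (strip a b \<delta>) (\<lambda>x. \<Phi> j (c (fst x) (snd x)))"
      using cont fibre_Ck_continuous[OF Suc.prems] .
    ultimately show ?case
      by (auto intro!: exI[of _ "\<lambda>s \<eta>. \<Phi> (Suc j) (c s \<eta>) * c' s \<eta>"])
  qed
qed

text \<open>\<open>\<Psi>\<close> is controlled for nonnegative arguments only, and the range of
  \<open>c\<close> touches 0. The sum of the series extends it smoothly across 0, and the two agree
  on that range.\<close>

lemma fibre_Ck_power_series:
  assumes ps: "power_series_on \<Psi> q \<rho>" and c: "fibre_Ck a b \<delta> k c"
    and range: "\<And>s \<eta>. (s, \<eta>) \<in> strip a b \<delta> \<Longrightarrow> 0 \<le> c s \<eta> \<and> c s \<eta> < \<rho>"
  shows "fibre_Ck a b \<delta> k (\<lambda>s \<eta>. \<Psi> (c s \<eta>))"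
proof -
  define \<Phi> where "\<Phi> j x = (\<Sum>k. (diffs ^^ j) q k * x ^ k)" for j and x :: real
  have \<rho>: "0 < \<rho>" and sums: "\<And>x. 0 \<le> x \<Longrightarrow> x \<le> \<rho> \<Longrightarrow> (\<lambda>k. q k * x ^ k) sums \<Psi> x"
    using ps by (auto simp: power_series_on_def)
  have summable: "\<bar>x\<bar> < \<rho> \<Longrightarrow> summable (\<lambda>k. (diffs ^^ j) q k * x ^ k)" for j x
  proof (induction j arbitrary: x)
    case 0
    have "summable (\<lambda>k. q k * \<rho> ^ k)" using sums[of \<rho>] \<rho> by (auto simp: sums_iff)
    then show ?case using powser_inside[of q \<rho> x] 0 \<rho> by simp
  next
    case (Suc j)
    then show ?case using termdiff_converges[of x \<rho> "(diffs ^^ j) q"] by simp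
  qed
  have "(\<Phi> j has_field_derivative \<Phi> (Suc j) x) (at x)" if "\<bar>x\<bar> < \<rho>" for j x
    using termdiffs_strong'[of \<rho> "(diffs ^^ j) q" x] summable that by (simp add: \<Phi>_def[abs_def])
  then have "fibre_Ck a b \<delta> k (\<lambda>s \<eta>. \<Phi> 0 (c s \<eta>))"
    by (rule fibre_Ck_compose[where \<Phi> = \<Phi> and \<rho> = \<rho>]) (use range c in force)+
  moreover have "\<Psi> (c s \<eta>) = \<Phi> 0 (c s \<eta>)" if "(s, \<eta>) \<in> strip a b \<delta>" for s \<eta>
    using sums[of "c s \<eta>"] range[OF that] by (simp add: \<Phi>_def sums_iff)
  ultimately show ?thesis by (rule fibre_Ck_cong)
qed

lemma C_k_on_derivative:
  assumes "C_k_on N \<gamma> S" "k < N" "t \<in> S"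
  shows "(vderivs S k \<gamma> has_vector_derivative vderivs S (Suc k) \<gamma> t) (at t within S)"
  using assms by (auto simp: C_k_on_def differentiable_on_def vector_derivative_works)

lemma fibre_Ck_curve:
  assumes \<gamma>: "C_k_on N \<gamma> {a..b}" and "k \<le> N"
  shows "fibre_Ck a b \<delta> (N - k) (\<lambda>s \<eta>. vderivs {a..b} k \<gamma> (s + \<eta>))"
proof -
  have cont: "continuous_on {a..b} (vderivs {a..b} k \<gamma>)" if "k \<le> N" for k
  proof (cases "k = N")
    case False
    then show ?thesis using \<gamma> that by (intro differentiable_imp_continuous_on) (auto simp: C_k_on_def)
  qed (use \<gamma> in \<open>simp add: C_k_on_def\<close>)
  have cont': "continuous_on (strip a b \<delta>) (\<lambda>x. vderivs {a..b} k \<gamma> (fst x + snd x))" if "k \<le> N" for k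
    by (rule continuous_on_compose2[OF cont[OF that]])
      (auto intro!: continuous_intros simp: strip_def)
  have "fibre_Ck a b \<delta> m (\<lambda>s \<eta>. vderivs {a..b} k \<gamma> (s + \<eta>))" if "m + k = N" for m k
    using that
  proof (induction m arbitrary: k)
    case 0
    then show ?case using cont' by simp
  next
    case (Suc m)
    have "((\<lambda>\<eta>. vderivs {a..b} k \<gamma> (s + \<eta>)) has_vector_derivative vderivs {a..b} (Suc k) \<gamma> (s + \<eta>))
        (at \<eta> within {a - s..b - s})" if "(s, \<eta>) \<in> strip a b \<delta>" for s \<eta>
    proof -
      have im: "(\<lambda>\<eta>. s + \<eta>) ` {a - s..b - s} = {a..b}" by simp
      have 1: "((\<lambda>\<eta>. s + \<eta>) has_vector_derivative 1) (at \<eta> within {a - s..b - s})"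
        by (auto intro!: derivative_eq_intros)
      have "(vderivs {a..b} k \<gamma> has_vector_derivative vderivs {a..b} (Suc k) \<gamma> (s + \<eta>))
          (at (s + \<eta>) within {a..b})"
        using that Suc.prems by (intro C_k_on_derivative[OF \<gamma>]) (auto simp: strip_def)
      from vector_diff_chain_within[OF 1 this[folded im]] show ?thesis by (simp add: o_def im)
    qed
    moreover have "fibre_Ck a b \<delta> m (\<lambda>s \<eta>. vderivs {a..b} (Suc k) \<gamma> (s + \<eta>))"
      using Suc.prems by (intro Suc.IH) simp
    moreover have "continuous_on (strip a b \<delta>) (\<lambda>x. vderivs {a..b} k \<gamma> (fst x + snd x))"
      using Suc.prems by (intro cont') simp
    ultimately show ?case
      by (auto simp del: vderivs.simps intro!: exI[of _ "\<lambda>s \<eta>. vderivs {a..b} (Suc k) \<gamma> (s + \<eta>)"])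
  qed
  then show ?thesis using assms(2) by simp
qed

lemma fibre_Ck_derivatives:
  assumes "fibre_Ck a b \<delta> N F"
  obtains D where "D 0 = F"
    "\<And>k s \<eta>. k < N \<Longrightarrow> (s, \<eta>) \<in> strip a b \<delta> \<Longrightarrow>
       (D k s has_vector_derivative D (Suc k) s \<eta>) (at \<eta> within {a - s..b - s})"
    "\<And>k. k \<le> N \<Longrightarrow> continuous_on (strip a b \<delta>) (\<lambda>x. D k (fst x) (snd x))"
  using assms
proof (induction N arbitrary: F thesis)
  case 0
  show ?case by (rule 0(1)[of "\<lambda>_. F"]) (use 0(2) in auto)
next
  case (Suc N)
  then obtain F' where F': "fibre_Ck a b \<delta> N F'"
    "\<And>s \<eta>. (s, \<eta>) \<in> strip a b \<delta> \<Longrightarrow> (F s has_vector_derivative F' s \<eta>) (at \<eta> within {a - s..b - s})"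
    by auto
  obtain D where D: "D 0 = F'"
    "\<And>k s \<eta>. k < N \<Longrightarrow> (s, \<eta>) \<in> strip a b \<delta> \<Longrightarrow>
       (D k s has_vector_derivative D (Suc k) s \<eta>) (at \<eta> within {a - s..b - s})"
    "\<And>k. k \<le> N \<Longrightarrow> continuous_on (strip a b \<delta>) (\<lambda>x. D k (fst x) (snd x))"
    using Suc.IH[OF _ F'(1)] by blast
  show ?case
  proof (rule Suc.prems(1)[of "\<lambda>k. case k of 0 \<Rightarrow> F | Suc k \<Rightarrow> D k"])
    show "continuous_on (strip a b \<delta>) (\<lambda>x. (case k of 0 \<Rightarrow> F | Suc k \<Rightarrow> D k) (fst x) (snd x))"
      if "k \<le> Suc N" for k
      using that D(3) fibre_Ck_continuous[OF Suc.prems(2)] by (cases k) auto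
    show "((case k of 0 \<Rightarrow> F | Suc k \<Rightarrow> D k) s has_vector_derivative
        (case Suc k of 0 \<Rightarrow> F | Suc k \<Rightarrow> D k) s \<eta>) (at \<eta> within {a - s..b - s})"
      if "k < Suc N" "(s, \<eta>) \<in> strip a b \<delta>" for k s \<eta>
      using that D(1,2) F'(2) by (cases k) auto
  qed simp
qed

lemma uniform_fibre_taylor:
  fixes F :: "real \<Rightarrow> real \<Rightarrow> vec3"
  assumes ab: "a < b" and \<delta>: "0 < \<delta>" and F: "fibre_Ck a b \<delta> N F"
  defines "J \<equiv> \<lambda>k s. vderivs {a - s..b - s} k (F s) 0"
  shows "k \<le> N \<Longrightarrow> bounded (J k ` {a..b})"
    and "0 < \<epsilon> \<Longrightarrow> \<exists>d>0. \<forall>s\<in>{a..b}. \<forall>\<eta>. s + \<eta> \<in> {a..b} \<longrightarrow> \<bar>\<eta>\<bar> < d \<longrightarrow>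
      norm (F s \<eta> - (\<Sum>k\<le>N. (\<eta> ^ k / fact k) *\<^sub>R J k s)) \<le> \<epsilon> * \<bar>\<eta>\<bar> ^ N"
    and "k \<le> N \<Longrightarrow> s \<in> {a..b} \<Longrightarrow> (\<And>\<eta>. (s, \<eta>) \<in> strip a b \<delta> \<Longrightarrow> F s \<eta> \<bullet> y = 0) \<Longrightarrow> J k s \<bullet> y = 0"
proof -
  obtain D where D: "D 0 = F"
    "\<And>k s \<eta>. k < N \<Longrightarrow> (s, \<eta>) \<in> strip a b \<delta> \<Longrightarrow>
       (D k s has_vector_derivative D (Suc k) s \<eta>) (at \<eta> within {a - s..b - s})"
    "\<And>k. k \<le> N \<Longrightarrow> continuous_on (strip a b \<delta>) (\<lambda>x. D k (fst x) (snd x))"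
    using fibre_Ck_derivatives[OF F] by blast
  \<comment> \<open>The derivative within a nondegenerate interval is unique, also at its end
    points; this is where \<open>a < b\<close> enters. It identifies the jet with the jointly
    continuous functions \<open>D\<close>.\<close>
  have vd: "vderivs {a - s..b - s} k (F s) \<eta> = D k s \<eta>" if "k \<le> N" "(s, \<eta>) \<in> strip a b \<delta>" for k s \<eta>
    using that
  proof (induction k arbitrary: \<eta>)
    case (Suc k)
    have "(vderivs {a - s..b - s} k (F s) has_vector_derivative D (Suc k) s \<eta>)
        (at \<eta> within {a - s..b - s})"
    proof (rule has_vector_derivative_transform_within)
      show "(D k s has_vector_derivative D (Suc k) s \<eta>) (at \<eta> within {a - s..b - s})"
        using D(2) Suc.prems by simp
      show "0 < \<delta> - \<bar>\<eta>\<bar>" "\<eta> \<in> {a - s..b - s}"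
        using Suc.prems(2) by (auto simp: strip_def)
      show "D k s x = vderivs {a - s..b - s} k (F s) x"
        if "x \<in> {a - s..b - s}" "dist x \<eta> < \<delta> - \<bar>\<eta>\<bar>" for x
        using that Suc.prems by (intro Suc.IH[symmetric]) (auto simp: strip_def dist_real_def)
    qed
    then show ?case
      using ab Suc.prems by (auto simp: strip_def intro!: vector_derivative_within_closed_interval)
  qed (simp add: D(1))
  have zero: "(s, 0) \<in> strip a b \<delta>" if "s \<in> {a..b}" for s
    using that \<delta> by (simp add: strip_def)
  have J: "J k s = D k s 0" if "k \<le> N" "s \<in> {a..b}" for k s
    unfolding J_def using vd zero that by blast
  show "J k s \<bullet> y = 0"
    if "k \<le> N" "s \<in> {a..b}" and perp: "\<And>\<eta>. (s, \<eta>) \<in> strip a b \<delta> \<Longrightarrow> F s \<eta> \<bullet> y = 0"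
  proof -
    have "D k s \<eta> \<bullet> y = 0" if "k \<le> N" "(s, \<eta>) \<in> strip a b \<delta>" for k \<eta>
      using that
    proof (induction k arbitrary: \<eta>)
      case 0
      then show ?case using perp by (simp add: D(1))
    next
      case (Suc k)
      have "(D k s has_vector_derivative D (Suc k) s \<eta>) (at \<eta> within {a - s..b - s})"
        using D(2) Suc.prems by simp
      then have "((\<lambda>\<eta>. D k s \<eta> \<bullet> y) has_vector_derivative D (Suc k) s \<eta> \<bullet> y)
          (at \<eta> within {a - s..b - s})"
        by (rule bounded_linear.has_vector_derivative[OF bounded_linear_inner_left])
      then have "((\<lambda>\<eta>. 0) has_vector_derivative D (Suc k) s \<eta> \<bullet> y) (at \<eta> within {a - s..b - s})"
      proof (rule has_vector_derivative_transform_within)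
        show "0 < \<delta> - \<bar>\<eta>\<bar>" "\<eta> \<in> {a - s..b - s}"
          using Suc.prems(2) by (auto simp: strip_def)
        show "D k s x \<bullet> y = 0" if "x \<in> {a - s..b - s}" "dist x \<eta> < \<delta> - \<bar>\<eta>\<bar>" for x
          using that Suc.prems by (intro Suc.IH) (auto simp: strip_def dist_real_def)
      qed
      from vector_derivative_within_closed_interval[OF _ _ this]
        vector_derivative_within_closed_interval[OF _ _ has_vector_derivative_const[of "0::real"]]
      show ?case using ab Suc.prems by (simp add: strip_def)
    qed
    then show ?thesis using J zero that by simp
  qed
  show "bounded (J k ` {a..b})" if "k \<le> N"
  proof -
    have "continuous_on {a..b} (\<lambda>s. D k (fst (s, 0 :: real)) (snd (s, 0 :: real)))"
      by (rule continuous_on_compose2[OF D(3)[OF that], of _ "\<lambda>s. (s, 0)"])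
        (auto intro!: continuous_intros zero)
    then have "bounded ((\<lambda>s. D k s 0) ` {a..b})"
      by (intro compact_imp_bounded compact_continuous_image) auto
    moreover have "J k ` {a..b} = (\<lambda>s. D k s 0) ` {a..b}"
      using J[OF that] by (intro image_cong) auto
    ultimately show ?thesis by simp
  qed
  show "\<exists>d>0. \<forall>s\<in>{a..b}. \<forall>\<eta>. s + \<eta> \<in> {a..b} \<longrightarrow> \<bar>\<eta>\<bar> < d \<longrightarrow>
      norm (F s \<eta> - (\<Sum>k\<le>N. (\<eta> ^ k / fact k) *\<^sub>R J k s)) \<le> \<epsilon> * \<bar>\<eta>\<bar> ^ N" if \<epsilon>: "0 < \<epsilon>"
  proof -
    \<comment> \<open>Halving the width makes the strip compact. Uniform continuity of the top
      derivative there bounds its oscillation between (s, t) and (s, 0) independently of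
      \<open>s\<close>.\<close>
    define K where "K = ({a..b} \<times> {- \<delta> / 2..\<delta> / 2}) \<inter>
      ({x. a \<le> fst x + snd x} \<inter> {x :: real \<times> real. fst x + snd x \<le> b})"
    have "compact K"
      unfolding K_def
      by (intro compact_Int_closed compact_Times closed_Int closed_Collect_le continuous_intros) auto
    moreover have "K \<subseteq> strip a b \<delta>" using \<delta> by (auto simp: K_def strip_def)
    ultimately have "uniformly_continuous_on K (\<lambda>x. D N (fst x) (snd x))"
      by (intro compact_uniformly_continuous continuous_on_subset[OF D(3)]) auto
    then obtain d where d: "0 < d" "\<And>x y. x \<in> K \<Longrightarrow> y \<in> K \<Longrightarrow> dist y x < d \<Longrightarrow>
        dist (D N (fst y) (snd y)) (D N (fst x) (snd x)) < \<epsilon>"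
      using \<epsilon> unfolding uniformly_continuous_on_def by metis
    define e where "e = min d (\<delta> / 2)"
    have "norm (F s \<eta> - (\<Sum>k\<le>N. (\<eta> ^ k / fact k) *\<^sub>R J k s)) \<le> \<epsilon> * \<bar>\<eta>\<bar> ^ N"
      if s: "s \<in> {a..b}" and \<eta>: "s + \<eta> \<in> {a..b}" "\<bar>\<eta>\<bar> < e" for s \<eta>
    proof -
      define S where "S = {a - s..b - s} \<inter> {- e<..<e}"
      have in_strip: "(s, t) \<in> strip a b \<delta>" if "t \<in> S" for t
        using that s \<delta> by (auto simp: S_def strip_def e_def)
      have "norm (D 0 s \<eta> - (\<Sum>k\<le>N. ((\<eta> - 0) ^ k / fact k) *\<^sub>R D k s 0)) \<le> \<epsilon> * \<bar>\<eta> - 0\<bar> ^ N"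
      proof (rule vector_taylor_bound)
        show "convex S" unfolding S_def by (intro convex_Int) auto
        show "0 \<in> S" "\<eta> \<in> S" using s \<eta> d(1) \<delta> by (auto simp: S_def e_def)
        show "(D k s has_vector_derivative D (Suc k) s t) (at t within S)" if "k < N" "t \<in> S" for k t
          using D(2)[OF that(1) in_strip[OF that(2)]]
          by (rule has_vector_derivative_within_subset) (simp add: S_def)
        show "norm (D N s t - D N s 0) \<le> \<epsilon>" if "t \<in> S" for t
        proof -
          have "(s, t) \<in> K" "(s, 0) \<in> K"
            using that s \<delta> by (auto simp: K_def S_def e_def)
          moreover have "dist (s, t) (s, 0 :: real) < d"
            using that by (auto simp: S_def e_def dist_Pair_Pair dist_real_def)
          ultimately show ?thesis using d(2)[of "(s, 0)" "(s, t)"] by (simp add: dist_norm)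
        qed
      qed (use \<epsilon> in auto)
      then show ?thesis using J[OF _ s] D(1) by simp
    qed
    moreover have "0 < e" using d(1) \<delta> by (simp add: e_def)
    ultimately show ?thesis by blast
  qed
qed

lemma curve_close:
  assumes "continuous_on {a..b} (\<gamma> :: real \<Rightarrow> vec3)"
  obtains \<delta> where "0 < \<delta>" "\<And>s t. s \<in> {a..b} \<Longrightarrow> t \<in> {a..b} \<Longrightarrow> \<bar>t - s\<bar> < \<delta> \<Longrightarrow> norm (\<gamma> t - \<gamma> s) < 1"
proof -
  have "uniformly_continuous_on {a..b} \<gamma>"
    using assms by (intro compact_uniformly_continuous) auto
  then show ?thesis
    unfolding uniformly_continuous_on_def using that
    by (metis dist_norm dist_real_def zero_less_one)
qed

text \<open>Passing to normal coordinates loses no derivative, for the scalar factor of the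
  logarithm is analytic in the inner product as long as that is positive.\<close>

lemma fibre_Ck_normal_coordinates:
  assumes \<gamma>: "C_k_on N \<gamma> {a..b}" and sphere: "\<gamma> ` {a..b} \<subseteq> S2"
    and close: "\<And>s t. s \<in> {a..b} \<Longrightarrow> t \<in> {a..b} \<Longrightarrow> \<bar>t - s\<bar> < \<delta> \<Longrightarrow> norm (\<gamma> t - \<gamma> s) < 1"
  shows "fibre_Ck a b \<delta> N (\<lambda>s \<eta>. Log_S2 (\<gamma> s) (\<gamma> (s + \<eta>)))"
proof -
  define c where "c s \<eta> = \<gamma> s \<bullet> \<gamma> (s + \<eta>)" for s \<eta>
  define m where "m s \<eta> = 1 / 2 + (- 1 / 2) * c s \<eta>" for s \<eta>
  define q where "q s \<eta> = m s \<eta> * (1 / (1 - m s \<eta>))" for s \<eta>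
  have cs: "norm (\<gamma> s) = 1" "norm (\<gamma> (s + \<eta>)) = 1" "0 < c s \<eta>" "c s \<eta> \<le> 1"
    if "(s, \<eta>) \<in> strip a b \<delta>" for s \<eta>
  proof -
    have *: "s \<in> {a..b}" "s + \<eta> \<in> {a..b}" "\<bar>s + \<eta> - s\<bar> < \<delta>" using that by (auto simp: strip_def)
    then show n: "norm (\<gamma> s) = 1" "norm (\<gamma> (s + \<eta>)) = 1"
      using subsetD[OF sphere, of "\<gamma> s"] subsetD[OF sphere, of "\<gamma> (s + \<eta>)"] by auto
    show "0 < c s \<eta>" unfolding c_def by (rule unit_close_inner[OF n close[OF *]])
    show "c s \<eta> \<le> 1" unfolding c_def by (rule unit_inner_bounds[OF n])
  qed
  have const: "fibre_Ck a b \<delta> N (\<lambda>s \<eta>. v)" for v :: real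
    by (rule fibre_Ck_fibre_constant) simp
  have g: "fibre_Ck a b \<delta> N (\<lambda>s \<eta>. \<gamma> (s + \<eta>))"
    using fibre_Ck_curve[OF \<gamma>, of 0] by simp
  have "continuous_on {a..b} \<gamma>"
  proof (cases N)
    case (Suc M)
    then have "vderivs {a..b} 0 \<gamma> differentiable_on {a..b}" using \<gamma> unfolding C_k_on_def by blast
    then show ?thesis by (simp add: differentiable_imp_continuous_on)
  qed (use \<gamma> in \<open>simp add: C_k_on_def\<close>)
  then have g0: "fibre_Ck a b \<delta> N (\<lambda>s \<eta>. \<gamma> s)"
    by (rule fibre_Ck_fibre_constant)
  have c: "fibre_Ck a b \<delta> N c"
    using fibre_Ck_bilinear[OF bounded_bilinear_inner g0 g] by (simp add: c_def[abs_def])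
  have m: "fibre_Ck a b \<delta> N m"
    unfolding m_def by (intro fibre_Ck_add const fibre_Ck_bilinear[OF bounded_bilinear_mult] c)
  \<comment> \<open>A positive inner product keeps \<open>m\<close> below 1/2 and then
    \<open>q\<close> below 1, the radii used for the geometric and the arctan series.\<close>
  have m_range: "0 \<le> m s \<eta>" "m s \<eta> < 1 / 2" if "(s, \<eta>) \<in> strip a b \<delta>" for s \<eta>
    using cs[OF that] by (auto simp: m_def)
  have q: "fibre_Ck a b \<delta> N q"
    unfolding q_def using m_range
    by (intro fibre_Ck_bilinear[OF bounded_bilinear_mult] m
        fibre_Ck_power_series[OF power_series_on_geometric]) auto
  have q_range: "0 \<le> q s \<eta>" "q s \<eta> < 1" if "(s, \<eta>) \<in> strip a b \<delta>" for s \<eta>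
    using m_range[OF that] by (auto simp: q_def field_simps)
  have at: "fibre_Ck a b \<delta> N (\<lambda>s \<eta>. sqrt_arctan (q s \<eta>))"
    using q_range by (intro fibre_Ck_power_series[OF power_series_on_sqrt_arctan] q) auto
  have "fibre_Ck a b \<delta> N (\<lambda>s \<eta>. ((1 + q s \<eta>) * sqrt_arctan (q s \<eta>)) *\<^sub>R
      (\<gamma> (s + \<eta>) + ((- 1) * c s \<eta>) *\<^sub>R \<gamma> s))"
    by (intro fibre_Ck_bilinear[OF bounded_bilinear_scaleR] fibre_Ck_bilinear[OF bounded_bilinear_mult]
        fibre_Ck_add const q at c g g0)
  then show ?thesis
  proof (rule fibre_Ck_cong)
    fix s \<eta> assume "(s, \<eta>) \<in> strip a b \<delta>"
    note cs = cs[OF this]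
    have "(1 - c s \<eta>) / 2 = m s \<eta>" by (simp add: m_def field_simps)
    then have "log_factor (c s \<eta>) = (1 + q s \<eta>) * sqrt_arctan (q s \<eta>)"
      by (simp add: log_factor_def q_def Let_def)
    with cs show "Log_S2 (\<gamma> s) (\<gamma> (s + \<eta>)) = ((1 + q s \<eta>) * sqrt_arctan (q s \<eta>)) *\<^sub>R
      (\<gamma> (s + \<eta>) + ((- 1) * c s \<eta>) *\<^sub>R \<gamma> s)"
      by (simp add: Log_S2_eq_sph_log sph_log_eq_log_factor c_def)
  qed
qed

section \<open>The SIDER error\<close>

text \<open>Splitting off the component along the base point \<open>y\<close> moves the whole construction to the unit
  sphere of \<open>real \<times> vec3\<close> with base point \<open>(1, 0)\<close>. There it depends on the normal coordinates
  alone and no longer on \<open>y\<close>.\<close>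

definition lift :: "vec3 \<Rightarrow> vec3 \<Rightarrow> real \<times> vec3" where
  "lift y v = (y \<bullet> v, v - (y \<bullet> v) *\<^sub>R y)"

lemma linear_lift: "linear (lift y)"
  by (rule linearI) (simp_all add: lift_def inner_add_right algebra_simps)

lemma inner_lift:
  assumes "norm y = 1"
  shows "lift y v \<bullet> lift y w = v \<bullet> w"
proof -
  have "y \<bullet> y = 1" using assms by (simp flip: power2_norm_eq_inner)
  then show ?thesis by (simp add: lift_def inner_prod_def inner_diff inner_commute)
qed

lemma norm_lift: "norm y = 1 \<Longrightarrow> norm (lift y v) = norm v"
  by (simp add: norm_eq_sqrt_inner inner_lift)

lemma lift_base: "norm y = 1 \<Longrightarrow> lift y y = (1, 0)"
  by (simp add: lift_def flip: power2_norm_eq_inner)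

text \<open>The exponential inverts the logarithm, \<open>lift y\<close> commutes with it as a
  linear isometry, and tangent vectors at \<open>y\<close> have first component 0.\<close>

lemma lift_eq_sph_exp:
  assumes "norm y = 1" "norm z = 1" "0 < y \<bullet> z"
  shows "lift y z = sph_exp (1, 0) (0, Log_S2 y z)"
proof -
  have "z = sph_exp y (sph_log y z)"
    using sph_slerp_1[of y z] assms by (simp add: sph_slerp_def)
  then have "lift y z = sph_exp (lift y y) (lift y (sph_log y z))"
    using sph_exp_isometry[OF linear_lift inner_lift[OF assms(1)], of y "sph_log y z"] by simp
  then show ?thesis
    using assms inner_sph_log[OF assms(1), of z]
    by (simp add: lift_base Log_S2_eq_sph_log) (simp add: lift_def)
qed

text \<open>The list begins with the first derivative, hence the index shift; the term of order 0 is
  the logarithm of the base point to itself, which is 0.\<close>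

definition taylor_curve :: "vec3 list \<Rightarrow> real \<Rightarrow> vec3" where
  "taylor_curve L \<eta> = (\<Sum>k<length L. (\<eta> ^ Suc k / fact (Suc k)) *\<^sub>R (L ! k))"

definition model_point :: "vec3 list \<Rightarrow> real \<Rightarrow> real \<times> vec3" where
  "model_point L \<eta> = sph_exp (1, 0) (0, taylor_curve L \<eta>)"

text \<open>The coefficient is read off the model curve at the position \<open>\<theta> - i = 1 / 2\<close>; any position that
  is not a node would do.\<close>

definition sider_coefficient :: "nat \<Rightarrow> vec3 list \<Rightarrow> real \<times> vec3" where
  "sider_coefficient n L = Lim (at_right 0) (\<lambda>t.
     (1 / (t ^ Suc n * (\<Prod>l\<le>n. 1 / 2 - real l))) *\<^sub>R
     (sph_sider (\<lambda>l. model_point L ((of_int l - 1 / 2) * t)) n 0 (1 / 2) - (1, 0)))"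

section \<open>Jets and expandable data of a curve on the sphere\<close>

locale sphere_curve =
  fixes n :: nat and \<gamma> :: "real \<Rightarrow> vec3" and a b :: real
  assumes n: "2 \<le> n" and ab: "a < b" and sphere: "\<gamma> ` {a..b} \<subseteq> S2"
    and smooth: "C_k_on (n + 1) \<gamma> {a..b}"
begin

lemma norm_curve: "s \<in> {a..b} \<Longrightarrow> norm (\<gamma> s) = 1"
  using sphere by (auto simp: image_subset_iff)

definition jet :: "nat \<Rightarrow> real \<Rightarrow> vec3" where
  "jet k s = vderivs {a - s..b - s} k (\<lambda>\<eta>. Log_S2 (\<gamma> s) (\<gamma> (s + \<eta>))) 0"

lemma taylor_curve_normal_jet:
  "taylor_curve (normal_jet (n + 1) \<gamma> a b s) \<eta> =
     (\<Sum>k<n + 1. (\<eta> ^ Suc k / fact (Suc k)) *\<^sub>R jet (Suc k) s)"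
  unfolding taylor_curve_def normal_jet_def jet_def
  by (rule sum.cong) (simp_all del: upt_Suc vderivs.simps power_Suc fact_Suc)

lemma continuous_curve: "continuous_on {a..b} \<gamma>"
proof -
  have "\<gamma> differentiable_on {a..b}"
    using spec[OF conjunct1[OF smooth[unfolded C_k_on_def]], of 0] by simp
  then show ?thesis by (rule differentiable_imp_continuous_on)
qed

lemma curve_inner_pos:
  obtains \<delta> where "0 < \<delta>"
    "\<And>s t. s \<in> {a..b} \<Longrightarrow> t \<in> {a..b} \<Longrightarrow> \<bar>t - s\<bar> < \<delta> \<Longrightarrow> 0 < \<gamma> s \<bullet> \<gamma> t"
proof -
  obtain \<delta> where \<delta>: "0 < \<delta>"
    "\<And>s t. s \<in> {a..b} \<Longrightarrow> t \<in> {a..b} \<Longrightarrow> \<bar>t - s\<bar> < \<delta> \<Longrightarrow> norm (\<gamma> t - \<gamma> s) < 1"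
    using curve_close[OF continuous_curve] by metis
  show thesis
    by (rule that[OF \<delta>(1)]) (rule unit_close_inner[OF norm_curve norm_curve \<delta>(2)])
qed

lemma fibre_Ck_log:
  obtains \<delta> where "0 < \<delta>" "fibre_Ck a b \<delta> (n + 1) (\<lambda>s \<eta>. Log_S2 (\<gamma> s) (\<gamma> (s + \<eta>)))"
proof -
  obtain \<delta> where \<delta>: "0 < \<delta>"
    "\<And>s t. s \<in> {a..b} \<Longrightarrow> t \<in> {a..b} \<Longrightarrow> \<bar>t - s\<bar> < \<delta> \<Longrightarrow> norm (\<gamma> t - \<gamma> s) < 1"
    using curve_close[OF continuous_curve] by metis
  show thesis
    by (rule that[OF \<delta>(1) fibre_Ck_normal_coordinates[OF smooth sphere \<delta>(2)]])
qed

lemma bounded_jet: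
  assumes "k \<le> n + 1"
  shows "bounded (jet k ` {a..b})"
proof -
  obtain \<delta> where \<delta>: "0 < \<delta>" "fibre_Ck a b \<delta> (n + 1) (\<lambda>s \<eta>. Log_S2 (\<gamma> s) (\<gamma> (s + \<eta>)))"
    by (rule fibre_Ck_log)
  show ?thesis
    unfolding jet_def by (rule uniform_fibre_taylor(1)[OF ab \<delta> assms])
qed

lemma jet_orthogonal:
  assumes "k \<le> n + 1" "s \<in> {a..b}"
  shows "jet k s \<bullet> \<gamma> s = 0"
proof -
  obtain \<delta> where \<delta>: "0 < \<delta>" "fibre_Ck a b \<delta> (n + 1) (\<lambda>s \<eta>. Log_S2 (\<gamma> s) (\<gamma> (s + \<eta>)))"
    by (rule fibre_Ck_log)
  show ?thesis
    unfolding jet_def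
  proof (rule uniform_fibre_taylor(3)[OF ab \<delta> assms])
    show "Log_S2 (\<gamma> s) (\<gamma> (s + \<eta>)) \<bullet> \<gamma> s = 0" for \<eta>
      using inner_sph_log[OF norm_curve[OF assms(2)]]
      by (simp add: Log_S2_eq_sph_log inner_commute)
  qed
qed

lemma jet_expansion:
  assumes "0 < \<epsilon>"
  shows "\<exists>d>0. \<forall>s\<in>{a..b}. \<forall>\<eta>. s + \<eta> \<in> {a..b} \<longrightarrow> \<bar>\<eta>\<bar> < d \<longrightarrow>
      norm (Log_S2 (\<gamma> s) (\<gamma> (s + \<eta>)) - taylor_curve (normal_jet (n + 1) \<gamma> a b s) \<eta>)
        \<le> \<epsilon> * \<bar>\<eta>\<bar> ^ (n + 1)"
proof -
  obtain \<delta> where \<delta>: "0 < \<delta>" "fibre_Ck a b \<delta> (n + 1) (\<lambda>s \<eta>. Log_S2 (\<gamma> s) (\<gamma> (s + \<eta>)))"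
    by (rule fibre_Ck_log)
  have "(\<Sum>k\<le>n + 1. (\<eta> ^ k / fact k) *\<^sub>R jet k s) =
      taylor_curve (normal_jet (n + 1) \<gamma> a b s) \<eta>" if "s \<in> {a..b}" for s \<eta>
  proof -
    have "jet 0 s = 0"
      using norm_curve[OF that]
      by (simp add: jet_def Log_S2_eq_sph_log sph_log_def flip: power2_norm_eq_inner)
    moreover have "(\<Sum>k\<le>Suc n. (\<eta> ^ k / fact k) *\<^sub>R jet k s) =
        (\<eta> ^ 0 / fact 0) *\<^sub>R jet 0 s + (\<Sum>k\<le>n. (\<eta> ^ Suc k / fact (Suc k)) *\<^sub>R jet (Suc k) s)"
      by (rule sum.atMost_Suc_shift)
    moreover have "taylor_curve (normal_jet (n + 1) \<gamma> a b s) \<eta> =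
        (\<Sum>k\<le>n. (\<eta> ^ Suc k / fact (Suc k)) *\<^sub>R jet (Suc k) s)"
      using taylor_curve_normal_jet[of s \<eta>]
      unfolding Suc_eq_plus1[symmetric] lessThan_Suc_atMost .
    ultimately show ?thesis
      unfolding Suc_eq_plus1[symmetric] by (simp only: scaleR_zero_right add_0_left)
  qed
  with uniform_fibre_taylor(2)[OF ab \<delta> assms, folded jet_def] show ?thesis by simp
qed

text \<open>A datum \<open>(f, s, v, t)\<close> stands for base point \<open>s\<close>, stencil position \<open>v = \<theta> - i\<close> and step \<open>t\<close>;
  the flag \<open>f\<close> selects the given curve (whose stencil has to fit into \<open>[a, b]\<close>) or the model curve
  with the same jet.\<close>

definition data :: "(bool \<times> real \<times> real \<times> real) set" where
  "data = {(f, s, v, t). s \<in> {a..b} \<and> 0 \<le> v \<and> v \<le> real n \<and>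
     (f \<longrightarrow> a \<le> s - v * t \<and> s + (real n - v) * t \<le> b)}"

definition data_filter :: "(bool \<times> real \<times> real \<times> real) filter" where
  "data_filter = inf (filtercomap (\<lambda>(f, s, v, t). t) (at_right 0)) (principal data)"

definition normal_point :: "int \<Rightarrow> bool \<times> real \<times> real \<times> real \<Rightarrow> vec3" where
  "normal_point l = (\<lambda>(f, s, v, t). if f then Log_S2 (\<gamma> s) (\<gamma> (s + (of_int l - v) * t))
     else taylor_curve (normal_jet (n + 1) \<gamma> a b s) ((of_int l - v) * t))"

text \<open>One threshold for the step works for both flags, all base points and all admissible
  positions; this is the uniformity claimed in the end.\<close>

lemma eventually_data_filter:
  "eventually P data_filter \<longleftrightarrow>
     (\<exists>\<delta>>0. \<forall>f s v t. (f, s, v, t) \<in> data \<longrightarrow> 0 < t \<longrightarrow> t < \<delta> \<longrightarrow> P (f, s, v, t))"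
proof
  assume "eventually P data_filter"
  then obtain Q where "eventually Q (at_right 0)" "\<And>f s v t. Q t \<Longrightarrow> (f, s, v, t) \<in> data \<Longrightarrow> P (f, s, v, t)"
    unfolding data_filter_def eventually_inf_principal eventually_filtercomap by fastforce
  then show "\<exists>\<delta>>0. \<forall>f s v t. (f, s, v, t) \<in> data \<longrightarrow> 0 < t \<longrightarrow> t < \<delta> \<longrightarrow> P (f, s, v, t)"
    unfolding eventually_at_right_field by blast
next
  assume "\<exists>\<delta>>0. \<forall>f s v t. (f, s, v, t) \<in> data \<longrightarrow> 0 < t \<longrightarrow> t < \<delta> \<longrightarrow> P (f, s, v, t)"
  then obtain \<delta> where \<delta>: "0 < \<delta>"
    "\<And>f s v t. (f, s, v, t) \<in> data \<Longrightarrow> 0 < t \<Longrightarrow> t < \<delta> \<Longrightarrow> P (f, s, v, t)" by blast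
  have "\<forall>\<^sub>F t in at_right 0. 0 < t \<and> t < \<delta>"
    unfolding eventually_at_right_field using \<delta>(1) by blast
  then show "eventually P data_filter"
    unfolding data_filter_def eventually_inf_principal eventually_filtercomap
    by (intro exI[of _ "\<lambda>t. 0 < t \<and> t < \<delta>"] conjI) (use \<delta>(2) in auto)
qed

sublocale data: stencil_regime data_filter "{a..b}" "\<lambda>(f, s, v, t). s" "\<lambda>(f, s, v, t). v"
  "\<lambda>(f, s, v, t). t" "n + 1" "real n"
proof
  show "\<forall>\<^sub>F x in data_filter. (case x of (f, s, v, t) \<Rightarrow> s) \<in> {a..b}"
    and "\<forall>\<^sub>F x in data_filter. \<bar>case x of (f, s, v, t) \<Rightarrow> v\<bar> \<le> real n"
    by (auto simp: eventually_data_filter data_def intro!: exI[of _ 1])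
  show "filterlim (\<lambda>(f, s, v, t). t) (at_right 0) data_filter"
    unfolding data_filter_def
    by (rule filterlim_mono[OF filterlim_filtercomap order_refl inf_le1])
  show "2 \<le> n + 1" using n by simp
qed

lemma normal_point_expansion:
  assumes l: "l \<in> {0..int n}"
  shows "data.negl (\<lambda>x. normal_point l x - (case x of (f, s, v, t) \<Rightarrow>
     taylor_curve (normal_jet (n + 1) \<gamma> a b s) ((of_int l - v) * t)))"
  unfolding data.negl_def
proof (intro allI impI)
  fix \<epsilon> :: real assume \<epsilon>: "0 < \<epsilon>"
  have n0: "0 < real n" using n by simp
  \<comment> \<open>A node may lie up to n steps from the base point, so its offset to the power n +
    1 can contribute a factor n^(n+1).\<close>
  from \<epsilon> n0 have "0 < \<epsilon> / real n ^ (n + 1)" by simp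
  from jet_expansion[OF this] obtain d where d: "0 < d" "\<And>s \<eta>. s \<in> {a..b} \<Longrightarrow> s + \<eta> \<in> {a..b} \<Longrightarrow> \<bar>\<eta>\<bar> < d \<Longrightarrow>
      norm (Log_S2 (\<gamma> s) (\<gamma> (s + \<eta>)) - taylor_curve (normal_jet (n + 1) \<gamma> a b s) \<eta>)
        \<le> \<epsilon> / real n ^ (n + 1) * \<bar>\<eta>\<bar> ^ (n + 1)"
    by blast
  have "norm (normal_point l (f, s, v, t) - taylor_curve (normal_jet (n + 1) \<gamma> a b s) ((of_int l - v) * t))
      \<le> \<epsilon> * t ^ (n + 1)"
    if x: "(f, s, v, t) \<in> data" and t: "0 < t" "t < d / real n" for f s v t
  proof (cases f)
    case True
    define \<eta> where "\<eta> = (of_int l - v) * t"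
    have v: "0 \<le> v" "v \<le> real n" and s: "s \<in> {a..b}" and fit: "a \<le> s - v * t" "s + (real n - v) * t \<le> b"
      using x True by (auto simp: data_def)
    have lr: "0 \<le> real_of_int l" "real_of_int l \<le> real n" using l by auto
    have \<eta>_le: "\<bar>\<eta>\<bar> \<le> real n * t"
      unfolding \<eta>_def abs_mult using v lr t by (intro mult_mono) auto
    have "(0 - v) * t \<le> \<eta>" "\<eta> \<le> (real n - v) * t"
      unfolding \<eta>_def by (rule mult_right_mono, use lr t in auto)+
    then have "s + \<eta> \<in> {a..b}" using fit by simp
    moreover have "\<bar>\<eta>\<bar> < d" using \<eta>_le t n0 by (simp add: field_simps)
    ultimately have "norm (Log_S2 (\<gamma> s) (\<gamma> (s + \<eta>)) - taylor_curve (normal_jet (n + 1) \<gamma> a b s) \<eta>)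
        \<le> \<epsilon> / real n ^ (n + 1) * \<bar>\<eta>\<bar> ^ (n + 1)"
      by (rule d(2)[OF s])
    also have "\<dots> \<le> \<epsilon> / real n ^ (n + 1) * (real n * t) ^ (n + 1)"
      using \<eta>_le \<epsilon> by (intro mult_left_mono power_mono) auto
    also have "\<dots> = \<epsilon> * t ^ (n + 1)"
      using n0 unfolding power_mult_distrib by simp
    finally show ?thesis using True by (simp add: normal_point_def \<eta>_def)
  qed (use \<epsilon> t in \<open>simp add: normal_point_def\<close>)
  then show "\<forall>\<^sub>F x in data_filter. norm (normal_point l x - (case x of (f, s, v, t) \<Rightarrow>
      taylor_curve (normal_jet (n + 1) \<gamma> a b s) ((of_int l - v) * t))) \<le> \<epsilon> * (case x of (f, s, v, t) \<Rightarrow> t) ^ (n + 1)"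
    unfolding eventually_data_filter using d(1) n0 by (intro exI[of _ "d / real n"]) auto
qed

definition node :: "int \<Rightarrow> bool \<times> real \<times> real \<times> real \<Rightarrow> real \<times> vec3" where
  "node l x = sph_exp (1, 0) (0, normal_point l x)"

lemma reg_node: "data.reg {0..int n} 0 node"
  unfolding node_def
proof (rule data.reg_sph_exp[where J = "\<lambda>k s. (0, jet k s)"])
  show "bounded ((\<lambda>s. (0 :: real, jet (Suc k) s)) ` {a..b})" if "k < n + 1" for k
  proof -
    have "bounded (jet (Suc k) ` {a..b})" using that by (intro bounded_jet) auto
    then show ?thesis by (simp add: bounded_iff)
  qed
  fix l assume "l \<in> {0..int n}"
  from normal_point_expansion[OF this]
  show "data.negl (\<lambda>x. (0 :: real, normal_point l x) - (\<Sum>k<n + 1.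
      (((of_int l - (case x of (f, s, v, t) \<Rightarrow> v)) * (case x of (f, s, v, t) \<Rightarrow> t)) ^ Suc k / fact (Suc k)) *\<^sub>R
      (0, jet (Suc k) (case x of (f, s, v, t) \<Rightarrow> s))))"
  proof (rule data.negl_le[where C = 1], intro always_eventually allI)
    fix x :: "bool \<times> real \<times> real \<times> real"
    obtain f s v t where x: "x = (f, s, v, t)" by (cases x)
    have "(\<Sum>k<n + 1. (((of_int l - v) * t) ^ Suc k / fact (Suc k)) *\<^sub>R (0 :: real, jet (Suc k) s)) =
        (0, taylor_curve (normal_jet (n + 1) \<gamma> a b s) ((of_int l - v) * t))"
      unfolding taylor_curve_normal_jet
      by (rule prod_eqI) (simp_all add: fst_sum snd_sum del: sum.lessThan_Suc power_Suc fact_Suc)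
    then show "norm ((0, normal_point l x) - (\<Sum>k<n + 1.
        (((of_int l - (case x of (f, s, v, t) \<Rightarrow> v)) * (case x of (f, s, v, t) \<Rightarrow> t)) ^ Suc k / fact (Suc k)) *\<^sub>R
        (0 :: real, jet (Suc k) (case x of (f, s, v, t) \<Rightarrow> s)))) \<le> 1 * norm (normal_point l x -
        (case x of (f, s, v, t) \<Rightarrow> taylor_curve (normal_jet (n + 1) \<gamma> a b s) ((of_int l - v) * t)))"
      unfolding x by simp
  qed
qed

sublocale model: model_regime data_filter "{a..b}" "\<lambda>(f, s, v, t). s" "\<lambda>(f, s, v, t). v"
  "\<lambda>(f, s, v, t). t" "n + 1" "real n" node n "(1, 0)" "\<lambda>s v t. (False, s, v, t)"
proof
  show "2 \<le> n" by (rule n)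
  show "data.reg {0..int n} 0 node" by (rule reg_node)
  show "\<forall>\<^sub>F x in data_filter. norm (node l x) = 1" for l
    by (rule always_eventually) (simp add: node_def norm_sph_exp)
  show "\<forall>\<^sub>F x in data_filter. 0 \<le> (case x of (f, s, v, t) \<Rightarrow> v) \<and> (case x of (f, s, v, t) \<Rightarrow> v) \<le> real n"
    by (auto simp: eventually_data_filter data_def intro!: exI[of _ 1])
  show "filterlim (\<lambda>t. (False, s, v, t)) data_filter (at_right 0)"
    if "s \<in> {a..b}" "0 \<le> v" "v \<le> real n" for s v
    unfolding data_filter_def filterlim_inf filterlim_filtercomap_iff filterlim_principal
    using that by (auto simp: data_def o_def filterlim_ident)
  \<comment> \<open>At position v = l the l-th model node has offset 0, where the Taylor curve
    vanishes.\<close>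
  show "node (int l) (False, s, real l, t) = (1, 0)" for l s t
    by (simp add: node_def normal_point_def taylor_curve_def flip: zero_prod_def)
qed simp_all

text \<open>The coefficient is a limit along the model curve, which is built from the jet alone;
  uniqueness of limits therefore identifies it with \<open>sider_coefficient\<close>.\<close>

lemma model_coefficient:
  assumes A: "data.negl (\<lambda>x. sph_sider (\<lambda>j. node j x) n 0 (case x of (f, s, v, t) \<Rightarrow> v) - (1, 0) -
       ((case x of (f, s, v, t) \<Rightarrow> t) ^ Suc n * (\<Prod>l\<le>n. (case x of (f, s, v, t) \<Rightarrow> v) - real l)) *\<^sub>R
       A (case x of (f, s, v, t) \<Rightarrow> s))"
    and s: "s \<in> {a..b}"
  shows "A s = sider_coefficient n (normal_jet (n + 1) \<gamma> a b s)" and "snd (A s) \<bullet> \<gamma> s = 0"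
proof -
  let ?L = "normal_jet (n + 1) \<gamma> a b s"
  define g where "g t = (1 / (t ^ Suc n * (\<Prod>l\<le>n. 1 / 2 - real l))) *\<^sub>R
     (sph_sider (\<lambda>l. model_point ?L ((of_int l - 1 / 2) * t)) n 0 (1 / 2) - (1, 0))" for t
  have "(1 / 2 :: real) - real l \<noteq> 0" for l
  proof
    assume "1 / 2 - real l = 0"
    then have "real (2 * l) = real 1" by simp
    then show False unfolding of_nat_eq_iff by presburger
  qed
  then have pi: "(\<Prod>l\<le>n. 1 / 2 - real l) \<noteq> 0" by simp
  have lim: "(g \<longlongrightarrow> A s) (at_right 0)"
    using model.sider_coefficient_limit[OF A s _ _ pi] n
    by (simp add: g_def[abs_def] node_def normal_point_def model_point_def)
  then show "A s = sider_coefficient n ?L"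
    unfolding sider_coefficient_def g_def[symmetric]
    by (intro tendsto_Lim[symmetric] trivial_limit_at_right_real)
  \<comment> \<open>The jet is orthogonal to the base point, so the model points lie in
    \<open>V\<close>. The construction preserves subspaces, and \<open>V\<close> is closed, so the
    limit stays tangential.\<close>
  define V where "V = {x :: real \<times> vec3. snd x \<bullet> \<gamma> s = 0}"
  have V: "subspace V"
    by (auto simp: V_def subspace_def inner_add_left)
  have "closed V"
    unfolding V_def by (intro closed_Collect_eq continuous_intros)
  have "jet (Suc k) s \<bullet> \<gamma> s = 0" if "k < n + 1" for k
    using s that by (intro jet_orthogonal) auto
  then have "model_point ?L \<eta> \<in> V" for \<eta>
    unfolding V_def model_point_def sph_exp_def taylor_curve_normal_jet
    by (simp add: inner_sum_left del: sum.lessThan_Suc power_Suc fact_Suc)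
  then have "g t \<in> V" for t
    unfolding g_def using n
    by (intro subspace_scale[OF V] subspace_diff[OF V] sph_sider_in_subspace V) (auto simp: V_def)
  then have "A s \<in> V"
    by (intro Lim_in_closed_set[OF \<open>closed V\<close> _ _ lim]) auto
  then show "snd (A s) \<bullet> \<gamma> s = 0" by (simp add: V_def)
qed

end

section \<open>Transfer of the expansion to the given samples\<close>

lemma norm_snd_le_norm: "norm (snd x) \<le> norm x"
  by (cases x) (simp add: norm_snd_le)

lemma prod_stencil_nodes:
  "(\<Prod>j\<in>{i..i + int n}. \<theta> - of_int j) = (\<Prod>l\<le>n. (\<theta> - of_int i) - real l)"
  by (rule prod.reindex_bij_witness[where i = "\<lambda>l. i + int l" and j = "\<lambda>j. nat (j - i)"]) auto

context sphere_curve
begin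

lemma stencil_range:
  assumes "0 < h" "stencil_in n a b h i" "of_int i \<le> \<theta>" "\<theta> \<le> of_int (i + int n)"
  shows "\<theta> * h \<in> {a..b}"
proof -
  have "of_int i * h \<le> \<theta> * h" "\<theta> * h \<le> of_int (i + int n) * h"
    using assms by (auto intro!: mult_right_mono simp del: of_int_add)
  then show ?thesis using assms(2) by (auto simp: stencil_in_def)
qed

text \<open>Shifting the indices by \<open>i\<close> and applying the isometry \<open>lift\<close>
  turn the actual stencil into the datum with flag \<open>True\<close>. The bound on
  \<open>n h\<close> keeps all nodes in the region where the logarithm is inverted by the
  exponential.\<close>

lemma sider_node:
  assumes \<delta>: "\<And>s t. s \<in> {a..b} \<Longrightarrow> t \<in> {a..b} \<Longrightarrow> \<bar>t - s\<bar> < \<delta> \<Longrightarrow> 0 < \<gamma> s \<bullet> \<gamma> t"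
    and h: "0 < h" "real n * h < \<delta>" and st: "stencil_in n a b h i"
    and \<theta>: "of_int i \<le> \<theta>" "\<theta> \<le> of_int (i + int n)"
  shows "sph_sider (\<lambda>j. node j (True, \<theta> * h, \<theta> - of_int i, h)) n 0 (\<theta> - of_int i) =
      lift (\<gamma> (\<theta> * h)) (sider (samples \<gamma> h) n i \<theta>)"
proof -
  have i: "a \<le> of_int i * h" "of_int (i + int n) * h \<le> b" using st by (auto simp: stencil_in_def)
  have s: "\<theta> * h \<in> {a..b}" using h(1) st \<theta> by (rule stencil_range)
  have node: "node j (True, \<theta> * h, \<theta> - of_int i, h) = lift (\<gamma> (\<theta> * h)) (samples \<gamma> h (j + i))"
    if j: "0 \<le> j" "j \<le> 0 + int n" for j
  proof -
    have eq: "\<theta> * h + (of_int j - (\<theta> - of_int i)) * h = of_int (j + i) * h"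
      by (simp add: algebra_simps)
    have "of_int i * h \<le> of_int (j + i) * h" "of_int (j + i) * h \<le> of_int (i + int n) * h"
      using j h by (auto intro!: mult_right_mono simp del: of_int_add)
    then have t: "of_int (j + i) * h \<in> {a..b}" using i by simp
    have jr: "0 \<le> real_of_int j" "real_of_int j \<le> real n" using j by auto
    have "\<bar>of_int (j + i) * h - \<theta> * h\<bar> = \<bar>of_int (j + i) - \<theta>\<bar> * h"
      using h by (simp add: abs_mult flip: left_diff_distrib)
    also have "\<dots> \<le> real n * h"
      using jr \<theta> h by (intro mult_right_mono) auto
    finally have "0 < \<gamma> (\<theta> * h) \<bullet> \<gamma> (of_int (j + i) * h)"
      using h by (intro \<delta>[OF s t]) simp
    then show ?thesis
      using lift_eq_sph_exp[OF norm_curve[OF s] norm_curve[OF t]]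
      by (simp add: node_def normal_point_def eq samples_def del: of_int_add)
  qed
  have "sph_sider (\<lambda>j. node j (True, \<theta> * h, \<theta> - of_int i, h)) n 0 (\<theta> - of_int i) =
      sph_sider (\<lambda>j. lift (\<gamma> (\<theta> * h)) (samples \<gamma> h (j + i))) n 0 (\<theta> - of_int i)"
    by (rule sph_sider_cong[OF n node])
  also have "\<dots> = lift (\<gamma> (\<theta> * h)) (sph_sider (\<lambda>j. samples \<gamma> h (j + i)) n 0 (\<theta> - of_int i))"
    by (rule sph_sider_isometry[OF linear_lift inner_lift[OF norm_curve[OF s]] n])
  also have "sph_sider (\<lambda>j. samples \<gamma> h (j + i)) n 0 (\<theta> - of_int i) = sider (samples \<gamma> h) n i \<theta>"
    using sph_sider_translate[OF n, of "samples \<gamma> h" i 0 "\<theta> - of_int i"] n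
    by (simp add: sider_eq_sph_sider)
  finally show "sph_sider (\<lambda>j. node j (True, \<theta> * h, \<theta> - of_int i, h)) n 0 (\<theta> - of_int i) =
      lift (\<gamma> (\<theta> * h)) (sider (samples \<gamma> h) n i \<theta>)" .
qed

text \<open>The joint expansion is evaluated at data of the given curve, while its coefficient
  \<open>A\<close> is identified through the model data.\<close>

lemma uniform_expansion:
  obtains A B where "\<And>s. s \<in> {a..b} \<Longrightarrow> A s = sider_coefficient n (normal_jet (n + 1) \<gamma> a b s)"
    "\<And>s. s \<in> {a..b} \<Longrightarrow> snd (A s) \<bullet> \<gamma> s = 0" "\<And>s. s \<in> {a..b} \<Longrightarrow> norm (A s) \<le> B"
    "\<And>\<epsilon>. 0 < \<epsilon> \<Longrightarrow> \<exists>\<delta>>0. \<forall>h i \<theta>. 0 < h \<longrightarrow> h < \<delta> \<longrightarrow> stencil_in n a b h i \<longrightarrow>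
       of_int i \<le> \<theta> \<longrightarrow> \<theta> \<le> of_int (i + int n) \<longrightarrow>
       norm (lift (\<gamma> (\<theta> * h)) (sider (samples \<gamma> h) n i \<theta>) - (1, 0) -
         (h ^ (n + 1) * (\<Prod>j\<in>{i..i + int n}. \<theta> - of_int j)) *\<^sub>R A (\<theta> * h)) \<le> \<epsilon> * h ^ (n + 1)"
proof -
  obtain A where A: "bounded (A ` {a..b})"
    "data.negl (\<lambda>x. sph_sider (\<lambda>j. node j x) n 0 (case x of (f, s, v, t) \<Rightarrow> v) - (1, 0) -
       ((case x of (f, s, v, t) \<Rightarrow> t) ^ Suc n * (\<Prod>l\<le>n. (case x of (f, s, v, t) \<Rightarrow> v) - real l)) *\<^sub>R
       A (case x of (f, s, v, t) \<Rightarrow> s))"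
    by (rule model.sider_expansion)
  obtain B where B: "\<And>s. s \<in> {a..b} \<Longrightarrow> norm (A s) \<le> B"
    using A(1) unfolding bounded_iff by blast
  obtain \<rho> where \<rho>: "0 < \<rho>"
    "\<And>s t. s \<in> {a..b} \<Longrightarrow> t \<in> {a..b} \<Longrightarrow> \<bar>t - s\<bar> < \<rho> \<Longrightarrow> 0 < \<gamma> s \<bullet> \<gamma> t"
    using curve_inner_pos by metis
  have n0: "0 < real n" using n by simp
  show thesis
  proof (rule that[OF model_coefficient[OF A(2)] B])
    fix \<epsilon> :: real assume "0 < \<epsilon>"
    with A(2) have "\<forall>\<^sub>F x in data_filter. norm (sph_sider (\<lambda>j. node j x) n 0 (case x of (f, s, v, t) \<Rightarrow> v) - (1, 0) -
       ((case x of (f, s, v, t) \<Rightarrow> t) ^ Suc n * (\<Prod>l\<le>n. (case x of (f, s, v, t) \<Rightarrow> v) - real l)) *\<^sub>R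
       A (case x of (f, s, v, t) \<Rightarrow> s)) \<le> \<epsilon> * (case x of (f, s, v, t) \<Rightarrow> t) ^ (n + 1)"
      unfolding data.negl_def by blast
    then obtain d where d: "0 < d" "\<And>f s v t. (f, s, v, t) \<in> data \<Longrightarrow> 0 < t \<Longrightarrow> t < d \<Longrightarrow>
        norm (sph_sider (\<lambda>j. node j (f, s, v, t)) n 0 v - (1, 0) -
          (t ^ Suc n * (\<Prod>l\<le>n. v - real l)) *\<^sub>R A s) \<le> \<epsilon> * t ^ (n + 1)"
      unfolding eventually_data_filter by fastforce
    define \<delta> where "\<delta> = min d (\<rho> / real n)"
    have "norm (lift (\<gamma> (\<theta> * h)) (sider (samples \<gamma> h) n i \<theta>) - (1, 0) -
         (h ^ (n + 1) * (\<Prod>j\<in>{i..i + int n}. \<theta> - of_int j)) *\<^sub>R A (\<theta> * h)) \<le> \<epsilon> * h ^ (n + 1)"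
      if h: "0 < h" "h < \<delta>" and st: "stencil_in n a b h i"
        and \<theta>: "of_int i \<le> \<theta>" "\<theta> \<le> of_int (i + int n)" for h i \<theta>
    proof -
      have nh: "real n * h < \<rho>" using h(2) n0 by (simp add: \<delta>_def field_simps)
      have sn1: "\<theta> * h \<in> {a..b}"
        using h(1) st \<theta> by (rule stencil_range)
      have sn2: "sph_sider (\<lambda>j. node j (True, \<theta> * h, \<theta> - of_int i, h)) n 0 (\<theta> - of_int i) =
          lift (\<gamma> (\<theta> * h)) (sider (samples \<gamma> h) n i \<theta>)"
        by (rule sider_node[OF \<rho>(2) h(1) nh st \<theta>])
      have "(True, \<theta> * h, \<theta> - of_int i, h) \<in> data"
        using sn1 \<theta> st by (auto simp: data_def stencil_in_def algebra_simps)
      from d(2)[OF this h(1)] h(2)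
      have "norm (sph_sider (\<lambda>j. node j (True, \<theta> * h, \<theta> - of_int i, h)) n 0 (\<theta> - of_int i) - (1, 0) -
          (h ^ Suc n * (\<Prod>l\<le>n. \<theta> - of_int i - real l)) *\<^sub>R A (\<theta> * h)) \<le> \<epsilon> * h ^ (n + 1)"
        by (simp add: \<delta>_def)
      then show ?thesis unfolding sn2 prod_stencil_nodes by simp
    qed
    moreover have "0 < \<delta>" using d(1) \<rho>(1) n0 by (simp add: \<delta>_def)
    ultimately show "\<exists>\<delta>>0. \<forall>h i \<theta>. 0 < h \<longrightarrow> h < \<delta> \<longrightarrow> stencil_in n a b h i \<longrightarrow>
       of_int i \<le> \<theta> \<longrightarrow> \<theta> \<le> of_int (i + int n) \<longrightarrow>
       norm (lift (\<gamma> (\<theta> * h)) (sider (samples \<gamma> h) n i \<theta>) - (1, 0) -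
         (h ^ (n + 1) * (\<Prod>j\<in>{i..i + int n}. \<theta> - of_int j)) *\<^sub>R A (\<theta> * h)) \<le> \<epsilon> * h ^ (n + 1)"
      by blast
  qed
qed

lemma norm_sider_samples:
  assumes "0 < h" "stencil_in n a b h i"
  shows "norm (sider (samples \<gamma> h) n i \<theta>) = 1"
  unfolding sider_eq_sph_sider[OF n]
proof (rule norm_sph_sider[OF n])
  fix j assume j: "i \<le> j" "j \<le> i + int n"
  have "of_int i * h \<le> of_int j * h" "of_int j * h \<le> of_int (i + int n) * h"
    using j assms(1) by (auto intro!: mult_right_mono simp del: of_int_add)
  then have "of_int j * h \<in> {a..b}" using assms(2) by (auto simp: stencil_in_def)
  then show "norm (samples \<gamma> h j) = 1" by (simp add: samples_def norm_curve)
qed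

lemma abs_stencil_prod_le:
  assumes "of_int i \<le> \<theta>" "\<theta> \<le> of_int (i + int n)"
  shows "\<bar>\<Prod>j\<in>{i..i + int n}. \<theta> - of_int j\<bar> \<le> real n ^ (n + 1)"
proof -
  have "\<bar>\<Prod>l\<le>n. (\<theta> - of_int i) - real l\<bar> = (\<Prod>l\<le>n. \<bar>(\<theta> - of_int i) - real l\<bar>)"
    by (rule abs_prod)
  also have "\<dots> \<le> (\<Prod>l\<le>n. real n)" using assms by (intro prod_mono) auto
  finally show ?thesis by (simp add: prod_stencil_nodes)
qed

lemma sider_error:
  obtains A B d where "0 \<le> B" "0 < d"
    "\<And>s. s \<in> {a..b} \<Longrightarrow> A s = snd (sider_coefficient n (normal_jet (n + 1) \<gamma> a b s))"
    "\<And>s. s \<in> {a..b} \<Longrightarrow> A s \<bullet> \<gamma> s = 0"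
    "\<And>h i \<theta>. 0 < h \<Longrightarrow> h < d \<Longrightarrow> stencil_in n a b h i \<Longrightarrow> of_int i \<le> \<theta> \<Longrightarrow>
       \<theta> \<le> of_int (i + int n) \<Longrightarrow>
       dist_S2 (\<gamma> (\<theta> * h)) (sider (samples \<gamma> h) n i \<theta>) \<le> B * h ^ (n + 1)"
    "\<And>\<epsilon>. 0 < \<epsilon> \<Longrightarrow> \<exists>\<delta>>0. \<forall>h i \<theta>. 0 < h \<longrightarrow> h < \<delta> \<longrightarrow> stencil_in n a b h i \<longrightarrow>
       of_int i \<le> \<theta> \<longrightarrow> \<theta> \<le> of_int (i + int n) \<longrightarrow>
       norm (Log_S2 (\<gamma> (\<theta> * h)) (sider (samples \<gamma> h) n i \<theta>) -
         (h ^ (n + 1) * (\<Prod>j\<in>{i..i + int n}. \<theta> - of_int j)) *\<^sub>R A (\<theta> * h)) \<le> \<epsilon> * h ^ (n + 1)"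
proof -
  obtain A B where A: "\<And>s. s \<in> {a..b} \<Longrightarrow> A s = sider_coefficient n (normal_jet (n + 1) \<gamma> a b s)"
    "\<And>s. s \<in> {a..b} \<Longrightarrow> snd (A s) \<bullet> \<gamma> s = 0" "\<And>s. s \<in> {a..b} \<Longrightarrow> norm (A s) \<le> B"
    and exp: "\<And>\<epsilon>. 0 < \<epsilon> \<Longrightarrow> \<exists>\<delta>>0. \<forall>h i \<theta>. 0 < h \<longrightarrow> h < \<delta> \<longrightarrow> stencil_in n a b h i \<longrightarrow>
       of_int i \<le> \<theta> \<longrightarrow> \<theta> \<le> of_int (i + int n) \<longrightarrow>
       norm (lift (\<gamma> (\<theta> * h)) (sider (samples \<gamma> h) n i \<theta>) - (1, 0) -
         (h ^ (n + 1) * (\<Prod>j\<in>{i..i + int n}. \<theta> - of_int j)) *\<^sub>R A (\<theta> * h)) \<le> \<epsilon> * h ^ (n + 1)"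
    by (rule uniform_expansion) blast
  obtain C where C: "0 \<le> C" "\<And>c. 1 / 2 \<le> c \<Longrightarrow> c \<le> 1 \<Longrightarrow> \<bar>log_factor c - 1\<bar> \<le> C * (1 - c)"
    using log_factor_near_1 by blast
  \<comment> \<open>\<open>K h^(n+1)\<close> bounds the lifted deviation from the base point: 1
    comes from the remainder with \<open>\<epsilon>\<close> = 1, the other summand from the leading
    term, whose product has n + 1 factors of size at most n.\<close>
  define K where "K = 1 + real n ^ (n + 1) * B"
  have "a \<in> {a..b}" using ab by simp
  then have B0: "0 \<le> B" using A(3) norm_ge_zero order_trans by blast
  have K1: "1 \<le> K" using B0 by (simp add: K_def)
  obtain d0 where d0: "0 < d0" "\<And>h i \<theta>. 0 < h \<Longrightarrow> h < d0 \<Longrightarrow> stencil_in n a b h i \<Longrightarrow> of_int i \<le> \<theta> \<Longrightarrow>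
       \<theta> \<le> of_int (i + int n) \<Longrightarrow>
       norm (lift (\<gamma> (\<theta> * h)) (sider (samples \<gamma> h) n i \<theta>) - (1, 0) -
         (h ^ (n + 1) * (\<Prod>j\<in>{i..i + int n}. \<theta> - of_int j)) *\<^sub>R A (\<theta> * h)) \<le> 1 * h ^ (n + 1)"
    using exp[of 1] by auto
  \<comment> \<open>Chosen so that K h < 1; since K is at least 1 this also gives h at most
    1.\<close>
  define d where "d = min d0 (1 / K)"
  have d_pos: "0 < d" using d0(1) K1 by (simp add: d_def)
  text \<open>The deviation \<open>P - y\<close> is of order \<open>h ^ (n + 1)\<close>, so \<open>Log\<close> differs from the projection of
    \<open>P\<close> to the tangent plane by a factor \<open>1 + O(h)\<close> only.\<close>
  have near: "\<theta> * h \<in> {a..b} \<and>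
      norm (snd (lift (\<gamma> (\<theta> * h)) (sider (samples \<gamma> h) n i \<theta>))) \<le> K * h ^ (n + 1) \<and>
      0 < \<gamma> (\<theta> * h) \<bullet> sider (samples \<gamma> h) n i \<theta> \<and>
      Log_S2 (\<gamma> (\<theta> * h)) (sider (samples \<gamma> h) n i \<theta>) =
        log_factor (\<gamma> (\<theta> * h) \<bullet> sider (samples \<gamma> h) n i \<theta>) *\<^sub>R
        snd (lift (\<gamma> (\<theta> * h)) (sider (samples \<gamma> h) n i \<theta>)) \<and>
      \<bar>log_factor (\<gamma> (\<theta> * h) \<bullet> sider (samples \<gamma> h) n i \<theta>) - 1\<bar> \<le> C * (K * h)"
    if h: "0 < h" "h < d" and st: "stencil_in n a b h i"
      and \<theta>: "of_int i \<le> \<theta>" "\<theta> \<le> of_int (i + int n)" for h i \<theta>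
  proof -
    let ?y = "\<gamma> (\<theta> * h)" and ?P = "sider (samples \<gamma> h) n i \<theta>"
    define E where "E = (h ^ (n + 1) * (\<Prod>j\<in>{i..i + int n}. \<theta> - of_int j)) *\<^sub>R A (\<theta> * h)"
    have s: "\<theta> * h \<in> {a..b}" using h(1) st \<theta> by (rule stencil_range)
    have y: "norm ?y = 1" using s by (rule norm_curve)
    have P: "norm ?P = 1" using h(1) st by (rule norm_sider_samples)
    have "norm E = h ^ (n + 1) * (\<bar>\<Prod>j\<in>{i..i + int n}. \<theta> - of_int j\<bar> * norm (A (\<theta> * h)))"
      using h by (simp add: E_def abs_mult)
    also have "\<dots> \<le> h ^ (n + 1) * (real n ^ (n + 1) * B)"
      using h A(3)[OF s] abs_stencil_prod_le[OF \<theta>] by (intro mult_left_mono mult_mono) auto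
    finally have "norm E \<le> h ^ (n + 1) * (real n ^ (n + 1) * B)" .
    moreover have "norm (lift ?y ?P - (1, 0) - E) \<le> 1 * h ^ (n + 1)"
      using h unfolding E_def by (intro d0(2) st \<theta>) (auto simp: d_def)
    moreover have "norm (lift ?y ?P - (1, 0)) \<le> norm (lift ?y ?P - (1, 0) - E) + norm E"
      by (metis diff_add_cancel norm_triangle_ineq)
    ultimately have dev: "norm (lift ?y ?P - (1, 0)) \<le> K * h ^ (n + 1)"
      by (simp add: K_def algebra_simps)
    have "lift ?y ?P - (1, 0) = lift ?y (?P - ?y)"
      using linear_diff[OF linear_lift, of ?y ?P ?y] lift_base[OF y] by simp
    then have dist: "norm (?P - ?y) \<le> K * h ^ (n + 1)" using dev norm_lift[OF y] by simp
    have Kh: "K * h < 1" using h K1 by (simp add: d_def field_simps)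
    then have "h \<le> 1" using mult_right_mono[OF K1 less_imp_le[OF h(1)]] by simp
    then have "h ^ (n + 1) \<le> h ^ 1" using h by (intro power_decreasing) auto
    then have le: "norm (?P - ?y) \<le> K * h"
      using dist K1 by (elim order_trans) auto
    \<comment> \<open>As the chord is at most K h < 1, its square is no larger than itself. Hence
      the inner product exceeds 1/2, the range of \<open>log_factor_near_1\<close>.\<close>
    have "(norm (?P - ?y))\<^sup>2 \<le> norm (?P - ?y) * 1"
      unfolding power2_eq_square using le Kh by (intro mult_left_mono) auto
    then have c: "1 - ?y \<bullet> ?P \<le> K * h / 2"
      using unit_inner_chord[OF y P] le by simp
    have c1: "?y \<bullet> ?P \<le> 1" using unit_inner_bounds[OF y P] by simp
    have "\<bar>log_factor (?y \<bullet> ?P) - 1\<bar> \<le> C * (1 - ?y \<bullet> ?P)"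
      using c Kh c1 by (intro C(2)) auto
    also have "\<dots> \<le> C * (K * h)"
    proof (rule mult_left_mono[OF _ C(1)])
      have "0 \<le> K * h" using K1 h(1) by simp
      with c show "1 - ?y \<bullet> ?P \<le> K * h" by linarith
    qed
    finally have f: "\<bar>log_factor (?y \<bullet> ?P) - 1\<bar> \<le> C * (K * h)" .
    have pos: "0 < ?y \<bullet> ?P" using c Kh by simp
    have "Log_S2 ?y ?P = log_factor (?y \<bullet> ?P) *\<^sub>R snd (lift ?y ?P)"
      using sph_log_eq_log_factor[OF y P pos] by (simp add: Log_S2_eq_sph_log lift_def)
    moreover have "norm (snd (lift ?y ?P)) \<le> norm (lift ?y ?P - (1, 0))"
      using norm_snd_le_norm[of "lift ?y ?P - (1, 0)"] by simp
    ultimately show ?thesis using s dev f pos by auto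
  qed
  \<comment> \<open>The distance is the length of the logarithm: a scalar factor of at most C + 1
    times a projection of length at most K h^(n+1).\<close>
  define B' where "B' = (C + 1) * K"
  show thesis
  proof (rule that[of B' d "\<lambda>s. snd (A s)", OF _ d_pos])
    show "0 \<le> B'" using C(1) K1 by (simp add: B'_def)
    show "snd (A s) = snd (sider_coefficient n (normal_jet (n + 1) \<gamma> a b s))"
      and "snd (A s) \<bullet> \<gamma> s = 0" if "s \<in> {a..b}" for s
      using A(1,2)[OF that] by simp_all
    show "dist_S2 (\<gamma> (\<theta> * h)) (sider (samples \<gamma> h) n i \<theta>) \<le> B' * h ^ (n + 1)"
      if h: "0 < h" "h < d" and st: "stencil_in n a b h i"
        and \<theta>: "of_int i \<le> \<theta>" "\<theta> \<le> of_int (i + int n)" for h i \<theta>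
    proof -
      let ?y = "\<gamma> (\<theta> * h)" and ?P = "sider (samples \<gamma> h) n i \<theta>"
      note * = near[OF h st \<theta>]
      have y: "norm ?y = 1" using * by (intro norm_curve) simp
      have P: "norm ?P = 1" using h(1) st by (rule norm_sider_samples)
      have "K * h < 1" using h K1 by (simp add: d_def field_simps)
      then have "C * (K * h) \<le> C * 1" using C(1) by (intro mult_left_mono) auto
      then have "\<bar>log_factor (?y \<bullet> ?P)\<bar> \<le> C + 1" using * by linarith
      moreover have "norm (Log_S2 ?y ?P) = \<bar>log_factor (?y \<bullet> ?P)\<bar> * norm (snd (lift ?y ?P))"
        using * by simp
      ultimately have le: "norm (Log_S2 ?y ?P) \<le> (C + 1) * (K * h ^ (n + 1))"
        using * C(1) by (auto intro!: mult_mono)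
      moreover have "dist_S2 ?y ?P = norm (Log_S2 ?y ?P)"
        using * norm_sph_log[OF y P] by (simp add: dist_S2_def Log_S2_eq_sph_log)
      ultimately show ?thesis by (simp add: B'_def mult_ac)
    qed
    fix \<epsilon> :: real assume \<epsilon>: "0 < \<epsilon>"
    then have "0 < \<epsilon> / 2" by simp
    from exp[OF this] obtain d1 where d1: "0 < d1" "\<And>h i \<theta>. 0 < h \<Longrightarrow> h < d1 \<Longrightarrow>
       stencil_in n a b h i \<Longrightarrow> of_int i \<le> \<theta> \<Longrightarrow> \<theta> \<le> of_int (i + int n) \<Longrightarrow>
       norm (lift (\<gamma> (\<theta> * h)) (sider (samples \<gamma> h) n i \<theta>) - (1, 0) -
         (h ^ (n + 1) * (\<Prod>j\<in>{i..i + int n}. \<theta> - of_int j)) *\<^sub>R A (\<theta> * h)) \<le> \<epsilon> / 2 * h ^ (n + 1)"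
      by blast
    \<comment> \<open>Replacing the logarithm by the projection costs at most C K h times K h^(n+1).
      Using C + 1 makes \<open>M\<close> positive, so that the step can be restricted by
      \<open>\<epsilon> / 2 / M\<close>.\<close>
    define M where "M = (C + 1) * K * K"
    have M: "0 < M" using C(1) K1 by (simp add: M_def)
    define \<delta> where "\<delta> = min (min d d1) (\<epsilon> / 2 / M)"
    have "norm (Log_S2 (\<gamma> (\<theta> * h)) (sider (samples \<gamma> h) n i \<theta>) -
         (h ^ (n + 1) * (\<Prod>j\<in>{i..i + int n}. \<theta> - of_int j)) *\<^sub>R snd (A (\<theta> * h))) \<le> \<epsilon> * h ^ (n + 1)"
      if h: "0 < h" "h < \<delta>" and st: "stencil_in n a b h i"
        and \<theta>: "of_int i \<le> \<theta>" "\<theta> \<le> of_int (i + int n)" for h i \<theta>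
    proof -
      let ?y = "\<gamma> (\<theta> * h)" and ?P = "sider (samples \<gamma> h) n i \<theta>"
      define E where "E = (h ^ (n + 1) * (\<Prod>j\<in>{i..i + int n}. \<theta> - of_int j)) *\<^sub>R A (\<theta> * h)"
      define f where "f = log_factor (?y \<bullet> ?P)"
      define V where "V = snd (lift ?y ?P)"
      have hd: "h < d" "h < d1" "h < \<epsilon> / 2 / M" using h(2) by (auto simp: \<delta>_def)
      have *: "norm V \<le> K * h ^ (n + 1)" "Log_S2 ?y ?P = f *\<^sub>R V" "\<bar>f - 1\<bar> \<le> C * (K * h)"
        using near[OF h(1) hd(1) st \<theta>] by (auto simp: f_def V_def)
      have "norm (lift ?y ?P - (1, 0) - E) \<le> \<epsilon> / 2 * h ^ (n + 1)"
        unfolding E_def using h(1) hd(2) st \<theta> by (rule d1(2))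
      then have 1: "norm (V - snd E) \<le> \<epsilon> / 2 * h ^ (n + 1)"
        using norm_snd_le_norm[of "lift ?y ?P - (1, 0) - E"] by (simp add: V_def)
      have "norm ((f - 1) *\<^sub>R V) \<le> (C * (K * h)) * (K * h ^ (n + 1))"
        unfolding norm_scaleR using * C(1) K1 h(1) by (intro mult_mono) auto
      also have "\<dots> = (C * K * K * h) * h ^ (n + 1)" by simp
      also have "\<dots> \<le> (M * h) * h ^ (n + 1)"
        using h(1) K1 by (intro mult_right_mono) (auto simp: M_def)
      also have "\<dots> \<le> \<epsilon> / 2 * h ^ (n + 1)"
        using hd(3) M h(1) by (intro mult_right_mono) (auto simp: field_simps)
      finally have 2: "norm ((f - 1) *\<^sub>R V) \<le> \<epsilon> / 2 * h ^ (n + 1)" .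
      have "Log_S2 ?y ?P - snd E = (f - 1) *\<^sub>R V + (V - snd E)"
        by (simp add: *(2) algebra_simps)
      then have "norm (Log_S2 ?y ?P - snd E) \<le> norm ((f - 1) *\<^sub>R V) + norm (V - snd E)"
        by (simp only: norm_triangle_ineq)
      with 1 2 show ?thesis by (simp add: E_def)
    qed
    moreover have "0 < \<delta>" using d_pos d1(1) \<epsilon> M by (simp add: \<delta>_def)
    ultimately show "\<exists>\<delta>>0. \<forall>h i \<theta>. 0 < h \<longrightarrow> h < \<delta> \<longrightarrow> stencil_in n a b h i \<longrightarrow>
       of_int i \<le> \<theta> \<longrightarrow> \<theta> \<le> of_int (i + int n) \<longrightarrow>
       norm (Log_S2 (\<gamma> (\<theta> * h)) (sider (samples \<gamma> h) n i \<theta>) -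
         (h ^ (n + 1) * (\<Prod>j\<in>{i..i + int n}. \<theta> - of_int j)) *\<^sub>R snd (A (\<theta> * h))) \<le> \<epsilon> * h ^ (n + 1)"
      by blast
  qed
qed

end

lemma sphere_curve_of_setting:
  assumes "2 \<le> n" "sider_setting n \<gamma> a b h0 K"
  shows "sphere_curve n \<gamma> a b"
  using assms by unfold_locales (auto simp: sider_setting_def)

text \<open>\<open>A\<close> is bound before the curve and takes only the jet as argument: this is
  how dependence on the jet but not on the shift \<open>i\<close> is expressed. The leading
  coefficient is stated in Peano form, uniformly over the stencils in [a, b], as suits a curve of
  class C^(n+1).\<close>

theorem theorem4:
  fixes n :: nat
  assumes "n \<ge> 2"
  shows
    "(\<forall>\<gamma> a b h0 K. sider_setting n \<gamma> a b h0 K \<longrightarrow>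
        (\<exists>C. \<forall>h i \<theta>. 0 < h \<and> h < h0 \<and> stencil_in n a b h i \<and>
            of_int i \<le> \<theta> \<and> \<theta> \<le> of_int (i + int n) \<longrightarrow>
          dist_S2 (\<gamma> (\<theta> * h)) (sider (samples \<gamma> h) n i \<theta>) \<le> C * h ^ (n + 1))) \<and>
     (\<exists>A :: vec3 list \<Rightarrow> vec3. \<forall>\<gamma> a b h0 K. sider_setting n \<gamma> a b h0 K \<longrightarrow>
        (\<forall>s\<in>{a..b}. A (normal_jet (n + 1) \<gamma> a b s) \<in> tangent_S2 (\<gamma> s)) \<and>
        (\<forall>\<epsilon>>0. \<forall>\<^sub>F h in at_right 0. \<forall>i \<theta>. stencil_in n a b h i \<and>
            of_int i \<le> \<theta> \<and> \<theta> \<le> of_int (i + int n) \<longrightarrow>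
          norm (Log_S2 (\<gamma> (\<theta> * h)) (sider (samples \<gamma> h) n i \<theta>) -
                (h ^ (n + 1) * (\<Prod>j\<in>{i..i + int n}. \<theta> - of_int j)) *\<^sub>R
                  A (normal_jet (n + 1) \<gamma> a b (\<theta> * h)))
            \<le> \<epsilon> * h ^ (n + 1)))"
\<comment> \<open>\<open>snd\<close> discards the component along the base point, leaving the
  tangential part.\<close>
proof (intro conjI exI[of _ "\<lambda>L. snd (sider_coefficient n L)"] allI impI ballI)
  fix \<gamma> a b h0 K assume setting: "sider_setting n \<gamma> a b h0 K"
  interpret sphere_curve n \<gamma> a b using assms setting by (rule sphere_curve_of_setting)
  obtain A B d where B: "0 \<le> B" and d: "0 < d"
    and A: "\<And>s. s \<in> {a..b} \<Longrightarrow> A s = snd (sider_coefficient n (normal_jet (n + 1) \<gamma> a b s))"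
      "\<And>s. s \<in> {a..b} \<Longrightarrow> A s \<bullet> \<gamma> s = 0"
    and le: "\<And>h i \<theta>. 0 < h \<Longrightarrow> h < d \<Longrightarrow> stencil_in n a b h i \<Longrightarrow> of_int i \<le> \<theta> \<Longrightarrow>
       \<theta> \<le> of_int (i + int n) \<Longrightarrow>
       dist_S2 (\<gamma> (\<theta> * h)) (sider (samples \<gamma> h) n i \<theta>) \<le> B * h ^ (n + 1)"
    and exp: "\<And>\<epsilon>. 0 < \<epsilon> \<Longrightarrow> \<exists>\<delta>>0. \<forall>h i \<theta>. 0 < h \<longrightarrow> h < \<delta> \<longrightarrow> stencil_in n a b h i \<longrightarrow>
       of_int i \<le> \<theta> \<longrightarrow> \<theta> \<le> of_int (i + int n) \<longrightarrow>
       norm (Log_S2 (\<gamma> (\<theta> * h)) (sider (samples \<gamma> h) n i \<theta>) -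
         (h ^ (n + 1) * (\<Prod>j\<in>{i..i + int n}. \<theta> - of_int j)) *\<^sub>R A (\<theta> * h)) \<le> \<epsilon> * h ^ (n + 1)"
    by (rule sider_error) blast
  show "\<exists>C. \<forall>h i \<theta>. 0 < h \<and> h < h0 \<and> stencil_in n a b h i \<and>
      of_int i \<le> \<theta> \<and> \<theta> \<le> of_int (i + int n) \<longrightarrow>
      dist_S2 (\<gamma> (\<theta> * h)) (sider (samples \<gamma> h) n i \<theta>) \<le> C * h ^ (n + 1)"
  \<comment> \<open>The expansion covers steps below \<open>d\<close>. For larger steps a spherical
    distance is at most pi, which the second summand dominates once h is at least
    \<open>d\<close>.\<close>
  proof (intro exI[of _ "B + pi / d ^ (n + 1)"] allI impI)
    fix h \<theta> :: real and i :: int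
    assume "0 < h \<and> h < h0 \<and> stencil_in n a b h i \<and> of_int i \<le> \<theta> \<and> \<theta> \<le> of_int (i + int n)"
    then have *: "0 < h" "stencil_in n a b h i" "of_int i \<le> \<theta>" "\<theta> \<le> of_int (i + int n)" by auto
    show "dist_S2 (\<gamma> (\<theta> * h)) (sider (samples \<gamma> h) n i \<theta>) \<le> (B + pi / d ^ (n + 1)) * h ^ (n + 1)"
    proof (cases "h < d")
      case True
      have "B * h ^ (n + 1) \<le> (B + pi / d ^ (n + 1)) * h ^ (n + 1)"
        using *(1) d by (intro mult_right_mono) auto
      with le[OF *(1) True *(2-)] show ?thesis by linarith
    next
      case False
      have "dist_S2 (\<gamma> (\<theta> * h)) (sider (samples \<gamma> h) n i \<theta>) \<le> pi"
        unfolding dist_S2_def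
        using unit_inner_bounds[OF norm_curve[OF stencil_range[OF *]] norm_sider_samples[OF *(1,2)]]
        by (intro arccos_ubound) auto
      also have "pi = pi / d ^ (n + 1) * d ^ (n + 1)" using d by simp
      also have "\<dots> \<le> (B + pi / d ^ (n + 1)) * h ^ (n + 1)"
        using False B d by (intro mult_mono power_mono) auto
      finally show ?thesis .
    qed
  qed
  show "snd (sider_coefficient n (normal_jet (n + 1) \<gamma> a b s)) \<in> tangent_S2 (\<gamma> s)"
    if "s \<in> {a..b}" for s
    using A[OF that] by (simp add: tangent_S2_def)
  fix \<epsilon> :: real assume "0 < \<epsilon>"
  from exp[OF this] obtain \<delta> where "0 < \<delta>"
    and \<delta>: "\<And>h i \<theta>. 0 < h \<Longrightarrow> h < \<delta> \<Longrightarrow> stencil_in n a b h i \<Longrightarrow>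
       of_int i \<le> \<theta> \<Longrightarrow> \<theta> \<le> of_int (i + int n) \<Longrightarrow>
       norm (Log_S2 (\<gamma> (\<theta> * h)) (sider (samples \<gamma> h) n i \<theta>) -
         (h ^ (n + 1) * (\<Prod>j\<in>{i..i + int n}. \<theta> - of_int j)) *\<^sub>R A (\<theta> * h)) \<le> \<epsilon> * h ^ (n + 1)"
    by blast
  show "\<forall>\<^sub>F h in at_right 0. \<forall>i \<theta>. stencil_in n a b h i \<and>
      of_int i \<le> \<theta> \<and> \<theta> \<le> of_int (i + int n) \<longrightarrow>
      norm (Log_S2 (\<gamma> (\<theta> * h)) (sider (samples \<gamma> h) n i \<theta>) -
        (h ^ (n + 1) * (\<Prod>j\<in>{i..i + int n}. \<theta> - of_int j)) *\<^sub>R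
          snd (sider_coefficient n (normal_jet (n + 1) \<gamma> a b (\<theta> * h))))
        \<le> \<epsilon> * h ^ (n + 1)"
    unfolding eventually_at_right_field
  proof (intro exI[of _ \<delta>] conjI allI impI)
    fix h \<theta> :: real and i :: int
    assume h: "0 < h" "h < \<delta>"
      and *: "stencil_in n a b h i \<and> of_int i \<le> \<theta> \<and> \<theta> \<le> of_int (i + int n)"
    then have "\<theta> * h \<in> {a..b}" by (intro stencil_range) auto
    from \<delta>[OF h, of i \<theta>] * A(1)[OF this]
    show "norm (Log_S2 (\<gamma> (\<theta> * h)) (sider (samples \<gamma> h) n i \<theta>) -
        (h ^ (n + 1) * (\<Prod>j\<in>{i..i + int n}. \<theta> - of_int j)) *\<^sub>R
          snd (sider_coefficient n (normal_jet (n + 1) \<gamma> a b (\<theta> * h))))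
        \<le> \<epsilon> * h ^ (n + 1)" by simp
  qed (rule \<open>0 < \<delta>\<close>)
qed

end
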